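(* Let $n\ge1$ and $d\ge 1$ be integers, let $N=(d-1)^n+1$, and let $B^n\subset\mathbb{R}^n$ be the closed unit ball. Let $U_1,\dots,U_N$ be pairwise nonintersecting compact connected domains in $B^n$ with nonempty interiors, with $n$-dimensional Lebesgue measures $\mu_j=m_n(U_j)$ satisfying $\mu_1\ge\mu_2\ge\dots\ge\mu_N$. Let $Z_j=\partial U_j$ and $Z=\bigcup_{j=1}^N Z_j$. Then $Z$ is $d$-norming, and $$\mathcal{R}_d(Z)\le\left(\frac{4n}{\mu_N}\right)^d .$$
   Context: For a set $Z\subset B^n$ and $d\in\mathbb{N}$, the Remez constant $\mathcal{R}_d(Z)$ is the minimal $K$ (possibly $+\infty$) for which $\sup_{B^n}|P|\le K\sup_Z|P|$ holds for every real polynomial $P(x_1,\dots,x_n)$ of degree $d$ (that is, of degree at most $d$). The set $Z$ is called $d$-norming if $\mathcal{R}_d(Z)<\infty$. *)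

theory Defs
  imports "HOL-Analysis.Analysis"
begin

text \<open>
  Real polynomials of degree at most \<open>d\<close> in the coordinates of \<open>real ^ 'n\<close>, as functions:
  \<open>\<alpha>\<close> ranges over the exponent vectors of the monomials of total degree at most \<open>d\<close>.
\<close>

definition poly_fun_le :: "nat \<Rightarrow> (real ^ 'n \<Rightarrow> real) set" where
  "poly_fun_le d =
     {P. \<exists>c :: ('n \<Rightarrow> nat) \<Rightarrow> real.
        P = (\<lambda>x. \<Sum>\<alpha> | (\<Sum>i\<in>UNIV. \<alpha> i) \<le> d. c \<alpha> * (\<Prod>i\<in>UNIV. x $ i ^ \<alpha> i))}"

lemma finite_exponents_le: "finite {\<alpha> :: 'n::finite \<Rightarrow> nat. (\<Sum>i\<in>UNIV. \<alpha> i) \<le> d}"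
proof (rule finite_subset)
  show "{\<alpha> :: 'n \<Rightarrow> nat. (\<Sum>i\<in>UNIV. \<alpha> i) \<le> d} \<subseteq> PiE UNIV (\<lambda>_. {..d})"
  proof
    fix \<alpha> :: "'n \<Rightarrow> nat"
    assume "\<alpha> \<in> {\<alpha>. (\<Sum>i\<in>UNIV. \<alpha> i) \<le> d}"
    moreover have "\<alpha> i \<le> (\<Sum>i\<in>UNIV. \<alpha> i)" for i
      by (rule member_le_sum) auto
    ultimately have "\<alpha> i \<le> d" for i
      using le_trans by blast
    then show "\<alpha> \<in> PiE UNIV (\<lambda>_. {..d})"
      by (auto simp: PiE_UNIV_domain)
  qed
  show "finite (PiE (UNIV :: 'n set) (\<lambda>_. {..d}))"
    by (intro finite_PiE) auto
qed

text \<open>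
  Suprema are taken in \<open>ennreal\<close>, so that they always exist and the supremum over the empty set
  is \<open>0\<close>. Since \<open>\<infinity> * 0 = 0\<close> in \<open>ennreal\<close>, the set of admissible constants is empty when some
  polynomial of degree at most \<open>d\<close> vanishes on \<open>Z\<close> but not on the ball; the infimum is then \<open>\<infinity>\<close>.
  Otherwise the infimum is attained (lemma \<open>remez_constant_minimal\<close> below).
\<close>

definition remez_constant :: "nat \<Rightarrow> (real ^ 'n) set \<Rightarrow> ennreal" where
  "remez_constant d Z =
     Inf {K. \<forall>P \<in> poly_fun_le d.
       (SUP x\<in>cball 0 1. ennreal \<bar>P x\<bar>) \<le> K * (SUP x\<in>Z. ennreal \<bar>P x\<bar>)}"

definition norming :: "nat \<Rightarrow> (real ^ 'n) set \<Rightarrow> bool" where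
  "norming d Z \<longleftrightarrow> remez_constant d Z < \<infinity>"

lemma remez_constant_minimal:
  fixes Z :: "(real ^ 'n) set"
  assumes "norming d Z" "Z \<subseteq> cball 0 1" "P \<in> poly_fun_le d"
  shows "(SUP x\<in>cball 0 1. ennreal \<bar>P x\<bar>) \<le> remez_constant d Z * (SUP x\<in>Z. ennreal \<bar>P x\<bar>)"
proof -
  let ?A = "{K. \<forall>P \<in> poly_fun_le d. (SUP x\<in>(cball 0 1 :: (real ^ 'n) set). ennreal \<bar>P x\<bar>)
              \<le> K * (SUP x\<in>Z. ennreal \<bar>P x\<bar>)}"
  let ?s = "SUP x\<in>Z. ennreal \<bar>P x\<bar>"
  have "continuous_on (cball 0 1) (\<lambda>x. \<bar>P x\<bar>)"
    using assms(3) by (auto simp: poly_fun_le_def intro!: continuous_intros)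
  then have "bounded ((\<lambda>x. \<bar>P x\<bar>) ` cball 0 1)"
    by (intro compact_imp_bounded compact_continuous_image) auto
  then obtain B where B: "\<And>x. x \<in> cball 0 1 \<Longrightarrow> \<bar>P x\<bar> \<le> B"
    unfolding bounded_iff by fastforce
  have "?s \<le> ennreal B"
    using assms(2) B by (intro SUP_least ennreal_leI) auto
  then have fin: "?s \<noteq> top"
    using ennreal_less_top leD top.not_eq_extremum by metis
  have ne: "?A \<noteq> {}"
  proof
    assume "?A = {}"
    then have "remez_constant d Z = top"
      unfolding remez_constant_def by (simp only: Inf_empty)
    with assms(1) show False by (simp add: norming_def)
  qed
  show ?thesis
  proof (cases "?s = 0")
    case True
    with ne assms(3) show ?thesis by auto
  next
    case False
    have "(SUP x\<in>cball 0 1. ennreal \<bar>P x\<bar>) / ?s \<le> Inf ?A"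
      using assms(3) False fin
      by (intro Inf_greatest) (auto simp: divide_le_posI_ennreal zero_less_iff_neq_zero mult.commute)
    then have "(SUP x\<in>cball 0 1. ennreal \<bar>P x\<bar>) / ?s * ?s \<le> Inf ?A * ?s"
      by (rule mult_right_mono) simp
    moreover have "y / ?s * ?s = y" for y :: ennreal
    proof -
      have "?s / ?s = 1"
        using False fin by (intro ennreal_divide_self) (auto simp only: less_top)
      then have "y * (?s / ?s) = y" by (simp only: mult_1_right)
      then show ?thesis by (simp only: ennreal_times_divide ennreal_divide_times)
    qed
    ultimately show ?thesis
      by (simp only: remez_constant_def)
  qed
qed

end

theory Submission
  imports Defs "HOL-Computational_Algebra.Polynomial"
begin

text \<open>
  Let \<open>\<bar>P\<bar> \<le> 1\<close> on \<open>Z\<close>. Each \<open>U\<^sub>j\<close> either lies in the sublevel set \<open>\<bar>P\<bar> \<le> 1\<close> or contains a local extremum of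
  \<open>P\<close> in its interior. For \<open>d \<ge> 4\<close> and \<open>n \<ge> 2\<close> a small perturbation makes all critical points nondegenerate,
  and the Bezoutian of the gradient shows that at most \<open>(d - 1)\<^sup>n - n - 1\<close> of the sets can contain an
  extremum; for \<open>d = 3\<close> there are at most one maximum and one minimum, because \<open>P\<close> would oscillate too often on
  the line through two maxima. Hence many disjoint sets of measure at least \<open>\<mu>\<^sub>N\<close> lie in the sublevel set.
  The one-variable Remez inequality on the segments from a point \<open>x\<close> of the ball bounds the measure of the
  sublevel set in terms of \<open>\<bar>P x\<bar>\<close>, and comparison with the volume of the ball gives the estimate. For \<open>d \<le> 2\<close>
  too few sets are available, and the fibres of the sets in the direction of the fastest change of \<open>P\<close> are
  used in addition; for \<open>n = 1\<close> one interpolates at endpoints of the intervals.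
\<close>

subsection \<open>Polynomial functions on \<open>\<real>\<^sup>n\<close>\<close>

text \<open>The obstacle is the volume of the unit ball, which exceeds 5 in dimensions five and six.
  One set of measure \<mu> inside the sublevel set gives, through segments and volumes, only the
  base 4 n vol(B) / \<mu> in place of 4 n / \<mu>, and Bezout's bound (d - 1)^n on the number of
  critical points would leave just one set. So more sets than vol(B) have to be free of extrema, and
  the count must save n + 1 over Bezout. The saving comes from signs: the Hessian determinants at
  extrema, multiplied by the trace in odd dimension, are all positive, and a sum of squares then
  forbids a nonzero linear functional on the extrema that kills all polynomials of degree at most n
  (d - 2) - 2. This multiplies by an affine function and the trace, and the degrees leave room for
  that in every dimension only from d = 4 on. For d = 3 the 2^n - 1 remaining sets fall short of
  \<pi> when n = 2; the factor 1/2 in the one-variable inequality makes up for it. For d \<le> 2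
  there are only one or two sets, and explicit constants have to be balanced, whence thresholds such
  as 0.72.\<close>

definition monom_fun :: "('n::finite \<Rightarrow> nat) \<Rightarrow> real ^ 'n \<Rightarrow> real" where
  "monom_fun \<alpha> x = (\<Prod>i\<in>UNIV. x $ i ^ \<alpha> i)"

lemma poly_fun_le_iff:
  "P \<in> poly_fun_le d \<longleftrightarrow>
    (\<exists>c. P = (\<lambda>x. \<Sum>\<alpha> | (\<Sum>i\<in>UNIV. \<alpha> i) \<le> d. c \<alpha> * monom_fun \<alpha> x))"
  by (simp add: poly_fun_le_def monom_fun_def)

lemma poly_fun_le_add [intro]:
  assumes "f \<in> poly_fun_le d" "g \<in> poly_fun_le d"
  shows "(\<lambda>x. f x + g x) \<in> poly_fun_le d"
proof -
  obtain a b where "f = (\<lambda>x. \<Sum>\<alpha> | (\<Sum>i\<in>UNIV. \<alpha> i) \<le> d. a \<alpha> * monom_fun \<alpha> x)"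
      "g = (\<lambda>x. \<Sum>\<alpha> | (\<Sum>i\<in>UNIV. \<alpha> i) \<le> d. b \<alpha> * monom_fun \<alpha> x)"
    using assms by (auto simp: poly_fun_le_iff)
  then show ?thesis
    unfolding poly_fun_le_iff
    by (intro exI[of _ "\<lambda>\<alpha>. a \<alpha> + b \<alpha>"]) (simp add: sum.distrib algebra_simps)
qed

lemma poly_fun_le_cmult [intro]:
  assumes "f \<in> poly_fun_le d"
  shows "(\<lambda>x. c * f x) \<in> poly_fun_le d"
proof -
  obtain a where "f = (\<lambda>x. \<Sum>\<alpha> | (\<Sum>i\<in>UNIV. \<alpha> i) \<le> d. a \<alpha> * monom_fun \<alpha> x)"
    using assms by (auto simp: poly_fun_le_iff)
  then show ?thesis
    unfolding poly_fun_le_iff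
    by (intro exI[of _ "\<lambda>\<alpha>. c * a \<alpha>"]) (simp add: sum_distrib_left algebra_simps)
qed

lemma poly_fun_le_zero [intro, simp]: "(\<lambda>x. 0) \<in> poly_fun_le d"
  unfolding poly_fun_le_iff by (intro exI[of _ "\<lambda>_. 0"]) simp

lemma poly_fun_le_sum [intro]:
  assumes "\<And>i. i \<in> I \<Longrightarrow> f i \<in> poly_fun_le d"
  shows "(\<lambda>x. \<Sum>i\<in>I. f i x) \<in> poly_fun_le d"
  using assms by (induction I rule: infinite_finite_induct) auto

lemma monom_fun_in_poly_fun_le:
  assumes "(\<Sum>i\<in>UNIV. \<alpha> i) \<le> d"
  shows "monom_fun \<alpha> \<in> poly_fun_le d"
proof -
  have "(\<Sum>\<beta> | (\<Sum>i\<in>UNIV. \<beta> i) \<le> d. (if \<beta> = \<alpha> then 1 else 0) * monom_fun \<beta> x)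
      = (\<Sum>\<beta> | (\<Sum>i\<in>UNIV. \<beta> i) \<le> d. if \<beta> = \<alpha> then monom_fun \<alpha> x else 0)" for x
    by (rule sum.cong) auto
  then have "(\<Sum>\<beta> | (\<Sum>i\<in>UNIV. \<beta> i) \<le> d. (if \<beta> = \<alpha> then 1 else 0) * monom_fun \<beta> x) = monom_fun \<alpha> x" for x
    using assms by (simp only:) (simp add: sum.delta[OF finite_exponents_le])
  then show ?thesis
    unfolding poly_fun_le_iff by (intro exI[of _ "\<lambda>\<beta>. if \<beta> = \<alpha> then 1 else 0"]) (simp add: fun_eq_iff)
qed

text \<open>Every property that is stable under linear combinations can be checked on monomials, so
  most closure proofs never touch coefficient families.\<close>

lemma poly_fun_le_induct [consumes 1, case_names monom zero add cmult]:
  assumes f: "f \<in> poly_fun_le d"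
    and monom: "\<And>\<alpha>. (\<Sum>i\<in>UNIV. \<alpha> i) \<le> d \<Longrightarrow> Q (monom_fun \<alpha>)"
    and zero: "Q (\<lambda>x. 0)"
    and add: "\<And>f g. Q f \<Longrightarrow> Q g \<Longrightarrow> Q (\<lambda>x. f x + g x)"
    and cmult: "\<And>c f. Q f \<Longrightarrow> Q (\<lambda>x. c * f x)"
  shows "Q f"
proof -
  obtain a where a: "f = (\<lambda>x. \<Sum>\<alpha> | (\<Sum>i\<in>UNIV. \<alpha> i) \<le> d. a \<alpha> * monom_fun \<alpha> x)"
    using f by (auto simp: poly_fun_le_iff)
  have "Q (\<lambda>x. \<Sum>\<alpha>\<in>S. a \<alpha> * monom_fun \<alpha> x)" if "S \<subseteq> {\<alpha>. (\<Sum>i\<in>UNIV. \<alpha> i) \<le> d}" for S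
    using finite_subset[OF that finite_exponents_le] that
    by (induction S rule: finite_induct) (auto intro!: zero add cmult monom)
  then show ?thesis by (simp add: a)
qed

lemma poly_fun_le_mono:
  assumes "f \<in> poly_fun_le d" "d \<le> e"
  shows "f \<in> poly_fun_le e"
  using assms(1) by (induction rule: poly_fun_le_induct) (use assms(2) in \<open>auto intro: monom_fun_in_poly_fun_le\<close>)

lemma monom_fun_mult: "monom_fun \<alpha> x * monom_fun \<beta> x = monom_fun (\<lambda>i. \<alpha> i + \<beta> i) x"
  by (simp add: monom_fun_def power_add prod.distrib)

lemma poly_fun_le_mult:
  assumes "f \<in> poly_fun_le d" "g \<in> poly_fun_le e"
  shows "(\<lambda>x. f x * g x) \<in> poly_fun_le (d + e)"
  using assms(1)
proof (induction rule: poly_fun_le_induct)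
  case (monom \<alpha>)
  note \<alpha> = monom
  from assms(2) show ?case
  proof (induction rule: poly_fun_le_induct)
    case (monom \<beta>)
    then show ?case
      using \<alpha> by (auto simp: monom_fun_mult sum.distrib intro!: monom_fun_in_poly_fun_le[unfolded fun_eq_iff])
  next
    case (cmult c f)
    then show ?case using poly_fun_le_cmult[of _ "d + e" c] by (simp add: mult_ac)
  qed (auto simp: algebra_simps)
next
  case (cmult c f)
  then show ?case using poly_fun_le_cmult[of _ "d + e" c] by (simp add: mult_ac)
qed (auto simp: algebra_simps)

lemma poly_fun_le_const [intro, simp]: "(\<lambda>x. c) \<in> poly_fun_le d"
proof -
  have "monom_fun (\<lambda>_. 0) \<in> poly_fun_le d"
    by (rule monom_fun_in_poly_fun_le) simp
  from poly_fun_le_cmult[OF this, of c] show ?thesis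
    by (simp add: monom_fun_def)
qed

lemma coord_in_poly_fun_le: "(\<lambda>x. x $ i) \<in> poly_fun_le 1"
proof -
  have "(\<lambda>x. x $ i) = monom_fun (\<lambda>j. if j = i then 1 else 0)"
    by (auto simp: monom_fun_def fun_eq_iff if_distrib prod.delta cong: if_cong)
  also have "\<dots> \<in> poly_fun_le 1"
    by (rule monom_fun_in_poly_fun_le) simp
  finally show ?thesis .
qed

lemma inner_in_poly_fun_le: "(\<lambda>x. v \<bullet> x) \<in> poly_fun_le 1"
  unfolding inner_vec_def inner_real_def
  by (intro poly_fun_le_sum poly_fun_le_cmult coord_in_poly_fun_le)

lemma poly_fun_le_uminus [intro]: "f \<in> poly_fun_le d \<Longrightarrow> (\<lambda>x. - f x) \<in> poly_fun_le d"
  using poly_fun_le_cmult[of f d "-1"] by simp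

lemma coord_power_in_poly_fun_le: "(\<lambda>x. x $ i ^ k) \<in> poly_fun_le k"
proof (induction k)
  case (Suc k)
  from poly_fun_le_mult[OF coord_in_poly_fun_le[of i] this] show ?case by simp
qed auto

lemma continuous_on_poly_fun_le: "f \<in> poly_fun_le d \<Longrightarrow> continuous_on S f"
  by (induction rule: poly_fun_le_induct)
     (auto simp: monom_fun_def[abs_def] intro!: continuous_intros)

lemma poly_fun_le_line:
  assumes "f \<in> poly_fun_le d"
  obtains p :: "real poly" where "degree p \<le> d" "\<And>t. poly p t = f (x + t *\<^sub>R h)"
proof -
  from assms have "\<exists>p :: real poly. degree p \<le> d \<and> (\<forall>t. poly p t = f (x + t *\<^sub>R h))"
  proof (induction rule: poly_fun_le_induct)
    case (monom \<alpha>)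
    let ?p = "\<Prod>i\<in>UNIV. [:x $ i, h $ i:] ^ \<alpha> i"
    have "degree ?p \<le> (\<Sum>i\<in>UNIV. degree ([:x $ i, h $ i:] ^ \<alpha> i))"
      using degree_prod_sum_le[of UNIV "\<lambda>i. [:x $ i, h $ i:] ^ \<alpha> i"] by (simp add: o_def)
    also have "\<dots> \<le> (\<Sum>i\<in>UNIV. \<alpha> i)"
    proof (rule sum_mono)
      fix i
      have "degree ([:x $ i, h $ i:] ^ \<alpha> i) \<le> degree [:x $ i, h $ i:] * \<alpha> i"
        by (rule degree_power_le)
      also have "\<dots> \<le> 1 * \<alpha> i"
        by (intro mult_right_mono) (auto)
      finally show "degree ([:x $ i, h $ i:] ^ \<alpha> i) \<le> \<alpha> i" by simp
    qed
    finally have "degree ?p \<le> d" using monom by simp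
    moreover have "poly ?p t = monom_fun \<alpha> (x + t *\<^sub>R h)" for t
      by (simp add: poly_prod monom_fun_def)
    ultimately show ?case by blast
  next
    case zero
    then show ?case by (intro exI[of _ 0]) simp
  next
    case (add f g)
    then obtain p q where "degree p \<le> d" "degree q \<le> d"
      "\<forall>t. poly p t = f (x + t *\<^sub>R h)" "\<forall>t. poly q t = g (x + t *\<^sub>R h)" by auto
    then show ?case by (intro exI[of _ "p + q"]) (auto intro: degree_add_le)
  next
    case (cmult c f)
    then obtain p where "degree p \<le> d" "\<forall>t. poly p t = f (x + t *\<^sub>R h)" by auto
    then show ?case
      by (intro exI[of _ "smult c p"]) (auto intro: order_trans[OF degree_smult_le])
  qed
  with that show ?thesis by blast
qed

lemma poly_fun_le_0:
  assumes "f \<in> poly_fun_le 0"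
  obtains c where "f = (\<lambda>x. c)"
proof -
  from assms have "\<exists>c. f = (\<lambda>x. c)"
  proof (induction rule: poly_fun_le_induct)
    case (monom \<alpha>)
    then have "monom_fun \<alpha> = (\<lambda>x. 1)" by (auto simp: monom_fun_def fun_eq_iff)
    then show ?case by blast
  qed auto
  with that show ?thesis by blast
qed

text \<open>Each nonconstant monomial gives up one factor \<open>x $ k\<close>, where
  \<open>k\<close> is any variable that occurs in it. This provides induction on the degree; the
  cofactors \<open>F i\<close> are not unique.\<close>

lemma poly_fun_le_Suc:
  assumes "f \<in> poly_fun_le (Suc d)"
  obtains c F where "\<And>i. F i \<in> poly_fun_le d" "f = (\<lambda>x. c + (\<Sum>i\<in>UNIV. x $ i * F i x))"
proof -
  from assms have "\<exists>c F. (\<forall>i. F i \<in> poly_fun_le d) \<and> f = (\<lambda>x. c + (\<Sum>i\<in>UNIV. x $ i * F i x))"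
  proof (induction rule: poly_fun_le_induct)
    case (monom \<alpha>)
    show ?case
    proof (cases "\<alpha> = (\<lambda>_. 0)")
      case True
      then show ?thesis
        by (intro exI[of _ 1] exI[of _ "\<lambda>_ _. 0"]) (auto simp: monom_fun_def)
    next
      case False
      then obtain k where k: "\<alpha> k > 0" by auto
      define \<beta> where "\<beta> = \<alpha>(k := \<alpha> k - 1)"
      define \<delta> where "\<delta> = (\<lambda>i. if i = k then 1 else 0 :: nat)"
      have \<alpha>: "\<alpha> = (\<lambda>i. \<delta> i + \<beta> i)" using k by (auto simp: \<beta>_def \<delta>_def)
      have "(\<Sum>i\<in>UNIV. \<alpha> i) = 1 + (\<Sum>i\<in>UNIV. \<beta> i)"
        by (subst \<alpha>) (simp add: sum.distrib \<delta>_def)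
      then have "monom_fun \<beta> \<in> poly_fun_le d"
        using monom by (intro monom_fun_in_poly_fun_le) simp
      moreover have "monom_fun \<delta> x = x $ k" for x
        by (auto simp: monom_fun_def \<delta>_def if_distrib prod.delta cong: if_cong)
      then have "monom_fun \<alpha> x = x $ k * monom_fun \<beta> x" for x
        by (subst \<alpha>) (simp flip: monom_fun_mult)
      moreover have "x $ i * (if i = k then monom_fun \<beta> x else 0) = (if i = k then x $ k * monom_fun \<beta> x else 0)" for i x
        by simp
      moreover have "(\<lambda>x. if i = k then monom_fun \<beta> x else 0) \<in> poly_fun_le d" for i
        using calculation(1) by (cases "i = k") auto
      ultimately show ?thesis
        by (intro exI[of _ 0] exI[of _ "\<lambda>i x. if i = k then monom_fun \<beta> x else 0"])
           (simp add: fun_eq_iff sum.delta)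
    qed
  next
    case zero
    show ?case by (intro exI[of _ 0] exI[of _ "\<lambda>_ _. 0"]) auto
  next
    case (add f g)
    then obtain c1 F1 c2 F2 where "\<forall>i. F1 i \<in> poly_fun_le d" "f = (\<lambda>x. c1 + (\<Sum>i\<in>UNIV. x $ i * F1 i x))"
      "\<forall>i. F2 i \<in> poly_fun_le d" "g = (\<lambda>x. c2 + (\<Sum>i\<in>UNIV. x $ i * F2 i x))"
      by blast
    then show ?case
      by (intro exI[of _ "c1 + c2"] exI[of _ "\<lambda>i x. F1 i x + F2 i x"])
         (auto simp: algebra_simps sum.distrib)
  next
    case (cmult a f)
    then obtain c F where "\<forall>i. F i \<in> poly_fun_le d" "f = (\<lambda>x. c + (\<Sum>i\<in>UNIV. x $ i * F i x))"
      by blast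
    then show ?case
      by (intro exI[of _ "a * c"] exI[of _ "\<lambda>i x. a * F i x"])
         (auto simp: algebra_simps sum_distrib_left)
  qed
  with that show ?thesis by blast
qed

lemma poly_fun_le_1:
  assumes "f \<in> poly_fun_le 1"
  obtains c g where "f = (\<lambda>x. c + g \<bullet> x)"
proof -
  have "f \<in> poly_fun_le (Suc 0)" using assms by simp
  then obtain c F where F: "\<And>i. F i \<in> poly_fun_le 0" "f = (\<lambda>x. c + (\<Sum>i\<in>UNIV. x $ i * F i x))"
    using poly_fun_le_Suc by blast
  have "\<exists>a. F i = (\<lambda>x. a)" for i using F(1) poly_fun_le_0 by metis
  then obtain a where "\<And>i. F i = (\<lambda>x. a i)" by metis
  with F(2) have "f = (\<lambda>x. c + (\<chi> i. a i) \<bullet> x)"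
    by (simp add: inner_vec_def mult.commute)
  with that show ?thesis by blast
qed

lemma poly_fun_le_2:
  fixes f :: "real ^ 'n \<Rightarrow> real"
  assumes "f \<in> poly_fun_le 2"
  obtains c g and M :: "real ^ 'n ^ 'n" where "f = (\<lambda>x. c + g \<bullet> x + x \<bullet> (M *v x))"
proof -
  have "f \<in> poly_fun_le (Suc 1)" using assms by (simp add: numeral_2_eq_2)
  then obtain c F where F: "\<And>i. F i \<in> poly_fun_le 1" "f = (\<lambda>x. c + (\<Sum>i\<in>UNIV. x $ i * F i x))"
    using poly_fun_le_Suc by blast
  have "\<exists>a g. F i = (\<lambda>x. a + g \<bullet> x)" for i using F(1) poly_fun_le_1 by metis
  then obtain a g where "\<And>i. F i = (\<lambda>x. a i + g i \<bullet> x)" by metis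
  with F(2) have "f = (\<lambda>x. c + (\<chi> i. a i) \<bullet> x + x \<bullet> ((\<chi> i. g i) *v x))"
    by (simp add: inner_vec_def matrix_vector_mult_def sum.distrib algebra_simps)
  with that show ?thesis by blast
qed

subsection \<open>The Remez inequality in one variable\<close>

lemma lagrange_interpolation:
  fixes p :: "real poly" and x :: "'i \<Rightarrow> real"
  assumes "finite I" "inj_on x I" "degree p < card I"
  shows "p = (\<Sum>i\<in>I. smult (poly p (x i) / (\<Prod>j\<in>I-{i}. x i - x j)) (\<Prod>j\<in>I-{i}. [:- x j, 1:]))"
    (is "p = ?q")
proof -
  let ?l = "\<lambda>i. \<Prod>j\<in>I-{i}. [:- x j, 1:]"
  have "degree (smult a (?l i)) < card I" if "i \<in> I" for a i
  proof -
    have "degree (?l i) \<le> (\<Sum>j\<in>I-{i}. degree [:- x j, 1:])"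
      using degree_prod_sum_le[of "I-{i}" "\<lambda>j. [:- x j, 1:]"] assms(1) by (simp add: o_def)
    also have "\<dots> = card (I - {i})" by simp
    also have "\<dots> < card I" using assms(1) that by (intro psubset_card_mono) auto
    finally show ?thesis using degree_smult_le[of a "?l i"] by linarith
  qed
  moreover have "0 < card I" using assms(3) by simp
  ultimately have dq: "degree ?q < card I"
    by (intro degree_sum_less) blast+
  have "poly ?q (x k) = poly p (x k)" if k: "k \<in> I" for k
  proof -
    have "poly (smult a (?l i)) (x k) = (if i = k then a * (\<Prod>j\<in>I-{k}. x k - x j) else 0)"
      if "i \<in> I" for a i
    proof (cases "i = k")
      case True
      then show ?thesis by (simp add: poly_prod)
    next
      case False
      then have "poly (?l i) (x k) = 0"
        using assms(1) k by (auto simp: poly_prod prod_zero_iff)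
      then show ?thesis using False by simp
    qed
    moreover have "(\<Prod>j\<in>I-{k}. x k - x j) \<noteq> 0"
      using assms(1,2) k by (auto simp: prod_zero_iff inj_on_def)
    moreover from calculation(1) have "poly ?q (x k)
        = (\<Sum>i\<in>I. if i = k then poly p (x i) / (\<Prod>j\<in>I-{i}. x i - x j) * (\<Prod>j\<in>I-{k}. x k - x j) else 0)"
      unfolding poly_sum by (intro sum.cong) auto
    ultimately show ?thesis
      using k assms(1) by (simp add: sum.delta)
  qed
  then show ?thesis
    using assms(2,3) dq card_image[OF assms(2)]
    by (intro poly_eqI_degree[of "x ` I"]) auto
qed

lemma lagrange_poly_eq:
  fixes p :: "real poly" and x :: "'i \<Rightarrow> real"
  assumes "finite I" "inj_on x I" "degree p < card I"
  shows "poly p y = (\<Sum>i\<in>I. poly p (x i) * (\<Prod>j\<in>I-{i}. (y - x j) / (x i - x j)))"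
  by (subst lagrange_interpolation[OF assms])
     (simp add: poly_sum poly_prod prod_dividef)

text \<open>Numerators are bounded crudely by \<open>r\<close>, but the denominators are kept, since
  they will be compared with those of extremal nodes.\<close>

lemma lagrange_bound:
  fixes p :: "real poly" and x :: "'i \<Rightarrow> real"
  assumes "finite I" "inj_on x I" "degree p < card I"
    and "\<And>i. i \<in> I \<Longrightarrow> \<bar>poly p (x i)\<bar> \<le> 1" "\<And>i. i \<in> I \<Longrightarrow> \<bar>y - x i\<bar> \<le> r"
  shows "\<bar>poly p y\<bar> \<le> (\<Sum>i\<in>I. r ^ (card I - 1) / (\<Prod>j\<in>I-{i}. \<bar>x i - x j\<bar>))"
proof -
  have "\<bar>poly p y\<bar> \<le> (\<Sum>i\<in>I. \<bar>poly p (x i) * (\<Prod>j\<in>I-{i}. (y - x j) / (x i - x j))\<bar>)"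
    unfolding lagrange_poly_eq[OF assms(1-3), of y] by (rule sum_abs)
  also have "\<dots> \<le> (\<Sum>i\<in>I. r ^ (card I - 1) / (\<Prod>j\<in>I-{i}. \<bar>x i - x j\<bar>))"
  proof (rule sum_mono)
    fix i assume i: "i \<in> I"
    have "\<bar>poly p (x i) * (\<Prod>j\<in>I-{i}. (y - x j) / (x i - x j))\<bar>
        = \<bar>poly p (x i)\<bar> * ((\<Prod>j\<in>I-{i}. \<bar>y - x j\<bar>) / (\<Prod>j\<in>I-{i}. \<bar>x i - x j\<bar>))"
      by (simp add: abs_mult abs_prod prod_dividef)
    also have "\<dots> \<le> 1 * ((\<Prod>j\<in>I-{i}. r) / (\<Prod>j\<in>I-{i}. \<bar>x i - x j\<bar>))"
      using assms(4,5) i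
      by (intro mult_mono divide_right_mono prod_mono divide_nonneg_nonneg prod_nonneg) auto
    finally show "\<bar>poly p (x i) * (\<Prod>j\<in>I-{i}. (y - x j) / (x i - x j))\<bar>
        \<le> r ^ (card I - 1) / (\<Prod>j\<in>I-{i}. \<bar>x i - x j\<bar>)"
      using i assms(1) by simp
  qed
  finally show ?thesis .
qed

section \<open>Chebyshev polynomials and their extrema\<close>

fun cheb :: "nat \<Rightarrow> real poly" where
  "cheb 0 = 1"
| "cheb (Suc 0) = [:0, 1:]"
| "cheb (Suc (Suc k)) = [:0, 2:] * cheb (Suc k) - cheb k"

lemma poly_cheb_cos: "poly (cheb k) (cos \<theta>) = cos (real k * \<theta>)"
proof (induction k rule: cheb.induct)
  case (3 k)
  have "cos (real (Suc (Suc k)) * \<theta>) + cos (real k * \<theta>) = 2 * cos \<theta> * cos (real (Suc k) * \<theta>)"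
    using cos_add[of "real (Suc k) * \<theta>" \<theta>] cos_diff[of "real (Suc k) * \<theta>" \<theta>]
    by (simp add: algebra_simps)
  with 3 show ?case by (simp add: algebra_simps)
qed auto

lemma degree_cheb_le: "degree (cheb k) \<le> k"
proof (induction k rule: cheb.induct)
  case (3 k)
  have "degree ([:0, 2:] * cheb (Suc k)) \<le> Suc (Suc k)"
    using degree_mult_le[of "[:0, 2:]" "cheb (Suc k)"] 3 by simp
  with 3 show ?case
    by (auto intro!: degree_diff_le)
qed auto

lemma coeff_cheb: "coeff (cheb (Suc k)) (Suc k) = 2 ^ k"
proof (induction k)
  case (Suc k)
  have "coeff (cheb k) (Suc (Suc k)) = 0"
    using degree_cheb_le[of k] by (intro coeff_eq_0) simp
  with Suc show ?case by (simp add: coeff_pCons split: nat.split)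
qed auto

lemma coeff_prod_linear:
  fixes x :: "'i \<Rightarrow> real"
  assumes "finite I"
  shows "coeff (\<Prod>j\<in>I. [:- x j, 1:]) (card I) = 1"
proof -
  have "degree (\<Prod>j\<in>I. [:- x j, 1:]) = card I"
    by (subst degree_prod_eq_sum_degree) auto
  moreover have "lead_coeff (\<Prod>j\<in>I. [:- x j, 1:]) = 1"
    by (simp add: lead_coeff_prod)
  ultimately show ?thesis by simp
qed

text \<open>Comparison of coefficients in Lagrange's formula, whose numerator polynomials are monic
  of degree \<open>d\<close>.\<close>

lemma lagrange_lead_coeff:
  fixes p :: "real poly" and x :: "'i \<Rightarrow> real"
  assumes "finite I" "inj_on x I" "degree p \<le> d" "card I = Suc d"
  shows "coeff p d = (\<Sum>i\<in>I. poly p (x i) / (\<Prod>j\<in>I-{i}. x i - x j))"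
proof -
  have "coeff (\<Prod>j\<in>I-{i}. [:- x j, 1:]) d = 1" if "i \<in> I" for i
    using coeff_prod_linear[of "I-{i}" x] that assms(1,4) by simp
  then have "coeff (\<Sum>i\<in>I. smult (poly p (x i) / (\<Prod>j\<in>I-{i}. x i - x j)) (\<Prod>j\<in>I-{i}. [:- x j, 1:])) d
     = (\<Sum>i\<in>I. poly p (x i) / (\<Prod>j\<in>I-{i}. x i - x j))"
    by (simp add: coeff_sum)
  with lagrange_interpolation[OF assms(1,2), of p] assms(3,4) show ?thesis by simp
qed

text \<open>The leading coefficient of the Chebyshev polynomial, computed by interpolation at its
  extrema, where all terms have the same sign.\<close>
lemma cheb_nodes_sum:
  assumes "d \<ge> 1"
  defines "c \<equiv> \<lambda>i. cos (real i * pi / real d)"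
  shows "(\<Sum>i\<le>d. 1 / (\<Prod>j\<in>{..d}-{i}. \<bar>c i - c j\<bar>)) = 2 ^ (d - 1)"
proof -
  have dec: "c j < c i" if "i < j" "j \<le> d" for i j
    unfolding c_def using that assms(1)
    by (intro cos_monotone_0_pi) (auto simp: divide_simps)
  have inj: "inj_on c {..d}"
    by (rule inj_onI) (metis atMost_iff dec less_irrefl linorder_neqE_nat)
  obtain k where k: "d = Suc k" using assms(1) by (cases d) auto
  have val: "poly (cheb d) (c i) = (-1) ^ i" for i
    using assms(1) by (simp add: c_def poly_cheb_cos cos_npi)
  \<comment> \<open>The nodes decrease with the index, so exactly the \<open>i\<close> factors with
    \<open>j < i\<close> are negative; the sign cancels against the value \<open>(-1) ^ i\<close> of
    \<open>cheb d\<close> at the node.\<close>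
  have sgn: "(\<Prod>j\<in>{..d}-{i}. c i - c j) = (-1) ^ i * (\<Prod>j\<in>{..d}-{i}. \<bar>c i - c j\<bar>)" if "i \<le> d" for i
  proof -
    have split: "{..d}-{i} = {..<i} \<union> {i<..d}" using that by auto
    have "(\<Prod>j<i. c i - c j) = (\<Prod>j<i. - \<bar>c i - c j\<bar>)"
      using dec that by (intro prod.cong) (auto simp: less_imp_le abs_if)
    also have "\<dots> = (-1) ^ i * (\<Prod>j<i. \<bar>c i - c j\<bar>)"
      by (simp add: prod_uminus)
    finally have 1: "(\<Prod>j<i. c i - c j) = (-1) ^ i * (\<Prod>j<i. \<bar>c i - c j\<bar>)" .
    have 2: "(\<Prod>j\<in>{i<..d}. c i - c j) = (\<Prod>j\<in>{i<..d}. \<bar>c i - c j\<bar>)"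
    proof (rule prod.cong)
      show "c i - c j = \<bar>c i - c j\<bar>" if "j \<in> {i<..d}" for j
        using dec[of i j] that by simp
    qed simp
    show ?thesis unfolding split
      by (subst (1 2) prod.union_disjoint) (auto simp: 1 2)
  qed
  have "2 ^ (d - 1) = coeff (cheb d) d" by (simp add: k coeff_cheb del: cheb.simps)
  also have "\<dots> = (\<Sum>i\<le>d. poly (cheb d) (c i) / (\<Prod>j\<in>{..d}-{i}. c i - c j))"
    by (rule lagrange_lead_coeff[OF _ inj]) (auto simp: degree_cheb_le)
  also have "\<dots> = (\<Sum>i\<le>d. 1 / (\<Prod>j\<in>{..d}-{i}. \<bar>c i - c j\<bar>))"
    by (rule sum.cong) (auto simp: val sgn)
  finally show ?thesis by simp
qed

text \<open>A greedy choice from the left: each new point is the least point of \<open>E\<close>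
  beyond the prescribed gap. The part of \<open>E\<close> left of it has measure at most the sum of
  the gaps so far, so \<open>E\<close> is not exhausted before \<open>d + 1\<close> points are
  found.\<close>

lemma spaced_points:
  fixes E :: "real set" and \<xi> :: "nat \<Rightarrow> real"
  assumes E: "compact E" and mono: "\<And>i. \<xi> i \<le> \<xi> (Suc i)" and "\<xi> 0 = 0"
    and "\<xi> d < measure lebesgue E"
  shows "\<exists>x. (\<forall>i\<le>d. x i \<in> E) \<and> (\<forall>i<d. \<xi> (Suc i) - \<xi> i \<le> x (Suc i) - x i)"
proof -
  have "k \<le> d \<Longrightarrow> \<exists>x. (\<forall>i\<le>k. x i \<in> E) \<and> (\<forall>i<k. \<xi> (Suc i) - \<xi> i \<le> x (Suc i) - x i)
      \<and> measure lebesgue (E \<inter> {..<x k}) \<le> \<xi> k" for k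
  proof (induction k)
    case 0
    have "mono \<xi>" using mono by (rule mono_iff_le_Suc[THEN iffD2, rule_format])
    then have "0 < measure lebesgue E" using monoD[of \<xi> 0 d] assms(3,4) by simp
    then have "E \<noteq> {}" by auto
    then obtain m where m: "m \<in> E" "\<forall>y\<in>E. m \<le> y"
      using compact_attains_inf[OF E] by auto
    then have "E \<inter> {..<m} = {}" by force
    with m assms(3) show ?case by (intro exI[of _ "\<lambda>_. m"]) simp
  next
    case (Suc k)
    then obtain x where x: "\<forall>i\<le>k. x i \<in> E" "\<forall>i<k. \<xi> (Suc i) - \<xi> i \<le> x (Suc i) - x i"
      "measure lebesgue (E \<inter> {..<x k}) \<le> \<xi> k" by auto
    define z where "z = x k + (\<xi> (Suc k) - \<xi> k)"
    have lm: "E \<inter> {..<y} \<in> lmeasurable" for y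
      using lmeasurable_compact[OF E] by (intro fmeasurable_Int_fmeasurable) auto
    have meas: "measure lebesgue (E \<inter> {..<z}) \<le> \<xi> (Suc k)"
    proof -
      have "measure lebesgue (E \<inter> {..<z}) \<le> measure lebesgue ((E \<inter> {..<x k}) \<union> {x k..z})"
        using lm by (intro measure_mono_fmeasurable) (auto intro: fmeasurableD)
      also have "\<dots> \<le> measure lebesgue (E \<inter> {..<x k}) + measure lebesgue {x k..z}"
        using lm by (intro measure_Un_le) (auto intro: fmeasurableD)
      also have "\<dots> \<le> \<xi> (Suc k)" using x(3) mono[of k] by (simp add: z_def)
      finally show ?thesis .
    qed
    have "E \<inter> {z..} \<noteq> {}"
    proof
      assume "E \<inter> {z..} = {}"
      then have "E \<inter> {..<z} = E" by force
      with meas have "measure lebesgue E \<le> \<xi> (Suc k)" by simp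
      also have "\<dots> \<le> \<xi> d"
        using lift_Suc_mono_le[of \<xi> "Suc k" d] mono Suc.prems by simp
      finally show False using assms(4) by simp
    qed
    then obtain y where y: "y \<in> E \<inter> {z..}" "\<forall>w\<in>E \<inter> {z..}. y \<le> w"
      using compact_attains_inf[of "E \<inter> {z..}"] E by (auto simp: compact_Int_closed)
    have "E \<inter> {..<y} = E \<inter> {..<z}"
      using y by force
    then show ?case
      using x y meas
      by (intro exI[of _ "x(Suc k := y)"]) (auto simp: z_def le_Suc_eq less_Suc_eq)
  qed
  from this[of d] show ?thesis by auto
qed

text \<open>A set of measure above \<open>m\<close> contains \<open>d + 1\<close> points that are
  pairwise at least as far apart as the Chebyshev extrema scaled to an interval of length
  \<open>m\<close>. Lagrange's formula at 0, with all numerators at most 1, and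
  \<open>cheb_nodes_sum\<close> give (2 / m)^d 2^(d - 1). The resulting factor 1/2 is exploited in
  degree three.\<close>

theorem remez_unit_interval:
  fixes p :: "real poly"
  assumes "degree p \<le> d" "d \<ge> 1" "0 < m"
    and "m < measure lebesgue {s\<in>{0..1}. \<bar>poly p s\<bar> \<le> 1}"
  shows "\<bar>poly p 0\<bar> \<le> (4 / m) ^ d / 2"
proof -
  define E where "E = {s\<in>{0..1}. \<bar>poly p s\<bar> \<le> 1}"
  have "E = {0..1} \<inter> {s. \<bar>poly p s\<bar> \<le> 1}" by (auto simp: E_def)
  moreover have "closed {s. \<bar>poly p s\<bar> \<le> 1}"
    by (intro closed_Collect_le continuous_intros)
  ultimately have E: "compact E" by (auto intro: compact_Int_closed)
  define c where "c = (\<lambda>i. cos (real i * pi / real d))"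
  \<comment> \<open>The cosines are turned into positions that increase from 0 to \<open>m\<close>;
    \<open>min i d\<close> keeps them monotone beyond \<open>d\<close>.\<close>
  define \<xi> where "\<xi> i = m / 2 * (1 - c (min i d))" for i
  have dec: "c j < c i" if "i < j" "j \<le> d" for i j
    unfolding c_def using that assms(2)
    by (intro cos_monotone_0_pi) (auto simp: divide_simps)
  have mono\<xi>: "\<xi> i \<le> \<xi> (Suc i)" for i
  proof (cases "Suc i \<le> d")
    case True
    with dec[of i "Suc i"] assms(3) show ?thesis
      by (auto simp: \<xi>_def intro!: mult_left_mono)
  qed (simp add: \<xi>_def min_def not_less_eq_eq le_antisym)
  have "\<xi> 0 = 0" by (simp add: \<xi>_def c_def)
  moreover have "\<xi> d < measure lebesgue E"
    using assms by (simp add: \<xi>_def c_def E_def)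
  ultimately obtain x where x: "\<And>i. i \<le> d \<Longrightarrow> x i \<in> E"
      "\<And>i. i < d \<Longrightarrow> \<xi> (Suc i) - \<xi> i \<le> x (Suc i) - x i"
    using spaced_points[OF E, of \<xi> d] mono\<xi> by blast
  have gap: "\<xi> j - \<xi> i \<le> x j - x i" if "i \<le> j" "j \<le> d" for i j
    using that
  proof (induction j rule: dec_induct)
    case (step k)
    then show ?case using x(2)[of k] by simp
  qed simp
  have gap2: "m / 2 * \<bar>c i - c j\<bar> \<le> \<bar>x i - x j\<bar>" if "i \<le> d" "j \<le> d" for i j
  proof -
    have *: "m / 2 * \<bar>c i - c j\<bar> \<le> \<bar>x i - x j\<bar>" if "i \<le> j" "j \<le> d" for i j
    proof -
      have "c j \<le> c i" using dec[of i j] that by (cases "i = j") auto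
      then have "m / 2 * \<bar>c i - c j\<bar> = \<xi> j - \<xi> i" using that by (simp add: \<xi>_def algebra_simps diff_divide_distrib)
      then show ?thesis using gap[OF that] by linarith
    qed
    show ?thesis using *[of i j] *[of j i] that
      by (cases "i \<le> j") (auto simp: abs_minus_commute)
  qed
  have cne: "\<bar>c i - c j\<bar> > 0" if "i \<le> d" "j \<le> d" "i \<noteq> j" for i j
    using dec[of i j] dec[of j i] that by (cases "i < j") auto
  have inj: "inj_on x {..d}"
  proof (rule inj_onI, rule ccontr)
    fix i j assume "i \<in> {..d}" "j \<in> {..d}" "x i = x j" "i \<noteq> j"
    then show False using gap2[of i j] cne[of i j] assms(3) by (auto simp: mult_le_0_iff)
  qed
  have "\<bar>poly p 0\<bar> \<le> (\<Sum>i\<le>d. 1 ^ (card {..d} - 1) / (\<Prod>j\<in>{..d}-{i}. \<bar>x i - x j\<bar>))"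
  proof (rule lagrange_bound[OF _ inj])
    show "\<bar>poly p (x i)\<bar> \<le> 1" "\<bar>0 - x i\<bar> \<le> 1" if "i \<in> {..d}" for i
      using x(1)[of i] that by (auto simp: E_def)
  qed (use assms(1) in auto)
  also have "\<dots> \<le> (\<Sum>i\<le>d. (2 / m) ^ d * (1 / (\<Prod>j\<in>{..d}-{i}. \<bar>c i - c j\<bar>)))"
  proof (rule sum_mono)
    fix i assume i: "i \<in> {..d}"
    have "(\<Prod>j\<in>{..d}-{i}. m / 2 * \<bar>c i - c j\<bar>) \<le> (\<Prod>j\<in>{..d}-{i}. \<bar>x i - x j\<bar>)"
      using gap2 i assms(3) by (intro prod_mono) auto
    moreover have "(\<Prod>j\<in>{..d}-{i}. m / 2 * \<bar>c i - c j\<bar>) = (m / 2) ^ d * (\<Prod>j\<in>{..d}-{i}. \<bar>c i - c j\<bar>)"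
      using i by (subst prod.distrib) simp
    moreover have "(\<Prod>j\<in>{..d}-{i}. \<bar>c i - c j\<bar>) > 0"
      using cne i by (intro prod_pos) auto
    ultimately have "1 / (\<Prod>j\<in>{..d}-{i}. \<bar>x i - x j\<bar>)
        \<le> 1 / ((m / 2) ^ d * (\<Prod>j\<in>{..d}-{i}. \<bar>c i - c j\<bar>))"
      using assms(3) by (intro frac_le) auto
    also have "\<dots> = (2 / m) ^ d * (1 / (\<Prod>j\<in>{..d}-{i}. \<bar>c i - c j\<bar>))"
      by (simp add: power_divide)
    finally show "1 ^ (card {..d} - 1) / (\<Prod>j\<in>{..d}-{i}. \<bar>x i - x j\<bar>)
        \<le> (2 / m) ^ d * (1 / (\<Prod>j\<in>{..d}-{i}. \<bar>c i - c j\<bar>))"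
      by simp
  qed
  also have "\<dots> = (2 / m) ^ d * 2 ^ (d - 1)"
    unfolding sum_distrib_left[symmetric] using cheb_nodes_sum[OF assms(2)] by (simp add: c_def)
  also have "\<dots> = (4 / m) ^ d / 2"
    using assms(2) by (cases d) (auto simp: power_divide power_mult_distrib[symmetric])
  finally show ?thesis .
qed

subsection \<open>Volumes of balls\<close>

lemma unit_ball_vol_rec:
  "unit_ball_vol (real (n + 2)) = 2 * pi / real (n + 2) * unit_ball_vol (real n)"
proof -
  define x where "x = real n / 2 + 1"
  have x: "real (n + 2) = 2 * x" "real n / 2 + 1 = x" "x > 0" by (auto simp: x_def)
  have "Gamma (x + 1) = x * Gamma x"
    using x(3) by (intro Gamma_plus1) (auto elim!: nonpos_Ints_cases)
  moreover have "pi powr x = pi powr (real n / 2) * pi"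
    by (simp add: x_def powr_add)
  moreover have "2 * x / 2 = x" by simp
  ultimately have "pi powr (2 * x / 2) / Gamma (2 * x / 2 + 1) = 2 * pi / (2 * x) * (pi powr (real n / 2) / Gamma x)"
    using x(3) by simp
  then show ?thesis
    by (simp only: unit_ball_vol_def x)
qed

lemma unit_ball_vol_small:
  "unit_ball_vol (real 0) = 1" "unit_ball_vol (real 1) = 2" "unit_ball_vol (real 2) = pi"
  "unit_ball_vol (real 3) = 4 / 3 * pi" "unit_ball_vol (real 4) = pi ^ 2 / 2"
  "unit_ball_vol (real 5) = 8 / 15 * pi ^ 2" "unit_ball_vol (real 6) = pi ^ 3 / 6"
  by (simp_all add: eval_unit_ball_vol power2_eq_square power3_eq_cube)

lemma pi_le_3_15: "pi \<le> 3.15"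
  using pi_approx(2) by simp

lemma pi_squared_le: "pi ^ 2 \<le> 9.9225"
  using power_mono[OF pi_le_3_15, of 2] by (simp add: power2_eq_square)

text \<open>The maximum is 8 \<pi>^2 / 15 in dimension five; from dimension seven on the recurrence
  multiplies by 2 \<pi> / n < 1.\<close>

lemma unit_ball_vol_le: "unit_ball_vol (real n) \<le> 5.3"
proof (induction n rule: less_induct)
  case (less n)
  have pi3: "pi ^ 3 \<le> 31.255875"
    using power_mono[OF pi_le_3_15, of 3] by (simp add: power3_eq_cube)
  consider "n = 0" | "n = 1" | "n = 2" | "n = 3" | "n = 4" | "n = 5" | "n = 6" | "n \<ge> 7"
    by linarith
  then show ?case
  proof cases
    case 8
    define m where "m = n - 2"
    have n: "n = m + 2" "m < n" using 8 by (auto simp: m_def)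
    have "2 * pi / real n \<le> 1" using 8 pi_le_3_15 by (simp add: field_simps)
    moreover have "unit_ball_vol (real m) \<ge> 0" by simp
    ultimately have "2 * pi / real n * unit_ball_vol (real m) \<le> 1 * unit_ball_vol (real m)"
      by (intro mult_right_mono)
    then show ?thesis using less.IH[OF n(2)] unit_ball_vol_rec[of m] n(1) by simp
  qed (insert pi_le_3_15 pi_squared_le pi3 unit_ball_vol_small, auto)
qed

text \<open>The quotient of the two sides without 1.05 is largest for \<open>n = 3\<close> and
  \<open>n = 4\<close>, where it equals \<pi> / 3 = 1.047... .\<close>

lemma unit_ball_vol_pred_le:
  assumes "n \<ge> 2"
  shows "unit_ball_vol (real (n - 1)) \<le> 1.05 * real n"
proof -
  consider "n = 2" | "n = 3" | "n = 4" | "n = 5" | "n \<ge> 6" using assms by linarith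
  then show ?thesis
  proof cases
    case 5
    then show ?thesis using unit_ball_vol_le[of "n - 1"] by simp
  qed (use pi_le_3_15 pi_squared_le unit_ball_vol_small in auto)
qed

text \<open>Needed for degree at least four, where \<open>n + 2\<close> sets of the family are known
  to lie in the sublevel set.\<close>

lemma unit_ball_vol_less_Suc_Suc:
  assumes "n \<ge> 2"
  shows "unit_ball_vol (real n) < real n + 2"
proof -
  consider "n = 2" | "n = 3" | "n \<ge> 4" using assms by linarith
  then show ?thesis
  proof cases
    case 3
    then show ?thesis using unit_ball_vol_le[of n] by simp
  qed (use pi_le_3_15 unit_ball_vol_small in auto)
qed

text \<open>Needed for degree three, where \<open>2 ^ n - 1\<close> sets remain. Without the factor
  9/10 it would fail for \<open>n = 2\<close>, as 3 < \<pi>.\<close>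

lemma unit_ball_vol_less_pow:
  assumes "n \<ge> 2"
  shows "9 / 10 * unit_ball_vol (real n) < 2 ^ n - 1"
proof (cases "n = 2")
  case True
  then show ?thesis using pi_le_3_15 unit_ball_vol_small(3) by simp
next
  case False
  then have "2 ^ 3 \<le> (2 ^ n :: real)" using assms by (intro power_increasing) auto
  then show ?thesis using unit_ball_vol_le[of n] by simp
qed

subsection \<open>Measure along fibres and rays\<close>

text \<open>Several results on Lebesgue measure are available in the library only for index types with a
  well-order; they carry over along the reindexing to the following ordered copy.\<close>

typedef 'a ordered = "UNIV :: 'a set" by simp

instance ordered :: (finite) finite
proof
  have "(UNIV :: 'a ordered set) = Abs_ordered ` UNIV"
    by (auto intro: Rep_ordered_inverse[symmetric])
  then show "finite (UNIV :: 'a ordered set)" by (metis finite_imageI finite)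
qed

instantiation ordered :: (finite) wellorder
begin

definition less_eq_ordered :: "'a ordered \<Rightarrow> 'a ordered \<Rightarrow> bool" where
  "x \<le> y \<longleftrightarrow> to_nat (Rep_ordered x) \<le> to_nat (Rep_ordered y)"

definition less_ordered :: "'a ordered \<Rightarrow> 'a ordered \<Rightarrow> bool" where
  "x < y \<longleftrightarrow> to_nat (Rep_ordered x) < to_nat (Rep_ordered y)"

instance
proof
  fix P :: "'a ordered \<Rightarrow> bool" and a :: "'a ordered"
  assume step: "\<And>x. (\<And>y. y < x \<Longrightarrow> P y) \<Longrightarrow> P x"
  show "P a"
    by (induction a rule: measure_induct_rule[where f = "\<lambda>x. to_nat (Rep_ordered x)"])
       (auto intro: step simp: less_ordered_def)
qed (auto simp: less_eq_ordered_def less_ordered_def Rep_ordered_inject)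

end

definition reindex :: "real ^ 'n \<Rightarrow> real ^ ('n ordered)" where
  "reindex x = (\<chi> i. x $ Rep_ordered i)"

definition unreindex :: "real ^ ('n ordered) \<Rightarrow> real ^ 'n" where
  "unreindex y = (\<chi> i. y $ Abs_ordered i)"

lemma unreindex_reindex [simp]: "unreindex (reindex x) = x"
  by (simp add: reindex_def unreindex_def Abs_ordered_inverse vec_eq_iff)

lemma reindex_unreindex [simp]: "reindex (unreindex y) = y"
  by (simp add: reindex_def unreindex_def Rep_ordered_inverse vec_eq_iff)

lemma bij_Rep_ordered: "bij Rep_ordered"
  by (metis Abs_ordered_inverse Rep_ordered_inverse UNIV_I bijI' )

lemma inner_reindex [simp]: "reindex x \<bullet> reindex y = x \<bullet> y"
  unfolding inner_vec_def reindex_def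
  using sum.reindex_bij_betw[OF bij_Rep_ordered, of "\<lambda>i. x $ i \<bullet> y $ i"] by simp

lemma inner_unreindex [simp]: "unreindex x \<bullet> unreindex y = x \<bullet> y"
  by (metis inner_reindex reindex_unreindex)

lemma linear_reindex: "linear reindex"
  by (rule linearI) (auto simp: reindex_def vec_eq_iff)

lemma linear_unreindex: "linear unreindex"
  by (rule linearI) (auto simp: unreindex_def vec_eq_iff)

lemma borel_measurable_reindex [measurable]: "reindex \<in> borel_measurable borel"
  by (intro borel_measurable_continuous_onI linear_continuous_on linear_linear[THEN iffD2] linear_conv_bounded_linear[THEN iffD1] linear_reindex)

lemma borel_measurable_unreindex [measurable]: "unreindex \<in> borel_measurable borel"
  by (intro borel_measurable_continuous_onI linear_continuous_on linear_linear[THEN iffD2] linear_conv_bounded_linear[THEN iffD1] linear_unreindex)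

lemma prod_Basis_vec:
  fixes x :: "real ^ 'n"
  shows "(\<Prod>b\<in>Basis. x \<bullet> b) = (\<Prod>i\<in>UNIV. x $ i)"
proof -
  have inj: "inj (\<lambda>i. axis i (1::real) :: real ^ 'n)" by (simp add: inj_def axis_eq_axis)
  have eq: "(Basis :: (real ^ 'n) set) = range (\<lambda>i. axis i 1)" by (auto simp: Basis_vec_def)
  have "(\<Prod>b\<in>Basis. x \<bullet> b) = (\<Prod>i\<in>UNIV. x \<bullet> axis i 1)"
    unfolding eq by (subst prod.reindex[OF inj]) simp
  then show ?thesis by (simp add: inner_axis)
qed

section \<open>Invariance of Lebesgue measure under reindexing and orthogonal maps\<close>

lemma lborel_distr_unreindex: "distr lborel borel unreindex = (lborel :: (real ^ 'n) measure)"
proof (rule lborel_eqI[symmetric])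
  fix l u :: "real ^ 'n" assume le: "\<And>b. b \<in> Basis \<Longrightarrow> l \<bullet> b \<le> u \<bullet> b"
  have le': "l $ i \<le> u $ i" for i
    using le[of "axis i 1"] by (simp add: inner_axis)
  have "unreindex -` box l u = box (reindex l) (reindex u)"
  proof (rule set_eqI)
    fix y :: "real ^ ('n ordered)"
    have "(\<forall>i. l $ i < unreindex y $ i \<and> unreindex y $ i < u $ i) \<longleftrightarrow>
        (\<forall>i. l $ Rep_ordered i < y $ i \<and> y $ i < u $ Rep_ordered i)"
      unfolding unreindex_def
      by (metis (no_types, lifting) Abs_ordered_inverse Rep_ordered_inverse UNIV_I vec_lambda_beta)
    then show "y \<in> unreindex -` box l u \<longleftrightarrow> y \<in> box (reindex l) (reindex u)"
      by (simp add: mem_box_cart reindex_def)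
  qed
  moreover have "reindex l \<bullet> b \<le> reindex u \<bullet> b" if "b \<in> Basis" for b
    using that le' by (auto simp: Basis_vec_def inner_axis reindex_def)
  ultimately have "emeasure (distr lborel borel unreindex) (box l u) = (\<Prod>b\<in>Basis. (reindex u - reindex l) \<bullet> b)"
    by (simp add: emeasure_distr emeasure_lborel_box_eq inner_diff_left)
  also have "(\<Prod>b\<in>Basis. (reindex u - reindex l) \<bullet> b) = (\<Prod>b\<in>Basis. (u - l) \<bullet> b)"
    unfolding prod_Basis_vec using prod.reindex_bij_betw[OF bij_Rep_ordered, of "\<lambda>i. (u - l) $ i"]
    by (simp add: reindex_def)
  finally show "emeasure (distr lborel borel unreindex) (box l u) = (\<Prod>b\<in>Basis. (u - l) \<bullet> b)" .
qed simp

lemma lborel_distr_reindex: "distr lborel borel reindex = (lborel :: (real ^ ('n::finite ordered)) measure)"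
proof -
  have "distr lborel borel reindex = distr (distr lborel borel (unreindex :: _ \<Rightarrow> real ^ 'n)) borel reindex"
    by (simp add: lborel_distr_unreindex)
  also have "\<dots> = distr lborel borel (reindex \<circ> (unreindex :: _ \<Rightarrow> real ^ 'n))"
    by (subst distr_distr) auto
  also have "reindex \<circ> (unreindex :: _ \<Rightarrow> real ^ 'n) = (\<lambda>x. x)" by auto
  finally show ?thesis by (simp add: distr_id2)
qed

lemma orthogonal_transformation_measurable:
  fixes T :: "real ^ 'n \<Rightarrow> real ^ 'n"
  shows "orthogonal_transformation T \<Longrightarrow> T \<in> borel_measurable borel"
  by (intro borel_measurable_continuous_onI linear_continuous_on linear_conv_bounded_linear[THEN iffD1])
     (rule orthogonal_transformation_linear)

lemma lborel_distr_orthogonal_ordered: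
  fixes T :: "real ^ 'm::{finite,wellorder} \<Rightarrow> real ^ 'm::_"
  assumes T: "orthogonal_transformation T"
  shows "distr lborel borel T = lborel"
proof (rule lborel_eqI[symmetric])
  fix l u :: "real ^ 'm::_" assume le: "\<And>b. b \<in> Basis \<Longrightarrow> l \<bullet> b \<le> u \<bullet> b"
  have [measurable]: "T \<in> borel_measurable borel" by (rule orthogonal_transformation_measurable[OF T])
  have inv: "orthogonal_transformation (inv T)" by (rule orthogonal_transformation_inv[OF T])
  have eq: "T -` box l u = inv T ` box l u"
    using orthogonal_transformation_bij[OF T] by (simp add: bij_vimage_eq_inv_image)
  have fin: "emeasure lborel (T -` box l u) < \<infinity>"
  proof -
    have "bounded (inv T ` box l u)"
      using orthogonal_transformation_linear[OF inv] by (intro bounded_linear_image) (auto simp: linear_conv_bounded_linear)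
    then show ?thesis unfolding eq by (rule emeasure_bounded_finite)
  qed
  have mb: "T -` box l u \<in> sets borel"
    using measurable_sets[of T borel borel "box l u"] by simp
  have "emeasure (distr lborel borel T) (box l u) = emeasure lborel (T -` box l u)"
    by (simp add: emeasure_distr)
  also have "\<dots> = ennreal (measure lebesgue (T -` box l u))"
    using fin mb by (simp add: emeasure_eq_ennreal_measure measure_completion)
  also have "measure lebesgue (T -` box l u) = measure lebesgue (box l u)"
    unfolding eq by (intro measure_orthogonal_image[OF inv]) auto
  also have "\<dots> = (\<Prod>b\<in>Basis. (u - l) \<bullet> b)"
    using le by (simp add: measure_completion measure_lborel_box_eq)
  finally show "emeasure (distr lborel borel T) (box l u) = (\<Prod>b\<in>Basis. (u - l) \<bullet> b)" .
qed simp

text \<open>Conjugation with \<open>reindex\<close> moves \<open>T\<close> to the ordered index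
  type, where images of boxes under orthogonal maps keep their measure.\<close>

lemma lborel_distr_orthogonal:
  fixes T :: "real ^ 'n \<Rightarrow> real ^ 'n"
  assumes T: "orthogonal_transformation T"
  shows "distr lborel borel T = lborel"
proof -
  have [measurable]: "T \<in> borel_measurable borel" by (rule orthogonal_transformation_measurable[OF T])
  define T' where "T' = reindex \<circ> T \<circ> unreindex"
  have T': "orthogonal_transformation T'"
    using T linear_compose[OF linear_compose[OF linear_unreindex] linear_reindex, of T]
    by (auto simp: T'_def orthogonal_transformation_def o_assoc)
  have [measurable]: "T' \<in> borel_measurable borel" by (rule orthogonal_transformation_measurable[OF T'])
  have "T = unreindex \<circ> T' \<circ> reindex" by (auto simp: T'_def)
  then have "distr lborel borel T = distr (distr (distr lborel borel reindex) borel T') borel unreindex"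
    by (simp add: distr_distr o_assoc)
  also have "\<dots> = lborel"
    by (simp only: lborel_distr_reindex lborel_distr_orthogonal_ordered[OF T'] lborel_distr_unreindex)
  finally show ?thesis .
qed


section \<open>Integration over parallel fibres\<close>

text \<open>Fubini with the coordinate along \<open>e\<close> innermost. The other coordinates
  contribute only from a ball of radius \<open>r\<close> in dimension n - 1, outside of which
  \<open>f\<close> vanishes on the whole fibre.\<close>

lemma nn_integral_axis_fibres:
  fixes f :: "'a::euclidean_space \<Rightarrow> ennreal"
  assumes [measurable]: "f \<in> borel_measurable borel" and e: "e \<in> Basis" and r: "r > 0"
    and supp: "\<And>x. f x \<noteq> 0 \<Longrightarrow> norm (x - (x \<bullet> e) *\<^sub>R e) \<le> r"
    and fib: "\<And>x. (\<integral>\<^sup>+t. f (x + t *\<^sub>R e) \<partial>lborel) \<le> ennreal l" and l: "l \<ge> 0"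
  shows "(\<integral>\<^sup>+x. f x \<partial>lborel) \<le> ennreal (l * unit_ball_vol (real (DIM('a) - 1)) * r ^ (DIM('a) - 1))"
proof -
  interpret product_sigma_finite "\<lambda>_. lborel" by standard
  let ?I = "Basis - {e}"
  let ?S = "\<lambda>I g. \<Sum>b\<in>I. g b *\<^sub>R (b :: 'a)"
  let ?B = "{g. sqrt (\<Sum>b\<in>?I. (g b)\<^sup>2) \<le> r} \<inter> space (Pi\<^sub>M ?I (\<lambda>_. lborel))"
  have ins: "insert e ?I = Basis" using e by auto
  have "(\<integral>\<^sup>+x. f x \<partial>lborel) = (\<integral>\<^sup>+g. f (?S Basis g) \<partial>Pi\<^sub>M Basis (\<lambda>_. lborel))"
    by (subst lborel_eq) (simp add: nn_integral_distr)
  also have "\<dots> = (\<integral>\<^sup>+g. f (?S Basis g) \<partial>Pi\<^sub>M (insert e ?I) (\<lambda>_. lborel))" by (simp only: ins)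
  also have "\<dots> = (\<integral>\<^sup>+g. (\<integral>\<^sup>+t. f (?S Basis (g(e := t))) \<partial>lborel) \<partial>Pi\<^sub>M ?I (\<lambda>_. lborel))"
    by (rule product_nn_integral_insert) (auto simp: ins)
  also have "\<dots> \<le> (\<integral>\<^sup>+g. ennreal l * indicator ?B g \<partial>Pi\<^sub>M ?I (\<lambda>_. lborel))"
  proof (rule nn_integral_mono)
    fix g assume g: "g \<in> space (Pi\<^sub>M ?I (\<lambda>_. lborel :: real measure))"
    have eq: "?S Basis (g(e := t)) = ?S ?I g + t *\<^sub>R e" for t
    proof -
      have "?S Basis (g(e := t)) = t *\<^sub>R e + ?S ?I (g(e := t))"
        using e by (subst sum.remove[of _ e]) auto
      also have "?S ?I (g(e := t)) = ?S ?I g" by (rule sum.cong) auto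
      finally show ?thesis by simp
    qed
    have orth: "?S ?I g \<bullet> e = 0"
      unfolding inner_sum_left using e by (intro sum.neutral) (auto simp: inner_Basis)
    have nrm: "norm (?S ?I g) = sqrt (\<Sum>b\<in>?I. (g b)\<^sup>2)"
    proof -
      have "norm (?S ?I g)^2 = (\<Sum>b\<in>?I. (g b)\<^sup>2)"
        by (subst norm_sum_Pythagorean) (auto simp: pairwise_def orthogonal_def inner_Basis)
      then show ?thesis by (metis norm_ge_zero real_sqrt_unique)
    qed
    show "(\<integral>\<^sup>+t. f (?S Basis (g(e := t))) \<partial>lborel) \<le> ennreal l * indicator ?B g"
    proof (cases "g \<in> ?B")
      case True
      then show ?thesis unfolding eq using fib[of "?S ?I g"] by simp
    next
      case False
      then have "sqrt (\<Sum>b\<in>?I. (g b)\<^sup>2) > r" using g by auto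
      then have "f (?S ?I g + t *\<^sub>R e) = 0" for t
        using supp[of "?S ?I g + t *\<^sub>R e"] e orth nrm by (auto simp: inner_add_left inner_Basis)
      then show ?thesis unfolding eq by simp
    qed
  qed
  also have "\<dots> = ennreal l * emeasure (Pi\<^sub>M ?I (\<lambda>_. lborel)) ?B"
    by (subst nn_integral_cmult_indicator) auto
  also have "\<dots> = ennreal l * ennreal (unit_ball_vol (real (card ?I)) * r ^ card ?I)"
    using r by (subst emeasure_cball_aux) auto
  also have "\<dots> = ennreal (l * unit_ball_vol (real (DIM('a) - 1)) * r ^ (DIM('a) - 1))"
    using l e r by (subst ennreal_mult[symmetric]) (auto simp: mult_ac)
  finally show ?thesis .
qed

text \<open>Translation by \<open>z\<close> and a rotation that carries a basis vector to
  \<open>e\<close> lead back to fibres parallel to an axis.\<close>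

lemma nn_integral_fibres:
  fixes f :: "real ^ 'n \<Rightarrow> ennreal" and e z :: "real ^ 'n"
  assumes f[measurable]: "f \<in> borel_measurable borel" and e: "norm e = 1" and r: "r > 0"
    and supp: "\<And>x. f x \<noteq> 0 \<Longrightarrow> norm ((x - z) - ((x - z) \<bullet> e) *\<^sub>R e) \<le> r"
    and fib: "\<And>x. (\<integral>\<^sup>+t. f (x + t *\<^sub>R e) \<partial>lborel) \<le> ennreal l" and l: "l \<ge> 0"
  shows "(\<integral>\<^sup>+x. f x \<partial>lborel) \<le> ennreal (l * unit_ball_vol (real (CARD('n) - 1)) * r ^ (CARD('n) - 1))"
proof -
  obtain k :: 'n where "True" by simp
  define a :: "real ^ 'n" where "a = axis k 1"
  have a: "a \<in> Basis" by (simp add: a_def)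
  obtain T where T: "orthogonal_transformation T" "T a = e"
    using orthogonal_transformation_exists[of a e] e by (auto simp: a_def)
  have [measurable]: "T \<in> borel_measurable borel" by (rule orthogonal_transformation_measurable[OF T(1)])
  have lin: "linear T" by (rule orthogonal_transformation_linear[OF T(1)])
  have "(\<integral>\<^sup>+x. f x \<partial>lborel) = (\<integral>\<^sup>+x. f (z + x) \<partial>lborel)"
    by (subst lborel_distr_plus[of z, symmetric]) (simp add: nn_integral_distr)
  also have "\<dots> = (\<integral>\<^sup>+x. f (z + T x) \<partial>lborel)"
    by (subst lborel_distr_orthogonal[OF T(1), symmetric]) (simp add: nn_integral_distr)
  also have "\<dots> \<le> ennreal (l * unit_ball_vol (real (DIM(real ^ 'n) - 1)) * r ^ (DIM(real ^ 'n) - 1))"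
  proof (rule nn_integral_axis_fibres[OF _ a r _ _ l])
    show "(\<lambda>x. f (z + T x)) \<in> borel_measurable borel" by measurable
    show "norm (x - (x \<bullet> a) *\<^sub>R a) \<le> r" if "f (z + T x) \<noteq> 0" for x
    proof -
      have "norm (T (x - (x \<bullet> a) *\<^sub>R a)) \<le> r"
      proof -
        have "T x \<bullet> e = x \<bullet> a"
          using T by (metis orthogonal_transformation_def)
        then have "T (x - (x \<bullet> a) *\<^sub>R a) = (z + T x - z) - ((z + T x - z) \<bullet> e) *\<^sub>R e"
          using lin T(2) by (simp add: linear_diff linear_cmul)
        then show ?thesis using supp[OF that] by simp
      qed
      then show ?thesis using orthogonal_transformation_norm[OF T(1)] by simp
    qed
    show "(\<integral>\<^sup>+ t. f (z + T (x + t *\<^sub>R a)) \<partial>lborel) \<le> ennreal l" for x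
      using fib[of "z + T x"] lin T(2) by (simp add: linear_add linear_cmul add.assoc)
  qed
  finally show ?thesis by simp
qed

text \<open>Two weighted sets are treated at once because in the application a fibre may be long for
  one of them, and only the weighted sum of both lengths has a good bound.\<close>

lemma measure_fibres_le:
  fixes V W :: "(real ^ 'n) set" and e z :: "real ^ 'n"
  assumes V: "compact V" and W: "compact W" and e: "norm e = 1" and r: "r > 0"
    and a: "a \<ge> 0" and b: "b \<ge> 0" and l: "l \<ge> 0"
    and supp: "\<And>x. x \<in> V \<union> W \<Longrightarrow> norm ((x - z) - ((x - z) \<bullet> e) *\<^sub>R e) \<le> r"
    and fib: "\<And>x. a * measure lebesgue {t. x + t *\<^sub>R e \<in> V} + b * measure lebesgue {t. x + t *\<^sub>R e \<in> W} \<le> l"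
  shows "a * measure lebesgue V + b * measure lebesgue W \<le> l * unit_ball_vol (real (CARD('n) - 1)) * r ^ (CARD('n) - 1)"
proof -
  have [measurable]: "V \<in> sets borel" "W \<in> sets borel" using V W by (auto intro: borel_compact)
  have fibc: "compact {t. x + t *\<^sub>R e \<in> S}" if "compact S" for x and S :: "(real ^ 'n) set"
  proof -
    have "closed ((\<lambda>t. x + t *\<^sub>R e) -` S)"
      using compact_imp_closed[OF that] by (intro continuous_closed_vimage) (auto intro!: continuous_intros)
    moreover have "bounded {t. x + t *\<^sub>R e \<in> S}"
    proof -
      have "bounded S" using that by (rule compact_imp_bounded)
      then obtain B where B: "\<And>y. y \<in> S \<Longrightarrow> norm y \<le> B" by (auto simp: bounded_iff)
      have "\<bar>t\<bar> \<le> B + norm x" if "x + t *\<^sub>R e \<in> S" for t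
        using B[OF that] norm_triangle_ineq4[of "x + t *\<^sub>R e" x] e by simp
      then show ?thesis by (auto simp: bounded_iff)
    qed
    ultimately show ?thesis by (simp add: compact_eq_bounded_closed vimage_def)
  qed
  have em: "emeasure lborel S = ennreal (measure lebesgue S)" if "compact S" for S :: "'b::euclidean_space set"
    using emeasure_compact_finite[OF that] borel_compact[OF that]
    by (simp add: emeasure_eq_ennreal_measure measure_completion)
  have ind: "(\<integral>\<^sup>+t. indicator S (x + t *\<^sub>R e) \<partial>lborel) = ennreal (measure lebesgue {t. x + t *\<^sub>R e \<in> S})"
    if S: "compact S" for S :: "(real ^ 'n) set" and x
  proof -
    have "(\<integral>\<^sup>+t. indicator S (x + t *\<^sub>R e) \<partial>lborel) = (\<integral>\<^sup>+t. indicator {t. x + t *\<^sub>R e \<in> S} t \<partial>lborel)"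
      by (intro nn_integral_cong) (auto simp: indicator_def)
    also have "\<dots> = emeasure lborel {t. x + t *\<^sub>R e \<in> S}"
      using borel_compact[OF fibc[OF S]] by simp
    finally show ?thesis using em[OF fibc[OF S]] by simp
  qed
  let ?f = "\<lambda>x. ennreal a * indicator V x + ennreal b * indicator W x :: ennreal"
  have "ennreal (a * measure lebesgue V + b * measure lebesgue W) = (\<integral>\<^sup>+x. ?f x \<partial>lborel)"
    using a b by (simp add: nn_integral_add nn_integral_cmult em[OF V] em[OF W] ennreal_mult)
  also have "\<dots> \<le> ennreal (l * unit_ball_vol (real (CARD('n) - 1)) * r ^ (CARD('n) - 1))"
  proof (rule nn_integral_fibres[OF _ e r _ _ l])
    show "?f \<in> borel_measurable borel" by measurable
    show "norm (x - z - ((x - z) \<bullet> e) *\<^sub>R e) \<le> r" if "?f x \<noteq> 0" for x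
      using that by (intro supp) (auto simp: indicator_def split: if_splits)
    show "(\<integral>\<^sup>+ t. ?f (x + t *\<^sub>R e) \<partial>lborel) \<le> ennreal l" for x
    proof -
      have "(\<integral>\<^sup>+ t. ?f (x + t *\<^sub>R e) \<partial>lborel)
          = ennreal a * (\<integral>\<^sup>+t. indicator V (x + t *\<^sub>R e) \<partial>lborel) + ennreal b * (\<integral>\<^sup>+t. indicator W (x + t *\<^sub>R e) \<partial>lborel)"
        by (simp add: nn_integral_add nn_integral_cmult)
      also have "\<dots> = ennreal (a * measure lebesgue {t. x + t *\<^sub>R e \<in> V} + b * measure lebesgue {t. x + t *\<^sub>R e \<in> W})"
        using a b by (simp add: ind V W ennreal_mult)
      finally show ?thesis using fib[of x] by (simp add: ennreal_leI)
    qed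
  qed
  finally show ?thesis using l r by (subst (asm) ennreal_le_iff) auto
qed

section \<open>Integration along rays\<close>

text \<open>Both sides bound the integral of \<open>F\<close> over pairs of a scale \<open>s\<close>
  in (0, 1] and a point \<open>x\<close> of the shell \<open>R\<close> with
  \<open>s *\<^sub>R x\<close> in \<open>U\<close>. For fixed \<open>x\<close> the scales have
  measure at most \<rho>. For fixed y = s x in \<open>U\<close> the substitution contributes s^(-n)
  \<ge> 1 / s, and the scales with y / s in \<open>R\<close> contain [g / t, g), where
  \<open>g\<close> is the gauge of \<open>y\<close> with respect to \<open>B\<close>; there 1 / s is
  at least 1 / g.\<close>

lemma radial_measure_le_0:
  fixes U B :: "'a::euclidean_space set"
  assumes U: "compact U" and B: "compact B" "convex B" "0 \<in> B" and UB: "U \<subseteq> B" and \<rho>: "\<rho> \<ge> 0"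
    and ray: "\<And>y. y \<in> B \<Longrightarrow> measure lebesgue {s\<in>{0..1}. s *\<^sub>R y \<in> U} \<le> \<rho>"
    and t: "t > 1"
  shows "(1 - 1 / t) * measure lebesgue U \<le> \<rho> * (t ^ DIM('a) - 1) * measure lebesgue B"
proof -
  define R where "R = (*\<^sub>R) t ` B - B"
  have tB: "compact ((*\<^sub>R) t ` B)" using B(1) by (rule compact_scaling)
  have BtB: "B \<subseteq> (*\<^sub>R) t ` B"
  proof
    fix x assume x: "x \<in> B"
    have "(1 - 1 / t) *\<^sub>R 0 + (1 / t) *\<^sub>R x \<in> B"
      using B(2,3) x t by (intro convexD) auto
    then show "x \<in> (*\<^sub>R) t ` B" using t by (intro image_eqI[of _ _ "(1 / t) *\<^sub>R x"]) auto
  qed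
  have [measurable]: "U \<in> sets borel" "B \<in> sets borel" "(*\<^sub>R) t ` B \<in> sets borel"
    using U B tB by (auto intro: borel_compact)
  then have [measurable]: "R \<in> sets borel" by (simp add: R_def)
  have em: "emeasure lborel S = ennreal (measure lebesgue S)" if "compact S" for S :: "'b::euclidean_space set"
    using emeasure_compact_finite[OF that] borel_compact[OF that]
    by (simp add: emeasure_eq_ennreal_measure measure_completion)
  have emR: "emeasure lborel R = ennreal ((t ^ DIM('a) - 1) * measure lebesgue B)"
  proof -
    have "emeasure lborel R = emeasure lborel ((*\<^sub>R) t ` B) - emeasure lborel B"
      unfolding R_def using BtB emeasure_compact_finite[OF B(1)]
      by (intro emeasure_Diff) auto
    also have "\<dots> = ennreal (t ^ DIM('a) * measure lebesgue B) - ennreal (measure lebesgue B)"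
      using measure_lebesgue_affine[of t 0 B] t by (simp add: em[OF tB] em[OF B(1)])
    also have "\<dots> = ennreal ((t ^ DIM('a) - 1) * measure lebesgue B)"
      by (subst ennreal_minus) (auto simp: algebra_simps)
    finally show ?thesis .
  qed
  define F :: "real \<Rightarrow> 'a \<Rightarrow> ennreal" where
    "F s x = indicator {0<..1} s * indicator R x * indicator U (s *\<^sub>R x)" for s x
  have [measurable]: "case_prod F \<in> borel_measurable (lborel \<Otimes>\<^sub>M lborel)"
    unfolding F_def by measurable
  have cl: "compact {s\<in>{0..1}. s *\<^sub>R x \<in> S}" if "compact S" for S and x :: 'a
  proof -
    have "closed ((\<lambda>s. s *\<^sub>R x) -` S)"
      using compact_imp_closed[OF that] by (intro continuous_closed_vimage) (auto intro!: continuous_intros)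
    then have "compact ({0..1} \<inter> ((\<lambda>s. s *\<^sub>R x) -` S))" by (rule compact_Int_closed[OF compact_Icc])
    then show ?thesis by (simp add: Int_def)
  qed
  have upper: "(\<integral>\<^sup>+x. (\<integral>\<^sup>+s. F s x \<partial>lborel) \<partial>lborel) \<le> ennreal (\<rho> * (t ^ DIM('a) - 1) * measure lebesgue B)"
  proof -
    have "(\<integral>\<^sup>+s. F s x \<partial>lborel) \<le> ennreal \<rho> * indicator R x" for x
    proof (cases "x \<in> R")
      case True
      let ?A = "{s\<in>{0..1}. s *\<^sub>R x \<in> U}"
      have "(\<integral>\<^sup>+s. F s x \<partial>lborel) \<le> (\<integral>\<^sup>+s. indicator ?A s \<partial>lborel)"
        by (intro nn_integral_mono) (auto simp: F_def indicator_def)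
      also have "\<dots> = ennreal (measure lebesgue ?A)"
        using borel_compact[OF cl[OF U]] em[OF cl[OF U]] by simp
      also have "measure lebesgue ?A \<le> \<rho>"
      proof -
        \<comment> \<open>\<open>\<sigma>\<close> is where the ray leaves \<open>B\<close>. Past it
          the ray misses \<open>U\<close>, so \<open>ray\<close> can be applied to the point
          \<open>\<sigma> *\<^sub>R x\<close> of \<open>B\<close>, and rescaling by
          \<open>\<sigma> \<le> 1\<close> only shortens.\<close>
        let ?S = "{s\<in>{0..1}. s *\<^sub>R x \<in> B}"
        have "0 \<in> ?S" using B(3) by simp
        then obtain \<sigma> where \<sigma>: "\<sigma> \<in> ?S" "\<And>s. s \<in> ?S \<Longrightarrow> s \<le> \<sigma>"
          using compact_attains_sup[OF cl[OF B(1)], of x] by blast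
        show ?thesis
        proof (cases "\<sigma> = 0")
          case True
          then have "?A \<subseteq> {0}" using \<sigma>(2) UB by force
          then have "measure lebesgue ?A \<le> measure lebesgue {0 :: real}"
            by (intro measure_mono_fmeasurable) (auto intro: lmeasurable_compact lmeasurable_compact[THEN fmeasurableD] cl[OF U])
          then show ?thesis using \<rho> by simp
        next
          case False
          then have pos: "\<sigma> > 0" using \<sigma>(1) by auto
          let ?A' = "{s\<in>{0..1}. s *\<^sub>R (\<sigma> *\<^sub>R x) \<in> U}"
          have "?A \<subseteq> (\<lambda>s. \<sigma> *\<^sub>R s + 0) ` ?A'"
          proof
            fix s assume s: "s \<in> ?A"
            then have "s \<le> \<sigma>" using \<sigma>(2) UB by blast
            then show "s \<in> (\<lambda>s. \<sigma> *\<^sub>R s + 0) ` ?A'"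
              using s pos by (intro image_eqI[of _ _ "s / \<sigma>"]) auto
          qed
          moreover have "compact ((\<lambda>s. \<sigma> *\<^sub>R s + 0) ` ?A')"
            using compact_scaling[OF cl[OF U], of \<sigma> "\<sigma> *\<^sub>R x"] by simp
          ultimately have "measure lebesgue ?A \<le> measure lebesgue ((\<lambda>s. \<sigma> *\<^sub>R s + 0) ` ?A')"
            using cl[OF U, of x]
            by (intro measure_mono_fmeasurable) (auto intro: lmeasurable_compact lmeasurable_compact[THEN fmeasurableD])
          also have "\<dots> = \<sigma> * measure lebesgue ?A'"
            using measure_lebesgue_affine[of \<sigma> 0 ?A'] pos by simp
          also have "\<dots> \<le> 1 * \<rho>"
            using ray[of "\<sigma> *\<^sub>R x"] \<sigma>(1) pos by (intro mult_mono) auto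
          finally show ?thesis by simp
        qed
      qed
      finally show ?thesis using True by (simp add: ennreal_leI)
    qed (simp add: F_def)
    then have "(\<integral>\<^sup>+x. (\<integral>\<^sup>+s. F s x \<partial>lborel) \<partial>lborel) \<le> (\<integral>\<^sup>+x. ennreal \<rho> * indicator R x \<partial>lborel)"
      by (intro nn_integral_mono)
    also have "\<dots> = ennreal (\<rho> * (t ^ DIM('a) - 1) * measure lebesgue B)"
      using \<rho> t by (simp add: nn_integral_cmult emR ennreal_mult' mult.assoc)
    finally show ?thesis .
  qed
  define G :: "real \<Rightarrow> 'a \<Rightarrow> ennreal" where
    "G s y = ennreal (1 / s) * indicator {0<..1} s * indicator R ((1 / s) *\<^sub>R y) * indicator U y" for s y
  have [measurable]: "case_prod G \<in> borel_measurable (lborel \<Otimes>\<^sub>M lborel)"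
    unfolding G_def by measurable
  have lower1: "(\<integral>\<^sup>+y. G s y \<partial>lborel) \<le> (\<integral>\<^sup>+x. F s x \<partial>lborel)" for s
  proof (cases "s \<in> {0<..1}")
    case True
    have "(\<integral>\<^sup>+x. F s x \<partial>lborel) = (\<integral>\<^sup>+x. indicator R x * indicator U (s *\<^sub>R x) \<partial>lborel)"
      using True by (simp add: F_def)
    also have "\<dots> = (\<integral>\<^sup>+x. indicator R x * indicator U (s *\<^sub>R x)
        \<partial>density (distr lborel borel (\<lambda>y. 0 + (1 / s) *\<^sub>R y)) (\<lambda>_. ennreal (\<bar>1 / s\<bar> ^ DIM('a))))"
      using True by (subst lborel_affine[of "1 / s" 0, symmetric]) auto
    also have "\<dots> = (\<integral>\<^sup>+y. ennreal ((1 / s) ^ DIM('a)) * (indicator R ((1 / s) *\<^sub>R y) * indicator U y) \<partial>lborel)"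
      using True by (subst nn_integral_density; (subst nn_integral_distr)?) auto
    finally have "(\<integral>\<^sup>+x. F s x \<partial>lborel) = \<dots>" .
    moreover have "(1 / s) ^ 1 \<le> (1 / s) ^ DIM('a)"
      using True by (intro power_increasing) (auto simp: Suc_le_eq)
    ultimately show ?thesis
      using True by (auto simp: G_def mult.assoc intro!: nn_integral_mono mult_right_mono ennreal_leI)
  qed (simp add: G_def)
  have lower2: "ennreal (1 - 1 / t) * indicator U y \<le> (\<integral>\<^sup>+s. G s y \<partial>lborel)" if "y \<noteq> 0" for y
  proof (cases "y \<in> U")
    case True
    have "closed ((\<lambda>s. s *\<^sub>R y) -` B)"
      using compact_imp_closed[OF B(1)] by (intro continuous_closed_vimage) (auto intro!: continuous_intros)
    moreover obtain M where M: "\<And>x. x \<in> B \<Longrightarrow> norm x \<le> M"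
      using compact_imp_bounded[OF B(1)] by (auto simp: bounded_iff)
    have "bounded ((\<lambda>s. s *\<^sub>R y) -` B)"
    proof -
      have "\<bar>s\<bar> \<le> M / norm y" if "s *\<^sub>R y \<in> B" for s
        using M[OF that] \<open>y \<noteq> 0\<close> by (simp add: field_simps)
      then show ?thesis by (auto simp: bounded_iff)
    qed
    ultimately have "compact ((\<lambda>s. s *\<^sub>R y) -` B)" by (simp add: compact_eq_bounded_closed)
    moreover have one: "1 \<in> (\<lambda>s. s *\<^sub>R y) -` B" using True UB by auto
    ultimately obtain lam where lam: "lam *\<^sub>R y \<in> B" "\<And>s. s *\<^sub>R y \<in> B \<Longrightarrow> s \<le> lam"
      using compact_attains_sup[of "(\<lambda>s. s *\<^sub>R y) -` B"] by blast
    have lam1: "lam \<ge> 1" using lam(2)[of 1] one by simp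
    define g where "g = 1 / lam"
    have g: "0 < g" "g \<le> 1" using lam1 by (auto simp: g_def)
    have mem: "(1 / s) *\<^sub>R y \<in> R" if s: "g / t \<le> s" "s < g" for s
    proof -
      have s0: "s > 0" using s g t by (meson divide_pos_pos less_le_trans less_trans zero_less_one)
      have "1 / s > lam" using s(2) s0 lam1 by (simp add: g_def field_simps)
      then have "(1 / s) *\<^sub>R y \<notin> B" using lam(2)[of "1 / s"] by linarith
      moreover have "(1 / s) *\<^sub>R y = t *\<^sub>R ((1 / (t * s * lam)) *\<^sub>R (lam *\<^sub>R y))"
        using t s0 lam1 by simp
      moreover have "(1 / (t * s * lam)) *\<^sub>R (lam *\<^sub>R y) \<in> B"
      proof -
        define c where "c = 1 / (t * s * lam)"
        have "t * s * lam \<ge> 1" using s(1) t lam1 by (simp add: g_def field_simps)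
        then have c: "0 \<le> c" "c \<le> 1" by (auto simp: c_def)
        have "(1 - c) *\<^sub>R 0 + c *\<^sub>R (lam *\<^sub>R y) \<in> B"
          using B(2,3) lam(1) c by (intro convexD) auto
        then show ?thesis by (simp add: c_def)
      qed
      ultimately have "(1 / s) *\<^sub>R y \<in> (*\<^sub>R) t ` B" "(1 / s) *\<^sub>R y \<notin> B"
        by (blast intro: image_eqI)+
      then show ?thesis unfolding R_def by (rule DiffI)
    qed
    have "ennreal (1 - 1 / t) = ennreal (1 / g) * emeasure lborel {g / t..<g}"
      using g t by (simp add: ennreal_mult'[symmetric] field_simps)
    also have "\<dots> = (\<integral>\<^sup>+s. ennreal (1 / g) * indicator {g / t..<g} s \<partial>lborel)"
      by (simp add: nn_integral_cmult)
    also have "\<dots> \<le> (\<integral>\<^sup>+s. G s y \<partial>lborel)"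
    proof (rule nn_integral_mono)
      fix s
      show "ennreal (1 / g) * indicator {g / t..<g} s \<le> G s y"
      proof (cases "s \<in> {g / t..<g}")
        case s: True
        have "g / t > 0" using g t by simp
        with s have "0 < s" "s < g" by auto
        then have "1 / g \<le> 1 / s" by (intro divide_left_mono) auto
        then show ?thesis using s mem[of s] True g \<open>0 < s\<close>
          by (auto simp: G_def intro!: ennreal_leI)
      qed simp
    qed
    finally show ?thesis using True by simp
  qed simp
  have "ennreal ((1 - 1 / t) * measure lebesgue U) = (\<integral>\<^sup>+y. ennreal (1 - 1 / t) * indicator U y \<partial>lborel)"
    using t by (simp add: nn_integral_cmult em[OF U] ennreal_mult')
  also have "\<dots> \<le> (\<integral>\<^sup>+y. (\<integral>\<^sup>+s. G s y \<partial>lborel) \<partial>lborel)"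
    using AE_lborel_singleton[of "0::'a"] by (intro nn_integral_mono_AE) (auto elim!: eventually_mono simp: lower2)
  also have "\<dots> = (\<integral>\<^sup>+s. (\<integral>\<^sup>+y. G s y \<partial>lborel) \<partial>lborel)"
    by (rule lborel_pair.Fubini') measurable
  also have "\<dots> \<le> (\<integral>\<^sup>+s. (\<integral>\<^sup>+x. F s x \<partial>lborel) \<partial>lborel)"
    by (intro nn_integral_mono lower1)
  also have "\<dots> = (\<integral>\<^sup>+x. (\<integral>\<^sup>+s. F s x \<partial>lborel) \<partial>lborel)"
    by (rule lborel_pair.Fubini'[symmetric]) measurable
  also note upper
  finally show ?thesis
    using \<rho> t by (subst (asm) ennreal_le_iff) auto
qed

text \<open>Compares the measures of the part of the rays that leads to \<open>U\<close> over the thin shell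
  \<open>t B - B\<close>, and lets \<open>t\<close> tend to \<open>1\<close>.\<close>
lemma radial_measure_le:
  fixes U B :: "'a::euclidean_space set"
  assumes U: "compact U" and B: "compact B" "convex B" "x0 \<in> B" and UB: "U \<subseteq> B" and \<rho>: "\<rho> \<ge> 0"
    and ray: "\<And>y. y \<in> B \<Longrightarrow> measure lebesgue {s\<in>{0..1}. x0 + s *\<^sub>R (y - x0) \<in> U} \<le> \<rho>"
  shows "measure lebesgue U \<le> real DIM('a) * \<rho> * measure lebesgue B"
proof -
  let ?n = "DIM('a)"
  let ?U = "(\<lambda>x. x - x0) ` U" and ?B = "(\<lambda>x. x - x0) ` B"
  have tr: "measure lebesgue ((\<lambda>x. x - x0) ` S) = measure lebesgue S" for S
    using measure_lebesgue_affine[of 1 "- x0" S] by simp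
  have main: "(1 - 1 / t) * measure lebesgue U \<le> \<rho> * (t ^ ?n - 1) * measure lebesgue B" if "t > 1" for t
  proof -
    have "(1 - 1 / t) * measure lebesgue ?U \<le> \<rho> * (t ^ ?n - 1) * measure lebesgue ?B"
    proof (rule radial_measure_le_0)
      show "compact ?U" by (rule compact_translation_subtract[OF U])
      show "compact ?B" by (rule compact_translation_subtract[OF B(1)])
      show "convex ?B" by (rule convex_translation_subtract[OF B(2)])
      show "measure lebesgue {s \<in> {0..1}. s *\<^sub>R y \<in> ?U} \<le> \<rho>" if "y \<in> ?B" for y
      proof -
        obtain x where x: "x \<in> B" "y = x - x0" using \<open>y \<in> ?B\<close> by blast
        have "s *\<^sub>R y \<in> ?U \<longleftrightarrow> x0 + s *\<^sub>R y \<in> U" for s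
          by (metis (no_types, lifting) add.commute add_diff_cancel_left' diff_add_cancel image_iff)
        then show ?thesis using ray[OF x(1)] x(2) by simp
      qed
    qed (use B UB \<rho> that in auto)
    then show ?thesis by (simp only: tr)
  qed
  have bound: "measure lebesgue U \<le> \<rho> * measure lebesgue B * (t * (\<Sum>i<?n. t ^ i))" if t: "t > 1" for t
  proof -
    have "t ^ ?n - 1 = (t - 1) * (\<Sum>i<?n. t ^ i)" by (rule power_diff_1_eq)
    with main[OF t] have "(1 - 1 / t) * measure lebesgue U \<le> \<rho> * ((t - 1) * (\<Sum>i<?n. t ^ i)) * measure lebesgue B"
      by simp
    also have "\<dots> = (1 - 1 / t) * (\<rho> * measure lebesgue B * (t * (\<Sum>i<?n. t ^ i)))"
      using t by (simp add: left_diff_distrib right_diff_distrib)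
    finally show ?thesis
      using t by (subst (asm) mult_le_cancel_left_pos) auto
  qed
  define X where "X k = 1 + inverse (real (Suc k))" for k
  have "X \<longlonglongrightarrow> 1 + 0"
    unfolding X_def by (intro tendsto_intros LIMSEQ_inverse_real_of_nat)
  then have "(\<lambda>k. \<rho> * measure lebesgue B * (X k * (\<Sum>i<?n. X k ^ i)))
      \<longlonglongrightarrow> \<rho> * measure lebesgue B * ((1 + 0) * (\<Sum>i<?n. (1 + 0) ^ i))"
    by (intro tendsto_intros)
  then have "measure lebesgue U \<le> \<rho> * measure lebesgue B * ((1 + 0) * (\<Sum>i<?n. (1 + 0) ^ i))"
  proof (rule LIMSEQ_le_const)
    have "X k > 1" for k by (simp add: X_def)
    then show "\<exists>N. \<forall>k\<ge>N. measure lebesgue U \<le> \<rho> * measure lebesgue B * (X k * (\<Sum>i<?n. X k ^ i))"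
      using bound by blast
  qed
  then show ?thesis by (simp add: mult_ac)
qed

subsection \<open>Linear dependence and elimination\<close>

text \<open>Gaussian elimination, one equation per induction step: an unknown \<open>s0\<close> with
  nonzero coefficient is removed from the remaining equations.\<close>

lemma nontrivial_solution:
  fixes A :: "'s \<Rightarrow> 't \<Rightarrow> real"
  assumes "finite T" "finite S" "card T < card S"
  shows "\<exists>c. (\<exists>s\<in>S. c s \<noteq> 0) \<and> (\<forall>t\<in>T. (\<Sum>s\<in>S. c s * A s t) = 0)"
  using assms
proof (induction T arbitrary: S A rule: finite_induct)
  case empty
  then have "S \<noteq> {}" by auto
  then show ?case by (intro exI[of _ "\<lambda>_. 1"]) auto
next
  case (insert t T)
  show ?case
  proof (cases "\<forall>s\<in>S. A s t = 0")
    case True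
    have "card T < card S" using insert by simp
    with insert.IH[OF insert.prems(1), of A] True show ?thesis by auto
  next
    case False
    then obtain s0 where s0: "s0 \<in> S" "A s0 t \<noteq> 0" by auto
    have "card T < card (S - {s0})" using insert s0 by simp
    with insert.IH[of "S - {s0}" "\<lambda>s u. A s u - A s t / A s0 t * A s0 u"] insert.prems(1)
    obtain c where c: "\<exists>s\<in>S-{s0}. c s \<noteq> 0"
      "\<And>u. u \<in> T \<Longrightarrow> (\<Sum>s\<in>S-{s0}. c s * (A s u - A s t / A s0 t * A s0 u)) = 0"
      by auto
    define b where "b = - (\<Sum>s\<in>S-{s0}. c s * A s t) / A s0 t"
    define c' where "c' = c(s0 := b)"
    have split: "(\<Sum>s\<in>S. c' s * A s u) = b * A s0 u + (\<Sum>s\<in>S-{s0}. c s * A s u)" for u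
      using insert.prems(1) s0 by (subst sum.remove[of _ s0]) (auto simp: c'_def intro!: sum.cong)
    have "(\<Sum>s\<in>S. c' s * A s u) = 0" if "u \<in> insert t T" for u
    proof (cases "u = t")
      case True
      then show ?thesis using s0 unfolding split by (simp add: b_def)
    next
      case False
      then have "u \<in> T" using that by simp
      from c(2)[OF this] have "0 = (\<Sum>s\<in>S-{s0}. c s * A s u) - (\<Sum>s\<in>S-{s0}. c s * A s t) * (A s0 u / A s0 t)"
        unfolding sum_distrib_right by (simp add: algebra_simps sum_subtractf)
      then show ?thesis unfolding split by (simp add: b_def)
    qed
    moreover have "\<exists>s\<in>S. c' s \<noteq> 0" using c(1) by (auto simp: c'_def)
    ultimately show ?thesis by blast
  qed
qed

text \<open>The powers \<open>T ^^ j\<close> with \<open>j \<le> (card \<Gamma>)\<^sup>2\<close> are linearly dependent as matrices, and every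
  eigenvalue is a root of the polynomial formed with the coefficients of such a relation.\<close>
lemma finite_eigenvalues:
  fixes K :: "'g \<Rightarrow> 'g \<Rightarrow> real"
  assumes \<Gamma>: "finite \<Gamma>"
  shows "finite {\<epsilon>. \<exists>v. (\<exists>\<gamma>\<in>\<Gamma>. v \<gamma> \<noteq> 0) \<and> (\<forall>\<gamma>\<in>\<Gamma>. \<epsilon> * v \<gamma> + (\<Sum>\<delta>\<in>\<Gamma>. K \<gamma> \<delta> * v \<delta>) = 0)}"
proof -
  define T where "T v \<gamma> = (\<Sum>\<delta>\<in>\<Gamma>. K \<gamma> \<delta> * v \<delta>)" for v :: "'g \<Rightarrow> real" and \<gamma>
  \<comment> \<open>The matrix entries of \<open>T ^^ j\<close>; there are
    \<open>(card \<Gamma>)\<^sup>2\<close> of them, one fewer than the powers considered.\<close>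
  define A where "A j p = (T ^^ j) (\<lambda>\<delta>. if \<delta> = snd p then 1 else 0) (fst p)" for j and p :: "'g \<times> 'g"
  have expand: "(T ^^ j) v \<gamma> = (\<Sum>\<delta>\<in>\<Gamma>. v \<delta> * A j (\<gamma>, \<delta>))" if "\<gamma> \<in> \<Gamma>" for j v \<gamma>
    using that
  proof (induction j arbitrary: \<gamma>)
    case 0
    have "v \<delta> * (if \<gamma> = \<delta> then 1 else 0) = (if \<delta> = \<gamma> then v \<gamma> else 0)" for \<delta> by auto
    with 0 \<Gamma> show ?case by (simp add: A_def sum.delta)
  next
    case (Suc j)
    have "(T ^^ Suc j) v \<gamma> = (\<Sum>\<beta>\<in>\<Gamma>. K \<gamma> \<beta> * (T ^^ j) v \<beta>)" by (simp add: T_def)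
    also have "\<dots> = (\<Sum>\<beta>\<in>\<Gamma>. K \<gamma> \<beta> * (\<Sum>\<delta>\<in>\<Gamma>. v \<delta> * A j (\<beta>, \<delta>)))"
      by (intro sum.cong refl) (simp add: Suc.IH)
    also have "\<dots> = (\<Sum>\<delta>\<in>\<Gamma>. v \<delta> * (\<Sum>\<beta>\<in>\<Gamma>. K \<gamma> \<beta> * A j (\<beta>, \<delta>)))"
      unfolding sum_distrib_left by (subst sum.swap) (simp add: mult_ac)
    also have "\<dots> = (\<Sum>\<delta>\<in>\<Gamma>. v \<delta> * A (Suc j) (\<gamma>, \<delta>))"
      by (simp add: A_def T_def)
    finally show ?case .
  qed
  let ?N = "card (\<Gamma> \<times> \<Gamma>)"
  obtain c where c: "\<exists>j\<in>{..?N}. c j \<noteq> 0" "\<And>p. p \<in> \<Gamma> \<times> \<Gamma> \<Longrightarrow> (\<Sum>j\<le>?N. c j * A j p) = 0"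
    using nontrivial_solution[of "\<Gamma> \<times> \<Gamma>" "{..?N}" A] \<Gamma> by auto
  \<comment> \<open>In the stated form of the equation \<open>- \<epsilon>\<close> is the eigenvalue
    of \<open>T\<close>, whence the alternating signs.\<close>
  have "(\<Sum>j\<le>?N. (c j * (-1) ^ j) * \<epsilon> ^ j) = 0"
    if "\<gamma>0 \<in> \<Gamma>" "v \<gamma>0 \<noteq> 0" and eig: "\<forall>\<gamma>\<in>\<Gamma>. \<epsilon> * v \<gamma> + (\<Sum>\<delta>\<in>\<Gamma>. K \<gamma> \<delta> * v \<delta>) = 0" for \<epsilon> v \<gamma>0
  proof -
    have pow: "(T ^^ j) v \<gamma> = (- \<epsilon>) ^ j * v \<gamma>" if "\<gamma> \<in> \<Gamma>" for j \<gamma>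
      using that
    proof (induction j arbitrary: \<gamma>)
      case (Suc j)
      have "(T ^^ Suc j) v \<gamma> = (\<Sum>\<beta>\<in>\<Gamma>. K \<gamma> \<beta> * (T ^^ j) v \<beta>)" by (simp add: T_def)
      also have "\<dots> = (- \<epsilon>) ^ j * (\<Sum>\<beta>\<in>\<Gamma>. K \<gamma> \<beta> * v \<beta>)"
        unfolding sum_distrib_left by (intro sum.cong refl) (simp add: Suc.IH)
      also have "(\<Sum>\<beta>\<in>\<Gamma>. K \<gamma> \<beta> * v \<beta>) = - \<epsilon> * v \<gamma>" using eig Suc.prems by (simp add: eq_neg_iff_add_eq_0 add.commute)
      finally show ?case by simp
    qed simp
    have "(\<Sum>j\<le>?N. c j * (- \<epsilon>) ^ j) * v \<gamma>0 = (\<Sum>j\<le>?N. c j * (T ^^ j) v \<gamma>0)"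
      by (simp add: pow[OF that(1)] sum_distrib_right mult.assoc)
    also have "\<dots> = (\<Sum>j\<le>?N. \<Sum>\<delta>\<in>\<Gamma>. v \<delta> * (c j * A j (\<gamma>0, \<delta>)))"
      by (simp add: expand[OF that(1)] sum_distrib_left mult_ac)
    also have "\<dots> = (\<Sum>\<delta>\<in>\<Gamma>. v \<delta> * (\<Sum>j\<le>?N. c j * A j (\<gamma>0, \<delta>)))"
      unfolding sum_distrib_left by (rule sum.swap)
    also have "\<dots> = 0" using c(2) that(1) by simp
    finally have "(\<Sum>j\<le>?N. c j * (- \<epsilon>) ^ j) = 0" using that(2) by simp
    then show ?thesis by (simp add: power_minus[of \<epsilon>] mult_ac)
  qed
  then have "{\<epsilon>. \<exists>v. (\<exists>\<gamma>\<in>\<Gamma>. v \<gamma> \<noteq> 0) \<and> (\<forall>\<gamma>\<in>\<Gamma>. \<epsilon> * v \<gamma> + (\<Sum>\<delta>\<in>\<Gamma>. K \<gamma> \<delta> * v \<delta>) = 0)}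
      \<subseteq> {\<epsilon>. (\<Sum>j\<le>?N. (c j * (-1) ^ j) * \<epsilon> ^ j) = 0}"
    by blast
  moreover have "finite {\<epsilon>. (\<Sum>j\<le>?N. (c j * (-1) ^ j) * \<epsilon> ^ j) = 0}"
    using c(1) by (subst polyfun_finite_roots) auto
  ultimately show ?thesis by (rule finite_subset)
qed

text \<open>Modulo the equations \<open>\<epsilon> x\<^sub>i ^ m + H\<^sub>i + v\<^sub>i = 0\<close> every monomial reduces to those with exponents
  below \<open>m\<close>, unless \<open>- \<epsilon>\<close> is an eigenvalue of one of finitely many operators, which act on the
  homogeneous parts and hence do not depend on the constants \<open>v\<^sub>i\<close>.\<close>
lemma reduction_to_box:
  fixes H :: "'n::finite \<Rightarrow> real ^ 'n \<Rightarrow> real"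
  assumes H: "\<And>i. H i \<in> poly_fun_le m" and m: "m \<ge> 1"
  shows "\<exists>E. finite E \<and> (\<forall>\<epsilon> v S c f. \<epsilon> \<notin> E \<longrightarrow> finite S \<longrightarrow>
     (\<forall>z\<in>S. \<forall>i. \<epsilon> * z $ i ^ m + H i z + v i = 0) \<longrightarrow>
     (\<forall>\<alpha>. (\<forall>i. \<alpha> i < m) \<longrightarrow> (\<Sum>i\<in>UNIV. \<alpha> i) \<le> D \<longrightarrow> (\<Sum>z\<in>S. c z * monom_fun \<alpha> z) = 0) \<longrightarrow>
     f \<in> poly_fun_le D \<longrightarrow> (\<Sum>z\<in>S. c z * f z) = 0)"
proof -
  define \<Gamma> :: "nat \<Rightarrow> ('n \<Rightarrow> nat) set" where "\<Gamma> e = {\<gamma>. (\<Sum>i\<in>UNIV. \<gamma> i) = e}" for e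
  have fin\<Gamma>: "finite (\<Gamma> e)" for e
    using finite_exponents_le[of e] by (rule finite_subset[rotated]) (auto simp: \<Gamma>_def)
  have "\<exists>h. H i = (\<lambda>x. \<Sum>\<alpha> | (\<Sum>i\<in>UNIV. \<alpha> i) \<le> m. h \<alpha> * monom_fun \<alpha> x)" for i
    using H[of i] by (simp add: poly_fun_le_iff)
  then obtain h where h: "\<And>i. H i = (\<lambda>x. \<Sum>\<alpha> | (\<Sum>i\<in>UNIV. \<alpha> i) \<le> m. h i \<alpha> * monom_fun \<alpha> x)"
    by metis
  define \<iota> where "\<iota> \<gamma> = (SOME i. \<gamma> i \<ge> m)" for \<gamma> :: "'n \<Rightarrow> nat"
  define \<beta> where "\<beta> \<gamma> = \<gamma>(\<iota> \<gamma> := \<gamma> (\<iota> \<gamma>) - m)" for \<gamma> :: "'n \<Rightarrow> nat"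
  \<comment> \<open>On monomials of degree \<open>e\<close>, row \<gamma> describes the product of
    the monomial \<open>\<beta> \<gamma>\<close> with the part of degree \<open>m\<close> of
    \<open>H (\<iota> \<gamma>)\<close>. Rows of box monomials are zero, because the functional
    vanishes on them by assumption.\<close>
  define K where "K \<gamma> \<gamma>' = (if \<exists>i. \<gamma> i \<ge> m
      then \<Sum>\<delta>\<in>\<Gamma> m. if (\<lambda>j. \<beta> \<gamma> j + \<delta> j) = \<gamma>' then h (\<iota> \<gamma>) \<delta> else 0 else 0)" for \<gamma> \<gamma>'
  define E where "E = insert 0 (\<Union>e\<le>D. {\<epsilon>. \<exists>v. (\<exists>\<gamma>\<in>\<Gamma> e. v \<gamma> \<noteq> 0) \<and>
      (\<forall>\<gamma>\<in>\<Gamma> e. \<epsilon> * v \<gamma> + (\<Sum>\<delta>\<in>\<Gamma> e. K \<gamma> \<delta> * v \<delta>) = 0)})"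
  have finE: "finite E"
    unfolding E_def using finite_eigenvalues[OF fin\<Gamma>] by (intro finite.insertI finite_UN_I) auto
  have main: "(\<Sum>z\<in>S. c z * f z) = 0"
    if \<epsilon>: "\<epsilon> \<notin> E" and S: "finite S" and zero: "\<And>z i. z \<in> S \<Longrightarrow> \<epsilon> * z $ i ^ m + H i z + v i = 0"
      and box: "\<And>\<alpha>. (\<forall>i. \<alpha> i < m) \<Longrightarrow> (\<Sum>i\<in>UNIV. \<alpha> i) \<le> D \<Longrightarrow> (\<Sum>z\<in>S. c z * monom_fun \<alpha> z) = 0"
      and f: "f \<in> poly_fun_le D" for \<epsilon> v S c f
  proof -
    define lam where "lam \<gamma> = (\<Sum>z\<in>S. c z * monom_fun \<gamma> z)" for \<gamma>
    have lam0: "\<forall>\<gamma>\<in>\<Gamma> e. lam \<gamma> = 0" if "e \<le> D" for e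
      using that
    proof (induction e rule: less_induct)
      case (less e)
      have IH: "lam \<gamma> = 0" if "(\<Sum>i\<in>UNIV. \<gamma> i) < e" for \<gamma>
        using less.IH[OF that] less.prems that by (auto simp: \<Gamma>_def)
      have eq: "\<epsilon> * lam \<gamma> + (\<Sum>\<delta>\<in>\<Gamma> e. K \<gamma> \<delta> * lam \<delta>) = 0" if \<gamma>: "\<gamma> \<in> \<Gamma> e" for \<gamma>
      proof (cases "\<exists>i. \<gamma> i \<ge> m")
        case False
        then have "lam \<gamma> = 0"
          using box[of \<gamma>] \<gamma> less.prems by (auto simp: lam_def \<Gamma>_def not_le)
        moreover have "K \<gamma> \<delta> = 0" for \<delta> using False by (auto simp: K_def)
        ultimately show ?thesis by simp
      next
        case True
        define i where "i = \<iota> \<gamma>"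
        have i: "\<gamma> i \<ge> m" unfolding i_def \<iota>_def using True by (rule someI_ex)
        have sum\<beta>: "(\<Sum>j\<in>UNIV. \<beta> \<gamma> j) + m = e"
        proof -
          have "(\<Sum>j\<in>UNIV. \<beta> \<gamma> j) = (\<gamma> i - m) + (\<Sum>j\<in>UNIV-{i}. \<gamma> j)"
            unfolding \<beta>_def i_def by (subst sum.remove[of _ "\<iota> \<gamma>"]) (auto intro!: sum.cong)
          moreover have "e = \<gamma> i + (\<Sum>j\<in>UNIV-{i}. \<gamma> j)"
            using \<gamma> by (simp add: \<Gamma>_def sum.remove[of UNIV i])
          ultimately show ?thesis using i by simp
        qed
        have mon: "monom_fun (\<beta> \<gamma>) z * z $ i ^ m = monom_fun \<gamma> z" for z :: "real ^ 'n"
        proof -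
          have "monom_fun (\<beta> \<gamma>) z = z $ i ^ (\<gamma> i - m) * (\<Prod>j\<in>UNIV-{i}. z $ j ^ \<gamma> j)"
            unfolding monom_fun_def \<beta>_def i_def by (subst prod.remove[of _ "\<iota> \<gamma>"]) (auto intro!: prod.cong)
          moreover have "monom_fun \<gamma> z = z $ i ^ \<gamma> i * (\<Prod>j\<in>UNIV-{i}. z $ j ^ \<gamma> j)"
            unfolding monom_fun_def by (rule prod.remove) auto
          moreover have "z $ i ^ \<gamma> i = z $ i ^ (\<gamma> i - m) * z $ i ^ m"
            using i by (simp flip: power_add)
          ultimately show ?thesis by (simp add: mult_ac)
        qed
        \<comment> \<open>The functional vanishes on multiples of the equations. In the multiple by
          the monomial \<open>\<beta> \<gamma>\<close> all terms of degree below \<open>e\<close>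
          drop out by induction, among them the one with \<open>v i\<close>; what is left is row
          \<gamma> of the eigenvalue equation.\<close>
        have "0 = (\<Sum>z\<in>S. c z * (monom_fun (\<beta> \<gamma>) z * (\<epsilon> * z $ i ^ m + H i z + v i)))"
          using zero by simp
        also have "\<dots> = (\<Sum>z\<in>S. \<epsilon> * (c z * (monom_fun (\<beta> \<gamma>) z * z $ i ^ m))
            + c z * (monom_fun (\<beta> \<gamma>) z * H i z) + v i * (c z * monom_fun (\<beta> \<gamma>) z))"
          by (rule sum.cong) (auto simp: algebra_simps)
        also have "\<dots> = \<epsilon> * lam \<gamma> + (\<Sum>z\<in>S. c z * (monom_fun (\<beta> \<gamma>) z * H i z)) + v i * lam (\<beta> \<gamma>)"
          by (simp add: sum.distrib mon lam_def sum_distrib_left)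
        also have "lam (\<beta> \<gamma>) = 0" using sum\<beta> m by (intro IH) simp
        also have "(\<Sum>z\<in>S. c z * (monom_fun (\<beta> \<gamma>) z * H i z))
            = (\<Sum>\<alpha> | (\<Sum>i\<in>UNIV. \<alpha> i) \<le> m. h i \<alpha> * lam (\<lambda>j. \<beta> \<gamma> j + \<alpha> j))"
          unfolding h lam_def sum_distrib_left
          by (subst sum.swap) (simp add: mult_ac flip: monom_fun_mult)
        also have "\<dots> = (\<Sum>\<alpha>\<in>\<Gamma> m. h i \<alpha> * lam (\<lambda>j. \<beta> \<gamma> j + \<alpha> j))"
        proof (rule sum.mono_neutral_right)
          show "finite {\<alpha> :: 'n \<Rightarrow> nat. (\<Sum>i\<in>UNIV. \<alpha> i) \<le> m}" by (rule finite_exponents_le)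
          show "\<forall>\<alpha>\<in>{\<alpha>. (\<Sum>i\<in>UNIV. \<alpha> i) \<le> m} - \<Gamma> m. h i \<alpha> * lam (\<lambda>j. \<beta> \<gamma> j + \<alpha> j) = 0"
            using sum\<beta> by (auto simp: \<Gamma>_def sum.distrib intro!: IH)
        qed (auto simp: \<Gamma>_def)
        also have "\<dots> = (\<Sum>\<alpha>\<in>\<Gamma> m. \<Sum>\<delta>\<in>\<Gamma> e. if (\<lambda>j. \<beta> \<gamma> j + \<alpha> j) = \<delta> then h i \<alpha> * lam \<delta> else 0)"
        proof (rule sum.cong)
          fix \<alpha> assume "\<alpha> \<in> \<Gamma> m"
          then have "(\<lambda>j. \<beta> \<gamma> j + \<alpha> j) \<in> \<Gamma> e" using sum\<beta> by (simp add: \<Gamma>_def sum.distrib)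
          then show "h i \<alpha> * lam (\<lambda>j. \<beta> \<gamma> j + \<alpha> j) = (\<Sum>\<delta>\<in>\<Gamma> e. if (\<lambda>j. \<beta> \<gamma> j + \<alpha> j) = \<delta> then h i \<alpha> * lam \<delta> else 0)"
            using fin\<Gamma>[of e] by (subst sum.delta') auto
        qed simp
        also have "\<dots> = (\<Sum>\<delta>\<in>\<Gamma> e. K \<gamma> \<delta> * lam \<delta>)"
          using True unfolding K_def i_def
          by (subst sum.swap) (auto simp: sum_distrib_right intro!: sum.cong)
        finally show ?thesis by simp
      qed
      \<comment> \<open>If \<open>lam\<close> were nonzero on some monomial of degree
        \<open>e\<close>, it would be an eigenvector that the choice of \<epsilon> forbids.\<close>
      have "\<epsilon> \<notin> {\<epsilon>. \<exists>v. (\<exists>\<gamma>\<in>\<Gamma> e. v \<gamma> \<noteq> 0) \<and>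
          (\<forall>\<gamma>\<in>\<Gamma> e. \<epsilon> * v \<gamma> + (\<Sum>\<delta>\<in>\<Gamma> e. K \<gamma> \<delta> * v \<delta>) = 0)}"
        using \<epsilon> less.prems by (auto simp: E_def)
      then show ?case using eq by blast
    qed
    from f show ?thesis
    proof (induction rule: poly_fun_le_induct)
      case (monom \<alpha>)
      then show ?case using lam0[of "\<Sum>i\<in>UNIV. \<alpha> i"] by (simp add: \<Gamma>_def lam_def)
    next
      case (cmult a f)
      then show ?case by (simp add: mult.left_commute flip: sum_distrib_left)
    qed (simp_all add: sum.distrib algebra_simps)
  qed
  show ?thesis
  proof (intro exI[of _ E] conjI allI impI finE)
    fix \<epsilon> v and S :: "(real ^ 'n) set" and c f :: "real ^ 'n \<Rightarrow> real"
    assume "\<epsilon> \<notin> E" "finite S" "\<forall>z\<in>S. \<forall>i. \<epsilon> * z $ i ^ m + H i z + v i = 0"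
      "\<forall>\<alpha>. (\<forall>i. \<alpha> i < m) \<longrightarrow> (\<Sum>i\<in>UNIV. \<alpha> i) \<le> D \<longrightarrow> (\<Sum>z\<in>S. c z * monom_fun \<alpha> z) = 0"
      "f \<in> poly_fun_le D"
    then show "(\<Sum>z\<in>S. c z * f z) = 0"
      by (intro main[of \<epsilon> S v c f]) simp_all
  qed
qed

text \<open>The degree bound excludes from the box at least the top exponent and the
  \<open>n\<close> exponents obtained by lowering one of its coordinates by 1. These
  \<open>n + 1\<close> are the gain over Bezout's bound.\<close>

lemma card_box_below_top:
  assumes m: "m \<ge> 2" and n: "CARD('n::finite) \<ge> 2"
  shows "finite {\<alpha> :: 'n \<Rightarrow> nat. (\<forall>i. \<alpha> i < m) \<and> (\<Sum>i\<in>UNIV. \<alpha> i) \<le> CARD('n) * (m - 1) - 2}" (is "finite ?A")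
    and "card {\<alpha> :: 'n \<Rightarrow> nat. (\<forall>i. \<alpha> i < m) \<and> (\<Sum>i\<in>UNIV. \<alpha> i) \<le> CARD('n) * (m - 1) - 2} + CARD('n) + 1
      \<le> m ^ CARD('n)"
proof -
  let ?Box = "PiE (UNIV :: 'n set) (\<lambda>_. {..<m})"
  define top where "top = (\<lambda>_ :: 'n. m - 1)"
  define X where "X = insert top (range (\<lambda>i. top(i := m - 2)))"
  have finBox: "finite ?Box" by (intro finite_PiE) auto
  have cardBox: "card ?Box = m ^ CARD('n)" by (simp add: card_PiE)
  have X: "X \<subseteq> ?Box" using m by (auto simp: X_def top_def PiE_UNIV_domain)
  have inj: "inj (\<lambda>i :: 'n. top(i := m - 2))"
  proof (rule injI, rule ccontr)
    fix i j :: 'n assume "top(i := m - 2) = top(j := m - 2)" "i \<noteq> j"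
    then have "m - 2 = m - 1" by (metis fun_upd_apply top_def)
    then show False using m by simp
  qed
  have "top \<noteq> top(i := m - 2)" for i
  proof
    assume "top = top(i := m - 2)"
    then have "m - 1 = m - 2" by (metis fun_upd_apply top_def)
    then show False using m by simp
  qed
  then have "top \<notin> range (\<lambda>i. top(i := m - 2))" by blast
  then have cardX: "card X = CARD('n) + 1"
    by (simp add: X_def card_image[OF inj])
  have sumX: "CARD('n) * (m - 1) \<le> (\<Sum>i\<in>UNIV. \<alpha> i) + 1" if \<alpha>: "\<alpha> \<in> X" for \<alpha>
  proof (cases "\<alpha> = top")
    case False
    then obtain i where i: "\<alpha> = top(i := m - 2)" using \<alpha> by (auto simp: X_def)
    have "(\<Sum>j\<in>UNIV. \<alpha> j) = (m - 2) + (\<Sum>j\<in>UNIV-{i}. top j)"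
      unfolding i by (subst sum.remove[of _ i]) (auto intro!: sum.cong)
    moreover have "(\<Sum>j\<in>UNIV. top j) = (m - 1) + (\<Sum>j\<in>UNIV-{i}. top j)"
      by (subst sum.remove[of _ i]) (auto simp: top_def)
    moreover have "(\<Sum>j\<in>UNIV. top j) = CARD('n) * (m - 1)" by (simp add: top_def)
    ultimately show ?thesis using m by linarith
  qed (simp add: top_def)
  \<comment> \<open>This makes the truncated subtraction of 2 exact.\<close>
  have "2 * 1 \<le> CARD('n) * (m - 1)" using m n by (intro mult_le_mono) auto
  then have sub: "?A \<subseteq> ?Box - X" using sumX by (fastforce simp: PiE_UNIV_domain)
  then show "finite ?A" using finBox by (meson finite_Diff finite_subset)
  have "card ?A \<le> card (?Box - X)" using sub finBox by (intro card_mono) auto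
  also have "\<dots> = m ^ CARD('n) - (CARD('n) + 1)"
    using X finBox by (subst card_Diff_subset) (auto simp: cardBox cardX intro: finite_subset)
  finally have "card ?A \<le> m ^ CARD('n) - (CARD('n) + 1)" .
  moreover have "CARD('n) + 1 \<le> m ^ CARD('n)"
    using card_mono[OF finBox X] by (simp add: cardX cardBox)
  ultimately show "card ?A + CARD('n) + 1 \<le> m ^ CARD('n)" by simp
qed

section \<open>Divided differences and the Bezoutian\<close>

text \<open>Polynomials in two vectors of total degree at most \<open>e\<close>, encoded as sums of
  products \<open>f x * g y\<close>, so that a functional can act on the first vector alone.\<close>

inductive bideg :: "nat \<Rightarrow> (real ^ 'n \<Rightarrow> real ^ 'n \<Rightarrow> real) \<Rightarrow> bool" for e :: nat where
  bideg_zero: "bideg e (\<lambda>x y. 0)"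
| bideg_prod: "f \<in> poly_fun_le p \<Longrightarrow> g \<in> poly_fun_le q \<Longrightarrow> p + q \<le> e \<Longrightarrow> bideg e (\<lambda>x y. f x * g y)"
| bideg_add: "bideg e F \<Longrightarrow> bideg e G \<Longrightarrow> bideg e (\<lambda>x y. F x y + G x y)"

lemma bideg_fst: "f \<in> poly_fun_le e \<Longrightarrow> bideg e (\<lambda>x y. f x)"
  using bideg_prod[of f e "\<lambda>_. 1" 0 e] by simp

lemma bideg_snd: "f \<in> poly_fun_le e \<Longrightarrow> bideg e (\<lambda>x y. f y)"
  using bideg_prod[of "\<lambda>_. 1" 0 f e e] by simp

lemma bideg_sum: "(\<And>i. i \<in> I \<Longrightarrow> bideg e (F i)) \<Longrightarrow> bideg e (\<lambda>x y. \<Sum>i\<in>I. F i x y)"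
  by (induction I rule: infinite_finite_induct) (auto intro: bideg_zero bideg_add)

lemma bideg_mult:
  assumes "bideg d F" "bideg e G"
  shows "bideg (d + e) (\<lambda>x y. F x y * G x y)"
  using assms(1)
proof (induction rule: bideg.induct)
  case (bideg_prod f p g q)
  note 1 = bideg_prod
  from assms(2) show ?case
  proof (induction rule: bideg.induct)
    case (bideg_prod f' p' g' q')
    have "bideg (d + e) (\<lambda>x y. (f x * f' x) * (g y * g' y))"
      using 1 bideg_prod by (intro bideg.bideg_prod[OF poly_fun_le_mult poly_fun_le_mult]) auto
    then show ?case by (simp add: mult_ac)
  qed (auto simp: distrib_left intro: bideg.intros)
qed (auto simp: distrib_right intro: bideg.intros)

lemma bideg_const: "bideg 0 (\<lambda>x y. c)"
  using bideg_fst[of "\<lambda>_. c" 0] by simp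

lemma bideg_finite_prod:
  assumes "finite I" "\<And>i. i \<in> I \<Longrightarrow> bideg e (F i)"
  shows "bideg (card I * e) (\<lambda>x y. \<Prod>i\<in>I. F i x y)"
  using assms by (induction I rule: finite_induct) (auto intro: bideg_const bideg_mult)

lemma bideg_diag: "bideg e F \<Longrightarrow> (\<lambda>x. F x x) \<in> poly_fun_le e"
proof (induction rule: bideg.induct)
  case (bideg_prod f p g q)
  then show ?case by (intro poly_fun_le_mono[OF poly_fun_le_mult])
qed auto

lemma bideg_det:
  fixes A :: "'n::finite \<Rightarrow> 'n \<Rightarrow> real ^ 'n \<Rightarrow> real ^ 'n \<Rightarrow> real"
  assumes "\<And>i j. bideg e (A i j)"
  shows "bideg (CARD('n) * e) (\<lambda>x y. det (\<chi> i j. A i j x y))"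
proof -
  have "bideg (0 + CARD('n) * e) (\<lambda>x y. of_int (sign p) * (\<Prod>i\<in>UNIV. A i (p i) x y))" for p :: "'n \<Rightarrow> 'n"
    using assms by (intro bideg_mult bideg_const bideg_finite_prod) auto
  then show ?thesis unfolding det_def by (intro bideg_sum) simp
qed

text \<open>In a product \<open>f x * g y\<close> of total degree at most \<open>e + 2\<close>,
  either \<open>f\<close> has degree at most \<open>e\<close> and is killed, or \<open>g\<close> has
  degree at most 1.\<close>

lemma bideg_functional:
  assumes F: "bideg (e + 2) F" and kill: "\<And>f. f \<in> poly_fun_le e \<Longrightarrow> (\<Sum>z\<in>S. c z * f z) = 0"
  shows "(\<lambda>y. \<Sum>z\<in>S. c z * F z y) \<in> poly_fun_le 1"
  using F
proof (induction rule: bideg.induct)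
  case (bideg_prod f p g q)
  have eq: "(\<Sum>z\<in>S. c z * (f z * g y)) = (\<Sum>z\<in>S. c z * f z) * g y" for y
    unfolding sum_distrib_right by (rule sum.cong) auto
  show ?case
  proof (cases "p \<le> e")
    case True
    then have "(\<Sum>z\<in>S. c z * f z) = 0" by (intro kill poly_fun_le_mono[OF bideg_prod(1)])
    then show ?thesis unfolding eq by (simp only: mult_zero_left poly_fun_le_zero)
  next
    case False
    then have "q \<le> 1" using bideg_prod(3) by simp
    then show ?thesis unfolding eq by (intro poly_fun_le_cmult poly_fun_le_mono[OF bideg_prod(2)])
  qed
next
  case (bideg_add F G)
  then show ?case unfolding distrib_left sum.distrib by (intro poly_fun_le_add)
qed simp

text \<open>Induction on the degree via f = c + \<Sum> x_i F_i and the identity x_i F_i(x) - y_i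
  F_i(y) = (x_i - y_i) F_i(x) + y_i (F_i(x) - F_i(y)). On the diagonal the \<open>A j\<close> are
  the partial derivatives, which ties the Bezoutian of a gradient to the Hessian.\<close>

lemma divided_differences:
  fixes f :: "real ^ 'n::finite \<Rightarrow> real"
  assumes "f \<in> poly_fun_le (Suc e)"
  obtains A where "\<And>j. bideg e (A j)" "\<And>x y. f x - f y = (\<Sum>j\<in>UNIV. A j x y * (x $ j - y $ j))"
    "\<And>z. (f has_derivative (\<lambda>h. \<Sum>j\<in>UNIV. A j z z * h $ j)) (at z)"
proof -
  let ?Q = "\<lambda>e f A. (\<forall>j. bideg e (A j)) \<and> (\<forall>x y. f x - f y = (\<Sum>j\<in>UNIV. A j x y * (x $ j - y $ j))) \<and>
    (\<forall>z. (f has_derivative (\<lambda>h. \<Sum>j\<in>UNIV. A j z z * h $ j)) (at z))"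
  from assms have "\<exists>A. ?Q e f A"
  proof (induction e arbitrary: f)
    case 0
    then obtain c F where F: "\<And>i. F i \<in> poly_fun_le 0" "f = (\<lambda>x. c + (\<Sum>i\<in>UNIV. x $ i * F i x))"
      by (rule poly_fun_le_Suc) (rule that; assumption)
    have "\<exists>a. F i = (\<lambda>x. a)" for i using F(1) poly_fun_le_0 by metis
    then obtain a where a: "\<And>i. F i = (\<lambda>x. a i)" by metis
    show ?case
    proof (intro exI conjI allI)
      show "bideg 0 (\<lambda>x y. a j)" for j by (rule bideg_const)
      show "f x - f y = (\<Sum>j\<in>UNIV. a j * (x $ j - y $ j))" for x y
        by (simp add: F a algebra_simps sum_subtractf)
      show "(f has_derivative (\<lambda>h. \<Sum>j\<in>UNIV. a j * h $ j)) (at z)" for z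
        unfolding F(2) a
        by (auto intro!: derivative_eq_intros bounded_linear_imp_has_derivative[OF bounded_linear_vec_nth]
              simp: mult.commute)
    qed
  next
    case (Suc e)
    from Suc.prems obtain c F where F: "\<And>i. F i \<in> poly_fun_le (Suc e)" "f = (\<lambda>x. c + (\<Sum>i\<in>UNIV. x $ i * F i x))"
      by (rule poly_fun_le_Suc) (rule that; assumption)
    have "\<exists>A. ?Q e (F i) A" for i by (rule Suc.IH[OF F(1)])
    then have "\<exists>A. \<forall>i. ?Q e (F i) (A i)" by (rule choice[OF allI])
    then obtain A where A: "\<And>i j. bideg e (A i j)"
      "\<And>i x y. F i x - F i y = (\<Sum>j\<in>UNIV. A i j x y * (x $ j - y $ j))"
      "\<And>i z. (F i has_derivative (\<lambda>h. \<Sum>j\<in>UNIV. A i j z z * h $ j)) (at z)"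
      by blast
    define B where "B j x y = F j x + (\<Sum>i\<in>UNIV. y $ i * A i j x y)" for j x y
    show ?case
    proof (intro exI[of _ B] conjI allI)
      show "bideg (Suc e) (B j)" for j
      proof -
        have "bideg (1 + e) (\<lambda>x y. y $ i * A i j x y)" for i
          by (intro bideg_mult bideg_snd A(1) coord_in_poly_fun_le)
        then show ?thesis unfolding B_def using F(1) by (intro bideg_add bideg_fst bideg_sum) auto
      qed
      show "f x - f y = (\<Sum>j\<in>UNIV. B j x y * (x $ j - y $ j))" for x y
      proof -
        have "f x - f y = (\<Sum>i\<in>UNIV. (x $ i - y $ i) * F i x + y $ i * (F i x - F i y))"
          unfolding F(2) by (simp add: algebra_simps sum_subtractf sum.distrib)
        also have "\<dots> = (\<Sum>i\<in>UNIV. F i x * (x $ i - y $ i))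
            + (\<Sum>i\<in>UNIV. \<Sum>j\<in>UNIV. y $ i * A i j x y * (x $ j - y $ j))"
          by (simp add: A(2) sum.distrib sum_distrib_left mult_ac)
        also have "\<dots> = (\<Sum>j\<in>UNIV. F j x * (x $ j - y $ j))
            + (\<Sum>j\<in>UNIV. \<Sum>i\<in>UNIV. y $ i * A i j x y * (x $ j - y $ j))"
          by (subst (2) sum.swap) simp
        also have "\<dots> = (\<Sum>j\<in>UNIV. B j x y * (x $ j - y $ j))"
          by (simp add: B_def distrib_right sum.distrib sum_distrib_right)
        finally show ?thesis .
      qed
      show "(f has_derivative (\<lambda>h. \<Sum>j\<in>UNIV. B j z z * h $ j)) (at z)" for z
      proof -
        have "(f has_derivative (\<lambda>h. 0 + (\<Sum>i\<in>UNIV. z $ i * (\<Sum>j\<in>UNIV. A i j z z * h $ j) + h $ i * F i z))) (at z)"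
          unfolding F(2)
          by (intro has_derivative_add has_derivative_const has_derivative_sum has_derivative_mult A(3)
                bounded_linear_imp_has_derivative[OF bounded_linear_vec_nth])
        also have "(\<lambda>h. 0 + (\<Sum>i\<in>UNIV. z $ i * (\<Sum>j\<in>UNIV. A i j z z * h $ j) + h $ i * F i z))
            = (\<lambda>h. \<Sum>j\<in>UNIV. B j z z * h $ j)"
        proof
          fix h :: "real ^ 'n"
          have "0 + (\<Sum>i\<in>UNIV. z $ i * (\<Sum>j\<in>UNIV. A i j z z * h $ j) + h $ i * F i z)
              = (\<Sum>i\<in>UNIV. F i z * h $ i) + (\<Sum>i\<in>UNIV. \<Sum>j\<in>UNIV. z $ i * A i j z z * h $ j)"
            by (simp add: sum.distrib sum_distrib_left mult_ac)
          also have "\<dots> = (\<Sum>j\<in>UNIV. F j z * h $ j) + (\<Sum>j\<in>UNIV. \<Sum>i\<in>UNIV. z $ i * A i j z z * h $ j)"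
            by (subst (2) sum.swap) simp
          also have "\<dots> = (\<Sum>j\<in>UNIV. B j z z * h $ j)"
            by (simp add: B_def distrib_right sum.distrib sum_distrib_right)
          finally show "0 + (\<Sum>i\<in>UNIV. z $ i * (\<Sum>j\<in>UNIV. A i j z z * h $ j) + h $ i * F i z)
              = (\<Sum>j\<in>UNIV. B j z z * h $ j)" .
        qed
        finally show ?thesis .
      qed
    qed
  qed
  with that show ?thesis by blast
qed

lemma det_eq_0_if_kernel:
  fixes M :: "real ^ 'n ^ 'n"
  assumes "M *v h = 0" "h \<noteq> 0"
  shows "det M = 0"
proof (rule ccontr)
  assume "det M \<noteq> 0"
  then have "invertible M" by (simp add: invertible_det_nz)
  then have "\<exists>B. B ** M = mat 1" by (auto simp: invertible_def)
  then show False using assms matrix_left_invertible_ker[of M] by blast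
qed

text \<open>The Bezoutian \<open>det A(x, y)\<close> vanishes at pairs of distinct common zeros. Applying the functional
  \<open>f \<mapsto> \<Sum> c\<^sub>z f(z)\<close> to it in the variable \<open>x\<close> shows that \<open>c\<^sub>z det A(z, z)\<close> is affine in \<open>z\<close>, and
  evaluating the functional at this affine function times \<open>W\<close> yields a sum of nonnegative terms.\<close>
lemma bezoutian_functional_zero:
  fixes A :: "'n::finite \<Rightarrow> 'n \<Rightarrow> real ^ 'n \<Rightarrow> real ^ 'n \<Rightarrow> real" and G :: "'n \<Rightarrow> real ^ 'n \<Rightarrow> real"
  assumes A: "\<And>i j. bideg k (A i j)"
    and G: "\<And>i x y. G i x - G i y = (\<Sum>j\<in>UNIV. A i j x y * (x $ j - y $ j))"
    and S: "finite S" "\<And>z i. z \<in> S \<Longrightarrow> G i z = 0"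
    and kill: "\<And>f. f \<in> poly_fun_le (CARD('n) * k - 2) \<Longrightarrow> (\<Sum>z\<in>S. c z * f z) = 0"
    and W: "W \<in> poly_fun_le w" "1 + w \<le> CARD('n) * k - 2"
    and pos: "\<And>z. z \<in> S \<Longrightarrow> W z * det (\<chi> i j. A i j z z) > 0"
    and z: "z \<in> S"
  shows "c z = 0"
proof -
  define b where "b x y = det (\<chi> i j. A i j x y)" for x y
  have b0: "b x y = 0" if "x \<in> S" "y \<in> S" "x \<noteq> y" for x y
  proof -
    have "(\<chi> i j. A i j x y) *v (x - y) = 0"
      using G[of _ x y] S(2) that by (simp add: matrix_vector_mult_def vec_eq_iff)
    then show ?thesis unfolding b_def using that by (intro det_eq_0_if_kernel) auto
  qed
  define L where "L y = (\<Sum>z\<in>S. c z * b z y)" for y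
  \<comment> \<open>\<open>W(2)\<close> makes the truncated difference positive, hence
    exact.\<close>
  have e2: "CARD('n) * k - 2 + 2 = CARD('n) * k" using W(2) by simp
  have L: "L \<in> poly_fun_le 1"
    unfolding L_def
  proof (rule bideg_functional[OF _ kill])
    show "bideg (CARD('n) * k - 2 + 2) b"
      unfolding e2 b_def by (rule bideg_det[OF A])
  qed
  have LW: "(\<lambda>x. L x * W x) \<in> poly_fun_le (CARD('n) * k - 2)"
    by (rule poly_fun_le_mono[OF poly_fun_le_mult[OF L W(1)] W(2)])
  have Lz: "L z = c z * b z z" if "z \<in> S" for z
  proof -
    have "L z = c z * b z z + (\<Sum>y\<in>S-{z}. c y * b y z)"
      unfolding L_def using S(1) that by (rule sum.remove)
    also have "(\<Sum>y\<in>S-{z}. c y * b y z) = 0" using b0 that by (intro sum.neutral) auto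
    finally show ?thesis by simp
  qed
  have "(\<Sum>z\<in>S. (c z)\<^sup>2 * (W z * b z z)) = (\<Sum>z\<in>S. c z * (L z * W z))"
    by (intro sum.cong) (auto simp: Lz power2_eq_square)
  also have "\<dots> = 0" by (rule kill[OF LW])
  finally have "\<forall>z\<in>S. (c z)\<^sup>2 * (W z * b z z) = 0"
    using S(1) pos by (subst (asm) sum_nonneg_eq_0_iff) (auto simp: b_def less_imp_le)
  then show ?thesis using z pos[OF z] by (auto simp: b_def)
qed

subsection \<open>Counting extrema\<close>

lemma det_uminus:
  fixes M :: "real ^ 'n ^ 'n"
  shows "det (- M) = (-1) ^ CARD('n) * det M"
proof -
  have "- M = (\<chi> i. (-1) *s M $ i)" by (simp add: vec_eq_iff)
  then show ?thesis using det_rows_mul[of "\<lambda>_. -1" "\<lambda>i. M $ i"] by simp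
qed

text \<open>On the segment from the identity to \<open>M\<close> the quadratic form is positive
  definite before the end point, so the determinant has no zero there and cannot become negative.
  The argument applies to matrices that are not known to be symmetric.\<close>

lemma det_pos_if_semidefinite:
  fixes M :: "real ^ 'n ^ 'n"
  assumes psd: "\<And>h. 0 \<le> h \<bullet> (M *v h)" and "det M \<noteq> 0"
  shows "det M > 0"
proof (rule ccontr)
  assume "\<not> det M > 0"
  then have neg: "det M < 0" using assms(2) by simp
  define N where "N t = (1 - t) *\<^sub>R mat 1 + t *\<^sub>R M" for t :: real
  have "\<exists>t\<ge>0. t \<le> 1 \<and> det (N t) = 0"
  proof (rule IVT2')
    show "continuous_on {0..1} (\<lambda>t. det (N t))"
      unfolding det_def N_def by (auto intro!: continuous_intros)
  qed (use neg in \<open>auto simp: N_def\<close>)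
  then obtain t where t: "0 \<le> t" "t \<le> 1" "det (N t) = 0" by blast
  have "t \<noteq> 1" using t assms(2) by (auto simp: N_def)
  have "\<exists>h. h \<noteq> 0 \<and> N t *v h = 0"
    using t(3) matrix_left_invertible_ker[of "N t"] invertible_det_nz[of "N t"] invertible_left_inverse[of "N t"]
    by metis
  then obtain h where h: "h \<noteq> 0" "N t *v h = 0" by blast
  have "N t *v h = (1 - t) *\<^sub>R h + t *\<^sub>R (M *v h)"
    by (simp add: N_def matrix_vector_mult_add_rdistrib scaleR_matrix_vector_assoc[symmetric])
  then have "0 = (1 - t) * (h \<bullet> h) + t * (h \<bullet> (M *v h))"
    using h(2) by (metis inner_add_right inner_scaleR_right inner_zero_right)
  moreover have "(1 - t) * (h \<bullet> h) > 0" using t \<open>t \<noteq> 1\<close> h(1) by simp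
  moreover have "t * (h \<bullet> (M *v h)) \<ge> 0" using t psd by simp
  ultimately show False by linarith
qed

text \<open>If the trace vanished, \<open>M\<close> would be antisymmetric, hence singular in odd dimension.\<close>
lemma trace_pos_if_semidefinite:
  fixes M :: "real ^ 'n ^ 'n"
  assumes psd: "\<And>h. 0 \<le> h \<bullet> (M *v h)" and "det M \<noteq> 0" and "odd CARD('n)"
  shows "(\<Sum>i\<in>UNIV. M $ i $ i) > 0"
proof (rule ccontr)
  assume *: "\<not> (\<Sum>i\<in>UNIV. M $ i $ i) > 0"
  have entry: "axis i 1 \<bullet> (M *v axis j 1) = M $ i $ j" for i j
    by (simp add: matrix_vector_mult_basis inner_axis' column_def)
  have nonneg: "M $ i $ i \<ge> 0" for i using psd[of "axis i 1"] by (simp add: entry)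
  then have "(\<Sum>i\<in>UNIV. M $ i $ i) = 0" using * sum_nonneg[of UNIV "\<lambda>i. M $ i $ i"] by auto
  then have diag: "M $ i $ i = 0" for i
    using nonneg by (subst (asm) sum_nonneg_eq_0_iff) auto
  \<comment> \<open>With zero diagonal, the form at \<open>axis i 1 + c *\<^sub>R axis j 1\<close>
    is linear in \<open>c\<close>; being nonnegative, it vanishes.\<close>
  have "M $ i $ j + M $ j $ i = 0" for i j
  proof -
    have "0 \<le> (axis i 1 + c *\<^sub>R axis j 1) \<bullet> (M *v (axis i 1 + c *\<^sub>R axis j 1))" for c :: real
      by (rule psd)
    then have "0 \<le> c * (M $ i $ j + M $ j $ i)" for c
      by (simp add: matrix_vector_right_distrib matrix_vector_mult_scaleR inner_add_left inner_add_right
          entry diag algebra_simps)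
    from this[of 1] this[of "-1"] show ?thesis by simp
  qed
  then have "transpose M = - M" by (simp add: vec_eq_iff transpose_def eq_neg_iff_add_eq_0)
  then have "det M = det (- M)" by (metis det_transpose)
  then show False using assms(2,3) by (simp add: det_uminus)
qed

text \<open>If the second-order form were negative at \<open>h\<close>, the slope of
  \<open>Q\<close> in direction \<open>h\<close> would be negative just after
  \<open>z\<close>.\<close>

lemma local_min_second_order:
  fixes Q :: "real ^ 'n \<Rightarrow> real"
  assumes Q: "\<And>x. (Q has_derivative (\<lambda>h. g x \<bullet> h)) (at x)"
    and g: "(g has_derivative (\<lambda>h. M *v h)) (at z)"
    and U: "open U" "z \<in> U" "\<forall>y\<in>U. Q z \<le> Q y"
  shows "g z = 0" and "0 \<le> h \<bullet> (M *v h)"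
proof -
  have "(\<lambda>h. g z \<bullet> h) = (\<lambda>h. 0)"
    using differential_zero_maxmin[OF U(2,1) Q] U(3) by blast
  then show gz: "g z = 0" by (metis inner_eq_zero_iff)
  show "0 \<le> h \<bullet> (M *v h)"
  proof (rule ccontr)
    assume neg: "\<not> 0 \<le> h \<bullet> (M *v h)"
    define \<phi> where "\<phi> t = Q (z + t *\<^sub>R h)" for t
    define \<psi> where "\<psi> t = g (z + t *\<^sub>R h) \<bullet> h" for t
    have d\<phi>: "(\<phi> has_real_derivative \<psi> t) (at t)" for t
    proof -
      have "((\<lambda>t. Q (z + t *\<^sub>R h)) has_derivative (\<lambda>s. g (z + t *\<^sub>R h) \<bullet> (s *\<^sub>R h))) (at t)"
        by (rule has_derivative_compose[OF _ Q, of "\<lambda>t. z + t *\<^sub>R h" "\<lambda>s. s *\<^sub>R h"])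
           (auto intro!: derivative_eq_intros)
      then show ?thesis
        by (simp add: has_field_derivative_def \<phi>_def[abs_def] \<psi>_def mult_commute_abs)
    qed
    have "((\<lambda>t. g (z + t *\<^sub>R h)) has_derivative (\<lambda>s. M *v (s *\<^sub>R h))) (at 0)"
      by (rule has_derivative_compose[of "\<lambda>t. z + t *\<^sub>R h" "\<lambda>s. s *\<^sub>R h"])
         (auto intro!: derivative_eq_intros simp: g)
    then have "(\<psi> has_derivative (\<lambda>s. (M *v (s *\<^sub>R h)) \<bullet> h)) (at 0)"
      unfolding \<psi>_def by (rule has_derivative_inner_left)
    then have "(\<psi> has_real_derivative (h \<bullet> (M *v h))) (at 0)"
      by (simp add: has_field_derivative_def matrix_vector_mult_scaleR inner_commute mult_commute_abs)
    then obtain d where d: "d > 0" "\<And>s. 0 < s \<Longrightarrow> s < d \<Longrightarrow> \<psi> s < \<psi> 0"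
      using DERIV_neg_dec_right[of \<psi> "h \<bullet> (M *v h)" 0] neg by auto
    have "open ((\<lambda>t. z + t *\<^sub>R h) -` U)"
      by (intro open_vimage U(1)) (auto intro!: continuous_intros)
    moreover have "0 \<in> (\<lambda>t. z + t *\<^sub>R h) -` U" using U(2) by simp
    ultimately obtain e where e: "e > 0" "ball 0 e \<subseteq> (\<lambda>t. z + t *\<^sub>R h) -` U"
      by (meson open_contains_ball)
    define t where "t = min d e / 2"
    have t: "0 < t" "t < d" "t < e" using d(1) e(1) by (auto simp: t_def)
    have "\<phi> t < \<phi> 0"
    proof (rule DERIV_neg_imp_decreasing_open[OF t(1)])
      show "\<exists>y. (\<phi> has_real_derivative y) (at x) \<and> y < 0" if "0 < x" "x < t" for x
        using d\<phi>[of x] d(2)[of x] that t gz by (auto simp: \<psi>_def)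
      show "continuous_on {0..t} \<phi>"
        using d\<phi> by (meson DERIV_continuous_on DERIV_subset has_field_derivative_at_within)
    qed
    moreover have "z + t *\<^sub>R h \<in> U" using e(2) t by (auto simp: subset_iff dist_real_def)
    ultimately show False using U(3) by (auto simp: \<phi>_def)
  qed
qed

text \<open>Sard's theorem: the critical values form a null set and cannot fill a ball.
  \<open>reindex\<close> again provides the ordered index type.\<close>

lemma regular_value_near_0:
  fixes f :: "real ^ 'n \<Rightarrow> real ^ 'n" and M :: "real ^ 'n \<Rightarrow> real ^ 'n ^ 'n"
  assumes f: "\<And>x. (f has_derivative (\<lambda>h. M x *v h)) (at x)" and "\<delta> > 0"
  shows "\<exists>v. norm v < \<delta> \<and> (\<forall>x. f x = v \<longrightarrow> det (M x) \<noteq> 0)"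
proof -
  define S where "S = reindex ` {x. det (M x) = 0}"
  define F where "F = (\<lambda>y. reindex (f (unreindex y)))"
  define F' where "F' y h = reindex (M (unreindex y) *v unreindex h)" for y h
  have "negligible (F ` S)"
  proof (rule baby_Sard)
    show "(F has_derivative F' y) (at y within S)" for y
    proof -
      have "((\<lambda>y. f (unreindex y)) has_derivative (\<lambda>h. M (unreindex y) *v unreindex h)) (at y)"
        using f by (rule has_derivative_compose[OF linear_imp_has_derivative[OF linear_unreindex]])
      then have "(F has_derivative F' y) (at y)"
        unfolding F_def F'_def
        by (rule bounded_linear.has_derivative[OF linear_conv_bounded_linear[THEN iffD1, OF linear_reindex]])
      then show ?thesis by (rule has_derivative_at_withinI)
    qed
    show "rank (matrix (F' y)) < CARD('n ordered)" if "y \<in> S" for y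
    proof -
      obtain x where x: "y = reindex x" "det (M x) = 0" using \<open>y \<in> S\<close> by (auto simp: S_def)
      have "\<not> inj ((*v) (M x))"
        using x(2) by (metis det_nz_iff_inj matrix_of_matrix_vector_mul matrix_vector_mul_linear)
      then obtain a b where ab: "a \<noteq> b" "M x *v a = M x *v b" by (auto simp: inj_def)
      have lin: "linear (F' y)"
        unfolding F'_def
        using linear_compose[OF linear_compose[OF linear_unreindex matrix_vector_mul_linear[of "M (unreindex y)"]] linear_reindex]
        by (simp add: o_def)
      have "F' y (reindex a) = F' y (reindex b)" using ab(2) by (simp add: F'_def x(1))
      moreover have "reindex a \<noteq> reindex b" using ab(1) by (metis unreindex_reindex)
      ultimately have "\<not> inj (F' y)" by (auto simp: inj_def)
      then have "det (matrix (F' y)) = 0" using det_nz_iff_inj[OF lin] by blast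
      then show ?thesis by (simp only: det_eq_0_rank)
    qed
  qed simp
  then have "\<not> ball 0 \<delta> \<subseteq> F ` S"
    using open_not_negligible[of "ball (0 :: real ^ ('n ordered)) \<delta>"] assms(2) negligible_subset by auto
  then obtain w where w: "norm w < \<delta>" "w \<notin> F ` S" by (auto simp: subset_iff)
  have "norm (unreindex w) = norm w" by (simp add: norm_eq_sqrt_inner)
  moreover have "det (M x) \<noteq> 0" if "f x = unreindex w" for x
  proof
    assume "det (M x) = 0"
    then have "F (reindex x) \<in> F ` S" by (auto simp: S_def)
    then show False using w(2) that by (simp add: F_def)
  qed
  ultimately show ?thesis using w(1) by (intro exI[of _ "unreindex w"]) auto
qed

text \<open>The perturbation adds the terms \<epsilon> x_i^d / d and a linear form, so the gradient
  becomes \<epsilon> x_i^m + H_i + v_i with m = d - 1. The exceptional set of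
  \<open>reduction_to_box\<close> does not depend on the constants, so \<epsilon> can be fixed
  outside it before Sard's theorem supplies \<open>v\<close>. More than m^n - n - 1 extrema would
  carry a nonzero functional that kills all polynomials of low degree, and
  \<open>bezoutian_functional_zero\<close> excludes it.\<close>

theorem extrema_count:
  fixes P :: "real ^ 'n \<Rightarrow> real"
  assumes P: "P \<in> poly_fun_le d" and d: "d \<ge> 4" and n: "CARD('n) \<ge> 2" and \<eta>: "\<eta> > 0"
  shows "\<exists>Q\<in>poly_fun_le d. (\<forall>x\<in>cball 0 1. \<bar>Q x - P x\<bar> \<le> \<eta>) \<and>
    (\<forall>S. finite S \<longrightarrow> (\<forall>z\<in>S. \<exists>U. open U \<and> z \<in> U \<and> ((\<forall>y\<in>U. Q y \<le> Q z) \<or> (\<forall>y\<in>U. Q z \<le> Q y))) \<longrightarrow>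
      card S + CARD('n) + 1 \<le> (d - 1) ^ CARD('n))"
proof -
  let ?n = "CARD('n)"
  define m where "m = d - 1"
  define k where "k = m - 1"
  have mk: "d = Suc m" "m = Suc k" "k \<ge> 2" using d by (auto simp: m_def k_def)
  obtain B where B: "\<And>j. bideg m (B j)"
    "\<And>z. (P has_derivative (\<lambda>h. \<Sum>j\<in>UNIV. B j z z * h $ j)) (at z)"
    using divided_differences[of P m] P mk(1) by metis
  \<comment> \<open>On the diagonal the divided differences are the partial derivatives of
    \<open>P\<close>.\<close>
  define H where "H j z = B j z z" for j z
  have H: "H j \<in> poly_fun_le m" for j
    unfolding H_def by (rule bideg_diag[OF B(1)])
  define D where "D = ?n * k - 2"
  obtain E where E: "finite E" and red: "\<And>\<epsilon> v S c f. \<epsilon> \<notin> E \<Longrightarrow> finite S \<Longrightarrow>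
     \<forall>z\<in>S. \<forall>i. \<epsilon> * z $ i ^ m + H i z + v i = 0 \<Longrightarrow>
     \<forall>\<alpha>. (\<forall>i. \<alpha> i < m) \<longrightarrow> (\<Sum>i\<in>UNIV. \<alpha> i) \<le> D \<longrightarrow> (\<Sum>z\<in>S. c z * monom_fun \<alpha> z) = 0 \<Longrightarrow>
     f \<in> poly_fun_le D \<Longrightarrow> (\<Sum>z\<in>S. c z * f z) = 0"
    using reduction_to_box[of H m D, OF H] mk(2) by auto
  \<comment> \<open>With this bound on \<epsilon> the \<open>n\<close> powers contribute at most
    half of \<eta> on the ball; the linear form contributes the other half.\<close>
  have "infinite {0<..<\<eta> / (2 * real ?n)}" using \<eta> by (simp add: infinite_Ioo)
  then have "\<not> {0<..<\<eta> / (2 * real ?n)} \<subseteq> E" using E finite_subset by blast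
  then obtain \<epsilon> where "\<epsilon> \<in> {0<..<\<eta> / (2 * real ?n)}" "\<epsilon> \<notin> E" by blast
  then have \<epsilon>: "\<epsilon> \<notin> E" "0 < \<epsilon>" "\<epsilon> < \<eta> / (2 * real ?n)" by simp_all
  define G0 where "G0 i z = \<epsilon> * z $ i ^ m + H i z" for i and z :: "real ^ 'n"
  have G0: "G0 i \<in> poly_fun_le (Suc k)" for i
    unfolding G0_def mk(2)[symmetric] by (intro poly_fun_le_add poly_fun_le_cmult coord_power_in_poly_fun_le H)
  have "\<exists>A. (\<forall>j. bideg k (A j)) \<and> (\<forall>x y. G0 i x - G0 i y = (\<Sum>j\<in>UNIV. A j x y * (x $ j - y $ j))) \<and>
    (\<forall>z. (G0 i has_derivative (\<lambda>h. \<Sum>j\<in>UNIV. A j z z * h $ j)) (at z))" for i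
    by (rule divided_differences[OF G0[of i]]) blast
  then have "\<exists>A. \<forall>i. (\<forall>j. bideg k (A i j)) \<and> (\<forall>x y. G0 i x - G0 i y = (\<Sum>j\<in>UNIV. A i j x y * (x $ j - y $ j))) \<and>
    (\<forall>z. (G0 i has_derivative (\<lambda>h. \<Sum>j\<in>UNIV. A i j z z * h $ j)) (at z))"
    by (rule choice[OF allI])
  then obtain A where A: "\<And>i j. bideg k (A i j)"
    "\<And>i x y. G0 i x - G0 i y = (\<Sum>j\<in>UNIV. A i j x y * (x $ j - y $ j))"
    "\<And>i z. (G0 i has_derivative (\<lambda>h. \<Sum>j\<in>UNIV. A i j z z * h $ j)) (at z)"
    by blast
  define M where "M z = (\<chi> i j. A i j z z)" for z
  have dG: "((\<lambda>z. \<chi> i. G0 i z + w i) has_derivative (\<lambda>h. M z *v h)) (at z)" for z w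
  proof -
    have "((\<lambda>z. \<chi> i. G0 i z + w i) has_derivative (\<lambda>h. \<chi> i. \<Sum>j\<in>UNIV. A i j z z * h $ j)) (at z)"
      by (subst has_derivative_componentwise_within)
         (auto simp: Basis_vec_def inner_axis intro!: has_derivative_add_const A(3))
    moreover have "(\<lambda>h. \<chi> i. \<Sum>j\<in>UNIV. A i j z z * h $ j) = (\<lambda>h. M z *v h)"
      by (simp add: fun_eq_iff M_def matrix_vector_mult_def)
    ultimately show ?thesis by simp
  qed
  obtain u where u: "norm u < \<eta> / 2" "\<And>z. (\<chi> i. G0 i z) = u \<Longrightarrow> det (M z) \<noteq> 0"
    using regular_value_near_0[of "\<lambda>z. \<chi> i. G0 i z" M "\<eta> / 2"] dG[where w = "\<lambda>_. 0"] \<eta> by auto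
  define v where "v = - u"
  define g where "g z = (\<chi> i. G0 i z + v $ i)" for z
  define Q where "Q x = P x + (\<Sum>i\<in>UNIV. \<epsilon> / real d * x $ i ^ d) + v \<bullet> x" for x
  have Q: "Q \<in> poly_fun_le d"
    unfolding Q_def
    by (intro poly_fun_le_add P poly_fun_le_sum poly_fun_le_cmult coord_power_in_poly_fun_le
          poly_fun_le_mono[OF inner_in_poly_fun_le]) (use d in auto)
  have close: "\<bar>Q x - P x\<bar> \<le> \<eta>" if x: "x \<in> cball 0 1" for x
  proof -
    have "\<bar>\<Sum>i\<in>UNIV. \<epsilon> / real d * x $ i ^ d\<bar> \<le> (\<Sum>i\<in>(UNIV :: 'n set). \<epsilon>)"
    proof (rule order_trans[OF sum_abs sum_mono])
      fix i
      have "\<bar>x $ i\<bar> \<le> 1" using component_le_norm_cart[of x i] x by simp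
      then have "\<bar>x $ i\<bar> ^ d \<le> 1" by (intro power_le_one) auto
      then have "\<epsilon> / real d * \<bar>x $ i\<bar> ^ d \<le> \<epsilon> / 1 * 1"
        using \<epsilon> d by (intro mult_mono divide_left_mono) auto
      then show "\<bar>\<epsilon> / real d * x $ i ^ d\<bar> \<le> \<epsilon>" using \<epsilon> by (simp add: abs_mult power_abs)
    qed
    also have "\<dots> \<le> \<eta> / 2" using \<epsilon>(3) by (simp add: field_simps)
    finally have "\<bar>\<Sum>i\<in>UNIV. \<epsilon> / real d * x $ i ^ d\<bar> \<le> \<eta> / 2" .
    moreover have "\<bar>v \<bullet> x\<bar> \<le> \<eta> / 2"
    proof -
      have "\<bar>v \<bullet> x\<bar> \<le> norm v * norm x" by (rule Cauchy_Schwarz_ineq2)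
      also have "\<dots> \<le> \<eta> / 2 * 1" using u(1) x \<eta> by (intro mult_mono) (auto simp: v_def)
      finally show ?thesis by simp
    qed
    ultimately show ?thesis by (simp add: Q_def)
  qed
  have dQ: "(Q has_derivative (\<lambda>h. g z \<bullet> h)) (at z)" for z
  proof -
    have coord: "((\<lambda>x :: real ^ 'n. x $ i) has_derivative (\<lambda>h. h $ i)) (at z)" for i
      by (rule bounded_linear_imp_has_derivative[OF bounded_linear_vec_nth])
    have "(Q has_derivative (\<lambda>h. (\<Sum>j\<in>UNIV. B j z z * h $ j)
        + (\<Sum>i\<in>UNIV. \<epsilon> / real d * (real d * h $ i * z $ i ^ (d - 1))) + v \<bullet> h)) (at z)"
      unfolding Q_def
      by (intro has_derivative_add B(2) has_derivative_sum has_derivative_mult_right has_derivative_power coord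
            has_derivative_inner_right has_derivative_ident)
    also have "(\<lambda>h. (\<Sum>j\<in>UNIV. B j z z * h $ j)
        + (\<Sum>i\<in>UNIV. \<epsilon> / real d * (real d * h $ i * z $ i ^ (d - 1))) + v \<bullet> h) = (\<lambda>h. g z \<bullet> h)"
    proof
      fix h :: "real ^ 'n"
      have "\<epsilon> / real d * (real d * h $ i * z $ i ^ (d - 1)) = \<epsilon> * z $ i ^ m * h $ i" for i
        using d by (simp add: m_def)
      then show "(\<Sum>j\<in>UNIV. B j z z * h $ j)
        + (\<Sum>i\<in>UNIV. \<epsilon> / real d * (real d * h $ i * z $ i ^ (d - 1))) + v \<bullet> h = g z \<bullet> h"
        by (simp add: g_def G0_def H_def inner_vec_def sum.distrib distrib_right)
    qed
    finally show ?thesis .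
  qed
  have dg: "(g has_derivative (\<lambda>h. M z *v h)) (at z)" for z
    unfolding g_def by (rule dG)
  have count: "card S + ?n + 1 \<le> m ^ ?n"
    if S: "finite S" and ext: "\<And>z. z \<in> S \<Longrightarrow> \<exists>U. open U \<and> z \<in> U \<and> ((\<forall>y\<in>U. Q y \<le> Q z) \<or> (\<forall>y\<in>U. Q z \<le> Q y))" for S
  proof (rule ccontr)
    assume "\<not> card S + ?n + 1 \<le> m ^ ?n"
    let ?A = "{\<alpha> :: 'n \<Rightarrow> nat. (\<forall>i. \<alpha> i < m) \<and> (\<Sum>i\<in>UNIV. \<alpha> i) \<le> ?n * (m - 1) - 2}"
    have m2: "m \<ge> 2" using mk by simp
    \<comment> \<open>Fewer conditions than points, so some nonzero functional on \<open>S\<close>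
      kills these box monomials.\<close>
    have "card ?A < card S"
      using card_box_below_top(2)[OF m2 n] \<open>\<not> card S + ?n + 1 \<le> m ^ ?n\<close> by linarith
    then obtain c where c: "\<exists>z\<in>S. c z \<noteq> 0" "\<forall>\<alpha>\<in>?A. (\<Sum>z\<in>S. c z * monom_fun \<alpha> z) = 0"
      using nontrivial_solution[OF card_box_below_top(1)[OF m2 n] S, of "\<lambda>z \<alpha>. monom_fun \<alpha> z"] by auto
    have crit: "g z = 0 \<and> ((\<forall>h. 0 \<le> h \<bullet> (M z *v h)) \<or> (\<forall>h. 0 \<le> h \<bullet> ((- M z) *v h)))" if z: "z \<in> S" for z
    proof -
      obtain U where U: "open U" "z \<in> U" "(\<forall>y\<in>U. Q y \<le> Q z) \<or> (\<forall>y\<in>U. Q z \<le> Q y)"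
        using ext[OF z] by blast
      from U(3) show ?thesis
      proof
        assume "\<forall>y\<in>U. Q z \<le> Q y"
        from local_min_second_order[OF dQ dg U(1,2) this] show ?thesis by blast
      next
        assume "\<forall>y\<in>U. Q y \<le> Q z"
        then have min: "\<forall>y\<in>U. - Q z \<le> - Q y" by simp
        have "((\<lambda>x. - Q x) has_derivative (\<lambda>h. (- g x) \<bullet> h)) (at x)" for x
          using has_derivative_minus[OF dQ[of x]] by simp
        moreover have "((\<lambda>x. - g x) has_derivative (\<lambda>h. (- M z) *v h)) (at z)"
          using has_derivative_minus[OF dg[of z]] by (simp add: matrix_vector_mult_def sum_negf vec_eq_iff fun_eq_iff uminus_vec_def)
        ultimately show ?thesis
          using local_min_second_order[of "\<lambda>x. - Q x" "\<lambda>x. - g x" "- M z" z U] U(1,2) min by auto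
      qed
    qed
    have zeros: "G0 i z + v $ i = 0" if "z \<in> S" for z i
      using crit[OF that] by (simp add: g_def vec_eq_iff)
    have kill: "(\<Sum>z\<in>S. c z * f z) = 0" if f: "f \<in> poly_fun_le (?n * k - 2)" for f
    proof (rule red[OF \<epsilon>(1) S])
      show "\<forall>z\<in>S. \<forall>i. \<epsilon> * z $ i ^ m + H i z + v $ i = 0" using zeros by (simp add: G0_def)
      show "\<forall>\<alpha>. (\<forall>i. \<alpha> i < m) \<longrightarrow> (\<Sum>i\<in>UNIV. \<alpha> i) \<le> D \<longrightarrow> (\<Sum>z\<in>S. c z * monom_fun \<alpha> z) = 0"
        using c(2) by (simp add: D_def k_def)
      show "f \<in> poly_fun_le D" using f by (simp add: D_def)
    qed
    have nz: "det (M z) \<noteq> 0" if "z \<in> S" for z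
    proof (rule u(2))
      show "(\<chi> i. G0 i z) = u" using zeros[OF that] by (simp add: vec_eq_iff v_def)
    qed
    \<comment> \<open>At a minimum the determinant and the trace are positive. At a maximum the
      trace is negative and the determinant has the sign (-1)^n, so the product with
      \<open>W\<close> is positive in both parities.\<close>
    define W where "W z = (if even ?n then 1 else (\<Sum>i\<in>UNIV. A i i z z))" for z
    define w where "w = (if even ?n then 0 else k)"
    have W: "W \<in> poly_fun_le w"
    proof (cases "even ?n")
      case False
      have "(\<lambda>z. \<Sum>i\<in>UNIV. A i i z z) \<in> poly_fun_le k"
        by (intro poly_fun_le_sum bideg_diag[OF A(1)])
      then show ?thesis using False by (simp add: W_def[abs_def] w_def)
    qed (simp add: W_def[abs_def] w_def)
    \<comment> \<open>This is where \<open>d \<ge> 4\<close>, that is \<open>k \<ge> 2\<close>,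
      enters: with \<open>k = 1\<close> the inequality fails for \<open>n = 2\<close> and
      \<open>n = 3\<close>.\<close>
    have w: "1 + w \<le> ?n * k - 2"
    proof (cases "even ?n")
      case True
      have "2 * 2 \<le> ?n * k" using n mk(3) by (rule mult_le_mono)
      then have "1 + 0 \<le> ?n * k - 2" by linarith
      then show ?thesis using True by (simp add: w_def)
    next
      case False
      then have "?n \<ge> 3" using n by (cases "?n = 2") auto
      then have "3 * k \<le> ?n * k" by (rule mult_le_mono1)
      then have "1 + k \<le> ?n * k - 2" using mk(3) by linarith
      then show ?thesis using False by (simp add: w_def)
    qed
    have pos: "W z * det (\<chi> i j. A i j z z) > 0" if z: "z \<in> S" for z
    proof -
      have tr: "(\<Sum>i\<in>UNIV. A i i z z) = (\<Sum>i\<in>UNIV. M z $ i $ i)" by (simp add: M_def)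
      have nz': "det (- M z) \<noteq> 0" using nz[OF z] by (simp add: det_uminus)
      consider "\<forall>h. 0 \<le> h \<bullet> (M z *v h)" | "\<forall>h. 0 \<le> h \<bullet> ((- M z) *v h)" using crit[OF z] by blast
      then have "W z * det (M z) > 0"
      proof cases
        case 1
        with det_pos_if_semidefinite[of "M z"] trace_pos_if_semidefinite[of "M z"] nz[OF z]
        show ?thesis by (auto simp: W_def tr)
      next
        case 2
        with det_pos_if_semidefinite[of "- M z"] trace_pos_if_semidefinite[of "- M z"] nz'
        show ?thesis by (auto simp: W_def tr det_uminus sum_negf mult_neg_neg)
      qed
      then show ?thesis by (simp add: M_def)
    qed
    have "c z = 0" if "z \<in> S" for z
    proof (rule bezoutian_functional_zero[where G = "\<lambda>i z. G0 i z + v $ i", OF A(1) _ S zeros kill W w pos that])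
      show "(G0 i x + v $ i) - (G0 i y + v $ i) = (\<Sum>j\<in>UNIV. A i j x y * (x $ j - y $ j))" for i x y
        using A(2) by simp
    qed
    with c(1) show False by blast
  qed
  show ?thesis
    by (rule bexI[OF _ Q]) (use close count in \<open>auto simp: m_def\<close>)
qed

subsection \<open>Peaks, valleys and degree at least three\<close>

text \<open>By the mean value theorem the derivative has alternating signs at \<open>d + 1\<close>
  points, hence \<open>d\<close> zeros, more than its degree allows.\<close>

lemma no_alternation:
  fixes p :: "real poly"
  assumes deg: "degree p \<le> d" and inc: "\<And>i. i \<le> d \<Longrightarrow> x i < x (Suc i)"
    and alt: "\<And>i. i \<le> d \<Longrightarrow> (-1) ^ i * (poly p (x (Suc i)) - poly p (x i)) > 0"
  shows False
proof -
  have "\<exists>y. x i < y \<and> y < x (Suc i) \<and> (-1) ^ i * poly (pderiv p) y > 0" if i: "i \<le> d" for i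
  proof -
    obtain y where y: "x i < y" "y < x (Suc i)"
        "poly p (x (Suc i)) - poly p (x i) = (x (Suc i) - x i) * poly (pderiv p) y"
      using poly_MVT[OF inc[OF i], of p] by blast
    then have "(x (Suc i) - x i) * ((-1) ^ i * poly (pderiv p) y) > 0"
      using alt[OF i] by (simp add: mult.left_commute)
    then show ?thesis using y(1,2) inc[OF i] by (auto simp: zero_less_mult_iff)
  qed
  then obtain y where y: "\<And>i. i \<le> d \<Longrightarrow> x i < y i" "\<And>i. i \<le> d \<Longrightarrow> y i < x (Suc i)"
      "\<And>i. i \<le> d \<Longrightarrow> (-1) ^ i * poly (pderiv p) (y i) > 0"
    by metis
  have nz: "pderiv p \<noteq> 0" using y(3)[of 0] by auto
  then have d: "degree p \<noteq> 0" by (simp add: pderiv_eq_0_iff)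
  have "\<exists>r. y i < r \<and> r < y (Suc i) \<and> poly (pderiv p) r = 0" if i: "i < d" for i
  proof -
    have le: "y i < y (Suc i)" using y(2)[of i] y(1)[of "Suc i"] i by simp
    have "i \<le> d" "Suc i \<le> d" using i by auto
    then have "((-1) ^ i * poly (pderiv p) (y i)) * ((-1) ^ Suc i * poly (pderiv p) (y (Suc i))) > 0"
      by (rule mult_pos_pos[OF y(3) y(3)])
    moreover have "((-1) ^ i * poly (pderiv p) (y i)) * ((-1) ^ Suc i * poly (pderiv p) (y (Suc i)))
        = - (poly (pderiv p) (y i) * poly (pderiv p) (y (Suc i)))"
      by (cases "even i") auto
    ultimately have "poly (pderiv p) (y i) * poly (pderiv p) (y (Suc i)) < 0" by linarith
    from poly_IVT[OF le this] show ?thesis by blast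
  qed
  then obtain r where r: "\<And>i. i < d \<Longrightarrow> y i < r i" "\<And>i. i < d \<Longrightarrow> r i < y (Suc i)"
      "\<And>i. i < d \<Longrightarrow> poly (pderiv p) (r i) = 0"
    by metis
  have mono: "r i < r j" if "i < j" "j < d" for i j
  proof -
    have "y (Suc i) \<le> y j"
      using that(1)[folded Suc_le_eq] that(2)
    proof (induction j rule: dec_induct)
      case (step k)
      then show ?case using y(2)[of k] y(1)[of "Suc k"] by simp
    qed simp
    then show ?thesis using r(2)[of i] r(1)[of j] that by linarith
  qed
  have "inj_on r {..<d}"
    by (rule inj_onI) (metis lessThan_iff less_irrefl linorder_neqE_nat mono)
  then have "d = card (r ` {..<d})" by (simp add: card_image)
  also have "\<dots> \<le> card {t. poly (pderiv p) t = 0}"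
    using r(3) poly_roots_finite[OF nz] by (intro card_mono) auto
  also have "\<dots> \<le> degree (pderiv p)" by (rule card_poly_roots_bound[OF nz])
  also have "\<dots> = degree p - 1" by (rule degree_pderiv)
  finally show False using d deg by simp
qed

lemma frontier_on_ray:
  fixes U :: "'a::euclidean_space set"
  assumes U: "bounded U" and z: "z \<in> interior U" and h: "h \<noteq> 0"
  shows "\<exists>t>0. z + t *\<^sub>R h \<in> frontier U"
proof -
  let ?R = "(\<lambda>t. z + t *\<^sub>R h) ` {0..}"
  obtain B where B: "\<And>y. y \<in> U \<Longrightarrow> norm y \<le> B" using U by (auto simp: bounded_iff)
  define t where "t = (\<bar>B\<bar> + norm z + 1) / norm h"
  have t: "t * norm h = \<bar>B\<bar> + norm z + 1" "t \<ge> 0" using h by (auto simp: t_def)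
  have "z + t *\<^sub>R h \<notin> U"
  proof
    assume "z + t *\<^sub>R h \<in> U"
    then have "norm (z + t *\<^sub>R h) \<le> B" by (rule B)
    moreover have "norm (t *\<^sub>R h) \<le> norm (z + t *\<^sub>R h) + norm z"
      by (metis add_diff_cancel_left' norm_triangle_ineq4)
    ultimately show False using t by simp
  qed
  moreover have "connected ?R"
    by (intro connected_continuous_image continuous_intros) (simp add: convex_connected)
  moreover have "z \<in> U" using z interior_subset by blast
  moreover have "z \<in> ?R" by (rule image_eqI[of _ _ 0]) auto
  moreover have "z + t *\<^sub>R h \<in> ?R" by (rule image_eqI[of _ _ t]) (use t in auto)
  ultimately have "?R \<inter> frontier U \<noteq> {}"
    by (intro connected_Int_frontier) blast+
  then obtain s where s: "s \<ge> 0" "z + s *\<^sub>R h \<in> frontier U" by auto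
  have "s \<noteq> 0" using s(2) z by (auto simp: frontier_def)
  with s show ?thesis by (intro exI[of _ s]) auto
qed

text \<open>The maximum of the absolute value on \<open>U\<close> is attained in the interior, since
  the frontier values are too small; the sign there decides between maximum and minimum of
  \<open>Q\<close>.\<close>

lemma interior_extremum:
  fixes Q :: "'a::euclidean_space \<Rightarrow> real"
  assumes U: "compact U" and Q: "continuous_on U Q" and x: "x \<in> U" "\<bar>Q x\<bar> > b"
    and front: "\<And>y. y \<in> frontier U \<Longrightarrow> \<bar>Q y\<bar> \<le> b"
  shows "\<exists>z\<in>interior U. ((\<forall>y\<in>U. Q y \<le> Q z) \<and> Q z > b) \<or> ((\<forall>y\<in>U. Q z \<le> Q y) \<and> Q z < - b)"
proof -
  have "continuous_on U (\<lambda>y. \<bar>Q y\<bar>)" using Q by (intro continuous_intros)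
  then obtain z where z: "z \<in> U" "\<And>y. y \<in> U \<Longrightarrow> \<bar>Q y\<bar> \<le> \<bar>Q z\<bar>"
    using continuous_attains_sup[OF U] x(1) by blast
  have gt: "\<bar>Q z\<bar> > b" using z(2)[OF x(1)] x(2) by simp
  then have "z \<notin> frontier U" using front[of z] by auto
  then have "z \<in> interior U"
    using z(1) compact_imp_closed[OF U] by (auto simp: frontier_def closure_closed)
  moreover have "((\<forall>y\<in>U. Q y \<le> Q z) \<and> Q z > b) \<or> ((\<forall>y\<in>U. Q z \<le> Q y) \<and> Q z < - b)"
  proof (cases "Q z \<ge> 0")
    case True
    have "Q y \<le> Q z" if "y \<in> U" for y using z(2)[OF that] True by linarith
    with gt True show ?thesis by auto
  next
    case False
    have "Q z \<le> Q y" if "y \<in> U" for y using z(2)[OF that] False by linarith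
    with gt False show ?thesis by auto
  qed
  ultimately show ?thesis by blast
qed

section \<open>Extrema on lines in degree at most three\<close>

lemma no_peak_affine:
  fixes P :: "real ^ 'n \<Rightarrow> real"
  assumes P: "P \<in> poly_fun_le 1" and U: "bounded U" "\<And>y. y \<in> frontier U \<Longrightarrow> \<bar>P y\<bar> \<le> 1"
    and z: "z \<in> interior U"
  shows "P z \<le> 1"
proof (rule ccontr)
  assume "\<not> P z \<le> 1"
  obtain h :: "real ^ 'n" where h: "h \<noteq> 0" by (metis axis_eq_0_iff zero_neq_one)
  obtain a b where ab: "a > 0" "z + a *\<^sub>R h \<in> frontier U" "b > 0" "z + b *\<^sub>R (- h) \<in> frontier U"
    using frontier_on_ray[OF U(1) z] h by (metis neg_equal_0_iff_equal)
  obtain p where p: "degree p \<le> 1" "\<And>t. poly p t = P (z + t *\<^sub>R h)"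
    using poly_fun_le_line[OF P] by blast
  define x where "x i = (if i = 0 then - b else if i = 1 then 0 else a)" for i :: nat
  have v: "poly p (- b) \<le> 1" "poly p 0 > 1" "poly p a \<le> 1"
    using U(2)[OF ab(2)] U(2)[OF ab(4)] \<open>\<not> P z \<le> 1\<close> p(2)[of "- b"] p(2)[of 0] p(2)[of a] by auto
  have "x i < x (Suc i) \<and> (-1) ^ i * (poly p (x (Suc i)) - poly p (x i)) > 0" if i: "i \<le> 1" for i
  proof -
    consider "i = 0" | "i = 1" using i by linarith
    then show ?thesis by cases (use ab v in \<open>auto simp: x_def\<close>)
  qed
  then show False using no_alternation[OF p(1), of x] by blast
qed

text \<open>On the line through \<open>z\<close> and \<open>w\<close>, a frontier point of
  \<open>U\<close> behind \<open>z\<close>, the points \<open>z\<close> and \<open>w\<close>, and a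
  frontier point of \<open>V\<close> behind \<open>w\<close> give three alternating steps, one too
  many for degree two.\<close>

lemma no_peak_and_valley:
  fixes P :: "real ^ 'n \<Rightarrow> real"
  assumes P: "P \<in> poly_fun_le 2" and U: "bounded U" "\<And>y. y \<in> frontier U \<Longrightarrow> \<bar>P y\<bar> \<le> 1"
    and V: "bounded V" "\<And>y. y \<in> frontier V \<Longrightarrow> \<bar>P y\<bar> \<le> 1"
    and z: "z \<in> interior U" "P z > 1" and w: "w \<in> interior V"
  shows "P w \<ge> - 1"
proof (rule ccontr)
  assume Pw: "\<not> P w \<ge> - 1"
  define h where "h = w - z"
  have h: "h \<noteq> 0" using Pw z(2) by (auto simp: h_def)
  obtain a b where ab: "a > 0" "w + a *\<^sub>R h \<in> frontier V" "b > 0" "z + b *\<^sub>R (- h) \<in> frontier U"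
    using frontier_on_ray[OF U(1) z(1)] frontier_on_ray[OF V(1) w(1)] h by (metis neg_equal_0_iff_equal)
  obtain p where p: "degree p \<le> 2" "\<And>t. poly p t = P (z + t *\<^sub>R h)"
    using poly_fun_le_line[OF P] by blast
  define x where "x i = (if i = 0 then - b else if i = 1 then 0 else if i = 2 then 1 else 1 + a)" for i :: nat
  have "poly p (1 + a) = P (w + a *\<^sub>R h)" by (simp add: p(2) h_def algebra_simps)
  moreover have "poly p (- b) = P (z + b *\<^sub>R (- h))" "poly p 0 = P z" by (simp_all add: p(2))
  moreover have "poly p 1 = P w" by (simp add: p(2) h_def)
  ultimately have v: "poly p (- b) \<le> 1" "poly p 0 > 1" "poly p 1 < - 1" "poly p (1 + a) \<ge> - 1"
    using V(2)[OF ab(2)] U(2)[OF ab(4)] z(2) Pw by linarith+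
  have "x i < x (Suc i) \<and> (-1) ^ i * (poly p (x (Suc i)) - poly p (x i)) > 0" if i: "i \<le> 2" for i
  proof -
    consider "i = 0" | "i = 1" | "i = 2" using i by linarith
    then show ?thesis by cases (use ab v in \<open>auto simp: x_def\<close>)
  qed
  then show False using no_alternation[OF p(1), of x] by blast
qed

text \<open>The segment from \<open>z\<close> to \<open>w\<close> has to leave \<open>U\<close>,
  which adds a low point between the two peaks. Low and high values then alternate at five points of
  a line, which a cubic cannot do.\<close>

lemma no_two_peaks:
  fixes P :: "real ^ 'n \<Rightarrow> real"
  assumes P: "P \<in> poly_fun_le 3" and U: "bounded U" "\<And>y. y \<in> frontier U \<Longrightarrow> \<bar>P y\<bar> \<le> 1"
    and V: "bounded V" "\<And>y. y \<in> frontier V \<Longrightarrow> \<bar>P y\<bar> \<le> 1" and disj: "U \<inter> V = {}"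
    and z: "z \<in> interior U" "P z > 1" and w: "w \<in> interior V"
  shows "P w \<le> 1"
proof (rule ccontr)
  assume Pw: "\<not> P w \<le> 1"
  define h where "h = w - z"
  have zU: "z \<in> U" and wV: "w \<in> V" using z(1) w interior_subset by blast+
  have h: "h \<noteq> 0" using zU wV disj by (auto simp: h_def)
  obtain a b where ab: "a > 0" "w + a *\<^sub>R h \<in> frontier V" "b > 0" "z + b *\<^sub>R (- h) \<in> frontier U"
    using frontier_on_ray[OF U(1) z(1)] frontier_on_ray[OF V(1) w(1)] h by (metis neg_equal_0_iff_equal)
  have "closed_segment z w \<inter> frontier U \<noteq> {}"
    using zU wV disj by (intro connected_Int_frontier) auto
  then obtain c where c': "0 \<le> c" "c \<le> 1" "(1 - c) *\<^sub>R z + c *\<^sub>R w \<in> frontier U"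
    by (auto simp: in_segment)
  moreover have "(1 - c) *\<^sub>R z + c *\<^sub>R w = z + c *\<^sub>R h" by (simp add: h_def algebra_simps)
  ultimately have c: "0 \<le> c" "c \<le> 1" "z + c *\<^sub>R h \<in> frontier U" by auto
  obtain p where p: "degree p \<le> 3" "\<And>t. poly p t = P (z + t *\<^sub>R h)"
    using poly_fun_le_line[OF P] by blast
  define x where "x i = (if i = 0 then - b else if i = 1 then 0 else if i = 2 then c else if i = 3 then 1 else 1 + a)" for i :: nat
  have "poly p (1 + a) = P (w + a *\<^sub>R h)" by (simp add: p(2) h_def algebra_simps)
  moreover have "poly p (- b) = P (z + b *\<^sub>R (- h))" "poly p 0 = P z" by (simp_all add: p(2))
  moreover have "poly p 1 = P w" by (simp add: p(2) h_def)
  ultimately have v: "poly p (- b) \<le> 1" "poly p 0 > 1" "poly p c \<le> 1" "poly p 1 > 1" "poly p (1 + a) \<le> 1"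
    using V(2)[OF ab(2)] U(2)[OF ab(4)] U(2)[OF c(3)] z(2) Pw p(2)[of c] by linarith+
  have "c \<noteq> 0" "c \<noteq> 1" using v by auto
  then have c': "0 < c" "c < 1" using c by auto
  have "x i < x (Suc i) \<and> (-1) ^ i * (poly p (x (Suc i)) - poly p (x i)) > 0" if i: "i \<le> 3" for i
  proof -
    consider "i = 0" | "i = 1" | "i = 2" | "i = 3" using i by linarith
    then show ?thesis by cases (use ab v c' in \<open>auto simp: x_def\<close>)
  qed
  then show False using no_alternation[OF p(1), of x] by blast
qed

section \<open>Bounds from many sets in the sublevel set\<close>

text \<open>If the bound failed, the one-variable inequality would let each segment from
  \<open>x0\<close> meet the sublevel set in length at most q \<gamma> / n, and
  \<open>radial_measure_le\<close> would make its measure at most q \<gamma> vol(B), less than the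
  total of the disjoint sets. The factor 1/2 of \<open>remez_unit_interval\<close> permits some
  \<gamma> < 1.\<close>

lemma poly_fun_le_bound_many_sublevel:
  fixes P :: "real ^ 'n \<Rightarrow> real"
  assumes P: "P \<in> poly_fun_le d" and d: "d \<ge> 1" and J: "finite J" "disjoint_family_on U J"
    and U: "\<And>j. j \<in> J \<Longrightarrow> compact (U j)" "\<And>j. j \<in> J \<Longrightarrow> U j \<subseteq> cball 0 1"
    and q: "q > 0" "\<And>j. j \<in> J \<Longrightarrow> q \<le> measure lebesgue (U j)"
    and sub: "\<And>j x. j \<in> J \<Longrightarrow> x \<in> U j \<Longrightarrow> \<bar>P x\<bar> \<le> 1"
    and \<gamma>: "\<gamma> > 0" "\<gamma> ^ d \<ge> 1 / 2" "\<gamma> * unit_ball_vol (real CARD('n)) < real (card J)"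
    and x0: "x0 \<in> cball 0 1"
  shows "\<bar>P x0\<bar> \<le> (4 * real CARD('n) / q) ^ d"
proof (rule ccontr)
  assume gt: "\<not> \<bar>P x0\<bar> \<le> (4 * real CARD('n) / q) ^ d"
  let ?n = "CARD('n)" and ?B = "cball 0 1 :: (real ^ 'n) set"
  define T where "T = {x\<in>?B. \<bar>P x\<bar> \<le> 1}"
  have cont: "continuous_on UNIV P" by (rule continuous_on_poly_fun_le[OF P])
  have "closed {x. \<bar>P x\<bar> \<le> 1}"
    using cont by (intro closed_Collect_le continuous_intros)
  then have "compact (?B \<inter> {x. \<bar>P x\<bar> \<le> 1})" by (intro compact_Int_closed compact_cball)
  moreover have "T = ?B \<inter> {x. \<bar>P x\<bar> \<le> 1}" by (auto simp: T_def)
  ultimately have T: "compact T" by simp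
  have "real (card J) * q \<le> (\<Sum>j\<in>J. measure lebesgue (U j))"
    using sum_bounded_below[of J q "\<lambda>j. measure lebesgue (U j)"] q(2) by (simp add: mult.commute)
  also have "\<dots> = measure lebesgue (\<Union>j\<in>J. U j)"
  proof (rule measure_finite_Union[symmetric, OF J(1) _ J(2)])
    show "U ` J \<subseteq> sets lebesgue" using U(1) by (auto intro: lmeasurable_compact[THEN fmeasurableD])
    show "emeasure lebesgue (U j) \<noteq> \<infinity>" if "j \<in> J" for j
      using fmeasurableD2[OF lmeasurable_compact[OF U(1)[OF that]]] by (simp only: infinity_ennreal_def not_False_eq_True)
  qed
  also have "\<dots> \<le> measure lebesgue T"
  proof (rule measure_mono_fmeasurable)
    show "(\<Union>j\<in>J. U j) \<subseteq> T" using U(2) sub unfolding T_def by blast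
    show "(\<Union>j\<in>J. U j) \<in> sets lebesgue"
      using J(1) U(1) by (intro sets.finite_UN) (auto intro: lmeasurable_compact[THEN fmeasurableD])
    show "T \<in> lmeasurable" by (rule lmeasurable_compact[OF T])
  qed
  also have "\<dots> \<le> real DIM(real ^ 'n) * (q * \<gamma> / real ?n) * measure lebesgue ?B"
  proof (rule radial_measure_le[OF T _ _ x0])
    show "T \<subseteq> ?B" by (auto simp: T_def)
    show "0 \<le> q * \<gamma> / real ?n" using q(1) \<gamma>(1) by simp
    show "measure lebesgue {s\<in>{0..1}. x0 + s *\<^sub>R (y - x0) \<in> T} \<le> q * \<gamma> / real ?n" if y: "y \<in> ?B" for y
    proof (rule ccontr)
      assume m: "\<not> measure lebesgue {s\<in>{0..1}. x0 + s *\<^sub>R (y - x0) \<in> T} \<le> q * \<gamma> / real ?n"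
      obtain p where p: "degree p \<le> d" "\<And>t. poly p t = P (x0 + t *\<^sub>R (y - x0))"
        using poly_fun_le_line[OF P] by blast
      have "x0 + s *\<^sub>R (y - x0) \<in> ?B" if "s \<in> {0..1}" for s
      proof -
        have "(1 - s) *\<^sub>R x0 + s *\<^sub>R y \<in> ?B"
          using x0 y that by (intro convexD convex_cball) auto
        then show ?thesis by (simp add: algebra_simps)
      qed
      then have "{s\<in>{0..1}. x0 + s *\<^sub>R (y - x0) \<in> T} = {s\<in>{0..1}. \<bar>poly p s\<bar> \<le> 1}"
        by (auto simp: T_def p(2))
      then have "\<bar>poly p 0\<bar> \<le> (4 / (q * \<gamma> / real ?n)) ^ d / 2"
        using m q(1) \<gamma>(1) by (intro remez_unit_interval[OF p(1) d]) auto
      also have "\<dots> = (4 * real ?n / q) ^ d / (2 * \<gamma> ^ d)"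
        by (simp add: power_divide power_mult_distrib)
      also have "\<dots> \<le> (4 * real ?n / q) ^ d / 1"
        using \<gamma>(2) q(1) by (intro divide_left_mono) auto
      finally show False using gt by (simp add: p(2))
    qed
  qed auto
  also have "\<dots> = q * (\<gamma> * unit_ball_vol (real ?n))"
    by (simp add: content_cball)
  finally show False using \<gamma>(3) q(1) by (simp add: mult.commute)
qed

text \<open>The sets \<open>U j\<close> on which \<open>\<bar>P\<bar> \<le> 1\<close> fails contain an interior extremum of \<open>P\<close>; bounding their number leaves many sets on which \<open>\<bar>P\<bar> \<le> 1\<close> holds.\<close>
lemma card_exceptional_le:
  fixes P :: "real ^ 'n \<Rightarrow> real"
  assumes P: "P \<in> poly_fun_le d" and d: "d \<ge> 4" and n: "CARD('n) \<ge> 2"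
    and J: "finite J" "disjoint_family_on U J"
    and U: "\<And>j. j \<in> J \<Longrightarrow> compact (U j)" "\<And>j. j \<in> J \<Longrightarrow> U j \<subseteq> cball 0 1"
    and front: "\<And>j x. j \<in> J \<Longrightarrow> x \<in> frontier (U j) \<Longrightarrow> \<bar>P x\<bar> \<le> 1"
  shows "card {j\<in>J. \<exists>x\<in>U j. \<bar>P x\<bar> > 1} + CARD('n) + 1 \<le> (d - 1) ^ CARD('n)"
proof -
  let ?b = "{j\<in>J. \<exists>x\<in>U j. \<bar>P x\<bar> > 1}"
  have finb: "finite ?b" using J(1) by simp
  obtain x where x: "\<And>j. j \<in> ?b \<Longrightarrow> x j \<in> U j \<and> \<bar>P (x j)\<bar> > 1"
    using bchoice[of ?b "\<lambda>j x. x \<in> U j \<and> \<bar>P x\<bar> > 1"] by blast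
  \<comment> \<open>One third of the least excess: after the perturbation the absolute value still
    exceeds 1 + \<eta> at \<open>x j\<close>, while it is at most 1 + \<eta> on the frontier. The
    inserted 1 covers the case of no exceptional set.\<close>
  define \<eta> where "\<eta> = Min (insert 1 ((\<lambda>j. \<bar>P (x j)\<bar> - 1) ` ?b)) / 3"
  have \<eta>: "\<eta> > 0" using x finb by (auto simp: \<eta>_def)
  have \<eta>x: "3 * \<eta> \<le> \<bar>P (x j)\<bar> - 1" if "j \<in> ?b" for j
    unfolding \<eta>_def using finb that by simp
  obtain Q where Q: "Q \<in> poly_fun_le d" "\<And>x. x \<in> cball 0 1 \<Longrightarrow> \<bar>Q x - P x\<bar> \<le> \<eta>"
    "\<And>S. finite S \<Longrightarrow> \<forall>z\<in>S. \<exists>U. open U \<and> z \<in> U \<and> ((\<forall>y\<in>U. Q y \<le> Q z) \<or> (\<forall>y\<in>U. Q z \<le> Q y)) \<Longrightarrow>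
      card S + CARD('n) + 1 \<le> (d - 1) ^ CARD('n)"
    using extrema_count[OF P d n \<eta>] by blast
  have "\<exists>z\<in>interior (U j). (\<forall>y\<in>U j. Q y \<le> Q z) \<or> (\<forall>y\<in>U j. Q z \<le> Q y)" if j: "j \<in> ?b" for j
  proof -
    have jJ: "j \<in> J" using j by simp
    have "\<bar>Q (x j)\<bar> > 1 + \<eta>"
      using Q(2)[of "x j"] \<eta>x[OF j] x[OF j] U(2)[OF jJ] \<eta> by (smt (verit) subsetD)
    moreover have "\<bar>Q y\<bar> \<le> 1 + \<eta>" if "y \<in> frontier (U j)" for y
    proof -
      have "y \<in> U j" using that frontier_subset_closed[OF compact_imp_closed[OF U(1)[OF jJ]]] by blast
      then show ?thesis using Q(2)[of y] front[OF jJ that] U(2)[OF jJ] by (smt (verit) subsetD)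
    qed
    ultimately have "\<exists>z\<in>interior (U j). ((\<forall>y\<in>U j. Q y \<le> Q z) \<and> Q z > 1 + \<eta>) \<or> ((\<forall>y\<in>U j. Q z \<le> Q y) \<and> Q z < - (1 + \<eta>))"
      using x[OF j] by (intro interior_extremum[OF U(1)[OF jJ] continuous_on_poly_fun_le[OF Q(1)]]) auto
    then show ?thesis by blast
  qed
  then obtain z where z: "\<And>j. j \<in> ?b \<Longrightarrow> z j \<in> interior (U j) \<and> ((\<forall>y\<in>U j. Q y \<le> Q (z j)) \<or> (\<forall>y\<in>U j. Q (z j) \<le> Q y))"
    using bchoice[of ?b "\<lambda>j z. z \<in> interior (U j) \<and> ((\<forall>y\<in>U j. Q y \<le> Q z) \<or> (\<forall>y\<in>U j. Q z \<le> Q y))"] by blast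
  have "inj_on z ?b"
  proof (rule inj_onI, rule ccontr)
    fix i j assume ij: "i \<in> ?b" "j \<in> ?b" "z i = z j" "i \<noteq> j"
    then have "z i \<in> U i \<inter> U j" using z[OF ij(1)] z[OF ij(2)] interior_subset by fastforce
    then show False using J(2) ij by (auto simp: disjoint_family_on_def)
  qed
  then have "card ?b = card (z ` ?b)" by (simp add: card_image)
  moreover have "card (z ` ?b) + CARD('n) + 1 \<le> (d - 1) ^ CARD('n)"
  proof (rule Q(3))
    show "finite (z ` ?b)" using finb by simp
    show "\<forall>w\<in>z ` ?b. \<exists>U. open U \<and> w \<in> U \<and> ((\<forall>y\<in>U. Q y \<le> Q w) \<or> (\<forall>y\<in>U. Q w \<le> Q y))"
    proof
      fix w assume "w \<in> z ` ?b"
      then obtain j where j: "j \<in> ?b" "w = z j" by blast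
      show "\<exists>U. open U \<and> w \<in> U \<and> ((\<forall>y\<in>U. Q y \<le> Q w) \<or> (\<forall>y\<in>U. Q w \<le> Q y))"
        using z[OF j(1)] j(2) interior_subset[of "U j"]
        by (intro exI[of _ "interior (U j)"]) (auto dest: subsetD)
    qed
  qed
  ultimately show ?thesis by simp
qed

lemma poly_fun_le_bound_deg_ge_3:
  fixes P :: "real ^ 'n \<Rightarrow> real"
  assumes P: "P \<in> poly_fun_le d" and d: "d \<ge> 3" and n: "CARD('n) \<ge> 2"
    and J: "finite J" "disjoint_family_on U J" "card J = (d - 1) ^ CARD('n) + 1"
    and U: "\<And>j. j \<in> J \<Longrightarrow> compact (U j)" "\<And>j. j \<in> J \<Longrightarrow> U j \<subseteq> cball 0 1"
    and q: "q > 0" "\<And>j. j \<in> J \<Longrightarrow> q \<le> measure lebesgue (U j)"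
    and front: "\<And>j x. j \<in> J \<Longrightarrow> x \<in> frontier (U j) \<Longrightarrow> \<bar>P x\<bar> \<le> 1"
    and x0: "x0 \<in> cball 0 1"
  shows "\<bar>P x0\<bar> \<le> (4 * real CARD('n) / q) ^ d"
proof -
  let ?n = "CARD('n)"
  let ?b = "{j\<in>J. \<exists>x\<in>U j. \<bar>P x\<bar> > 1}"
  have main: "\<bar>P x0\<bar> \<le> (4 * real CARD('n) / q) ^ d"
    if \<gamma>: "\<gamma> > 0" "\<gamma> ^ d \<ge> 1 / 2" "\<gamma> * unit_ball_vol (real CARD('n)) < real (card (J - ?b))" for \<gamma>
  proof (rule poly_fun_le_bound_many_sublevel[OF P _ _ _ _ _ q(1) _ _ \<gamma> x0, of U])
    show "disjoint_family_on U (J - ?b)" using J(2) by (auto simp: disjoint_family_on_def)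
    show "\<bar>P x\<bar> \<le> 1" if "j \<in> J - ?b" "x \<in> U j" for j x using that by force
  qed (use d J(1) U q(2) in auto)
  have card: "card (J - ?b) = (d - 1) ^ ?n + 1 - card ?b"
    using J by (subst card_Diff_subset) auto
  show ?thesis
  proof (cases "d = 3")
    case False
    then have d4: "d \<ge> 4" using d by simp
    have "card ?b + ?n + 1 \<le> (d - 1) ^ ?n"
      by (rule card_exceptional_le[OF P d4 n J(1,2) U front])
    \<comment> \<open>From (d - 1)^n + 1 sets at most (d - 1)^n - n - 1 are removed.\<close>
    then have "?n + 2 \<le> card (J - ?b)" using card by linarith
    then have "real ?n + 2 \<le> real (card (J - ?b))" by linarith
    then show ?thesis using unit_ball_vol_less_Suc_Suc[OF n] by (intro main[of 1]) auto
  next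
    case True
    define X where "X = {j\<in>J. \<exists>z\<in>interior (U j). P z > 1}"
    define Y where "Y = {j\<in>J. \<exists>z\<in>interior (U j). P z < - 1}"
    have bU: "bounded (U j)" if "j \<in> J" for j using U(1)[OF that] by (rule compact_imp_bounded)
    have dis: "U i \<inter> U j = {}" if "i \<in> J" "j \<in> J" "i \<noteq> j" for i j
      using J(2) that by (auto simp: disjoint_family_on_def)
    have P3: "P \<in> poly_fun_le 3" "(\<lambda>x. - P x) \<in> poly_fun_le 3" using P True by auto
    have "i = j" if mem: "i \<in> X" "j \<in> X" for i j
    proof (rule ccontr)
      assume ij: "i \<noteq> j"
      obtain z w where zw: "z \<in> interior (U i)" "P z > 1" "w \<in> interior (U j)" "P w > 1" "i \<in> J" "j \<in> J"
        using mem by (auto simp: X_def)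
      have "P w \<le> 1"
      proof (rule no_two_peaks[OF P3(1) bU[OF zw(5)] _ bU[OF zw(6)] _ dis[OF zw(5,6) ij] zw(1) _ zw(3)])
        show "\<bar>P y\<bar> \<le> 1" if "y \<in> frontier (U i)" for y using front[OF zw(5) that] by simp
        show "\<bar>P y\<bar> \<le> 1" if "y \<in> frontier (U j)" for y using front[OF zw(6) that] by simp
        show "P z > 1" using zw(2) by simp
      qed
      then show False using zw(4) by simp
    qed
    moreover have "finite X" using J(1) by (simp add: X_def)
    ultimately have X: "card X \<le> 1" using card_le_Suc0_iff_eq[of X] by auto
    have "i = j" if mem: "i \<in> Y" "j \<in> Y" for i j
    proof (rule ccontr)
      assume ij: "i \<noteq> j"
      obtain z w where zw: "z \<in> interior (U i)" "P z < - 1" "w \<in> interior (U j)" "P w < - 1" "i \<in> J" "j \<in> J"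
        using mem by (auto simp: Y_def)
      have "- P w \<le> 1"
      proof (rule no_two_peaks[OF P3(2) bU[OF zw(5)] _ bU[OF zw(6)] _ dis[OF zw(5,6) ij] zw(1) _ zw(3)])
        show "\<bar>- P y\<bar> \<le> 1" if "y \<in> frontier (U i)" for y using front[OF zw(5) that] by simp
        show "\<bar>- P y\<bar> \<le> 1" if "y \<in> frontier (U j)" for y using front[OF zw(6) that] by simp
        show "- P z > 1" using zw(2) by simp
      qed
      then show False using zw(4) by simp
    qed
    moreover have "finite Y" using J(1) by (simp add: Y_def)
    ultimately have Y: "card Y \<le> 1" using card_le_Suc0_iff_eq[of Y] by auto
    have "?b \<subseteq> X \<union> Y"
    proof
      fix j assume j: "j \<in> ?b"
      then obtain x where x: "x \<in> U j" "\<bar>P x\<bar> > 1" and jJ: "j \<in> J" by auto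
      from interior_extremum[OF U(1)[OF jJ] continuous_on_poly_fun_le[OF P] x front[OF jJ]]
      show "j \<in> X \<union> Y" using jJ by (auto simp: X_def Y_def)
    qed
    then have "card ?b \<le> card (X \<union> Y)"
      using J(1) by (intro card_mono) (auto simp: X_def Y_def)
    also have "\<dots> \<le> 2" using card_Un_le[of X Y] X Y by linarith
    finally have "(2 :: nat) ^ ?n \<le> card (J - ?b) + 1" using card True by simp
    then have "real (2 ^ ?n) \<le> real (card (J - ?b) + 1)" by (simp only: of_nat_le_iff)
    then have "(2 :: real) ^ ?n - 1 \<le> real (card (J - ?b))" by simp
    \<comment> \<open>The value 9/10 satisfies 0.9^3 = 0.729 \<ge> 1/2; \<gamma> = 1 would not do
      for n = 2.\<close>
    then show ?thesis using unit_ball_vol_less_pow[OF n] True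
      by (intro main[of "9 / 10"]) (auto simp: power3_eq_cube)
  qed
qed

subsection \<open>Degree one and dimension one\<close>

text \<open>A nonmeasurable \<open>S\<close> has \<open>measure\<close> 0 by convention, which saves
  measurability proofs for fibres.\<close>

lemma measure_le_superset:
  assumes "S \<subseteq> T" "T \<in> lmeasurable"
  shows "measure lebesgue S \<le> measure lebesgue T"
proof (cases "S \<in> sets lebesgue")
  case True
  then show ?thesis using assms by (intro measure_mono_fmeasurable)
qed (simp add: measure_notin_sets)

lemma measure_le_diameter:
  fixes S :: "real set"
  assumes "0 \<le> \<rho>" "\<And>s t. s \<in> S \<Longrightarrow> t \<in> S \<Longrightarrow> s < t \<Longrightarrow> t - s \<le> \<rho>" "bounded S"
  shows "measure lebesgue S \<le> \<rho>"
proof (cases "S = {}")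
  case False
  have bdd: "bdd_below S" using assms(3) by (rule bounded_imp_bdd_below)
  have "S \<subseteq> {Inf S..Inf S + \<rho>}"
  proof
    fix t assume t: "t \<in> S"
    have "t - \<rho> \<le> s" if "s \<in> S" for s
      using assms(1) assms(2)[OF that t] by (cases "s < t") auto
    then have "t - \<rho> \<le> Inf S" using False by (intro cInf_greatest)
    then show "t \<in> {Inf S..Inf S + \<rho>}" using cInf_lower[OF t bdd] by auto
  qed
  then have "measure lebesgue S \<le> measure lebesgue {Inf S..Inf S + \<rho>}"
    by (rule measure_le_superset) simp
  then show ?thesis using assms(1) by simp
qed (use assms in simp)

lemma measure_le_two_intervals:
  fixes S :: "real set"
  assumes "0 \<le> C" "C \<le> B" "\<And>t. t \<in> S \<Longrightarrow> C \<le> \<bar>t + y\<bar> \<and> \<bar>t + y\<bar> \<le> B"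
  shows "measure lebesgue S \<le> 2 * (B - C)"
proof -
  have "t \<in> {- y - B..- y - C} \<union> {- y + C..- y + B}" if "t \<in> S" for t
    using assms(3)[OF that] by (auto simp: abs_if split: if_splits)
  then have "S \<subseteq> {- y - B..- y - C} \<union> {- y + C..- y + B}" by blast
  then have "measure lebesgue S \<le> measure lebesgue ({- y - B..- y - C} \<union> {- y + C..- y + B})"
    by (rule measure_le_superset) auto
  also have "\<dots> \<le> measure lebesgue {- y - B..- y - C} + measure lebesgue {- y + C..- y + B}"
    by (rule measure_Un_le) auto
  finally show ?thesis using assms(1,2) by simp
qed

lemma norm_perp_squared:
  fixes e x :: "'a::real_inner"
  assumes "norm e = 1"
  shows "(norm (x - (x \<bullet> e) *\<^sub>R e))\<^sup>2 = (norm x)\<^sup>2 - (x \<bullet> e)\<^sup>2"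
proof -
  have "e \<bullet> e = 1" using assms by (simp add: norm_eq_1)
  then show ?thesis
    unfolding power2_norm_eq_inner
    by (simp add: inner_diff_left inner_diff_right inner_commute) (simp add: power2_eq_square)
qed

text \<open>The specialisation to a single set. The distance from \<open>z\<close> may be bounded in
  place of the distance from the axis, as projection does not increase norms.\<close>

lemma measure_le_fibres:
  fixes V :: "(real ^ 'n) set" and e z :: "real ^ 'n"
  assumes "compact V" "norm e = 1" "r > 0" "l \<ge> 0" "\<And>x. x \<in> V \<Longrightarrow> norm (x - z) \<le> r \<or> norm ((x - z) - ((x - z) \<bullet> e) *\<^sub>R e) \<le> r"
    and "\<And>x. measure lebesgue {t. x + t *\<^sub>R e \<in> V} \<le> l"
  shows "measure lebesgue V \<le> l * unit_ball_vol (real (CARD('n) - 1)) * r ^ (CARD('n) - 1)"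
proof -
  have proj: "norm (h - (h \<bullet> e) *\<^sub>R e) \<le> norm h" for h
  proof -
    have "(norm (h - (h \<bullet> e) *\<^sub>R e))\<^sup>2 = (norm h)\<^sup>2 - (h \<bullet> e)\<^sup>2"
      by (rule norm_perp_squared[OF assms(2)])
    also have "\<dots> \<le> (norm h)\<^sup>2" by simp
    finally show ?thesis by (rule power2_le_imp_le) simp
  qed
  have "1 * measure lebesgue V + 0 * measure lebesgue V \<le> l * unit_ball_vol (real (CARD('n) - 1)) * r ^ (CARD('n) - 1)"
  proof (rule measure_fibres_le[OF assms(1,1,2,3) _ _ assms(4), of _ _ z])
    show "norm (x - z - ((x - z) \<bullet> e) *\<^sub>R e) \<le> r" if "x \<in> V \<union> V" for x
      using assms(5)[of x] that proj[of "x - z"] by auto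
    show "1 * measure lebesgue {t. x + t *\<^sub>R e \<in> V} + 0 * measure lebesgue {t. x + t *\<^sub>R e \<in> V} \<le> l" for x
      using assms(6)[of x] by simp
  qed auto
  then show ?thesis by simp
qed

lemma slab_measure_le:
  fixes V :: "(real ^ 'n) set" and e :: "real ^ 'n"
  assumes "compact V" "norm e = 1" "r > 0" "lo \<le> hi"
    and "\<And>x. x \<in> V \<Longrightarrow> norm x \<le> r \<or> norm (x - (x \<bullet> e) *\<^sub>R e) \<le> r"
    and "\<And>x. x \<in> V \<Longrightarrow> lo \<le> x \<bullet> e \<and> x \<bullet> e \<le> hi"
  shows "measure lebesgue V \<le> (hi - lo) * unit_ball_vol (real (CARD('n) - 1)) * r ^ (CARD('n) - 1)"
proof (rule measure_le_fibres[OF assms(1-3), of _ 0])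
  show "measure lebesgue {t. x + t *\<^sub>R e \<in> V} \<le> hi - lo" for x
  proof -
    have "e \<bullet> e = 1" using assms(2) by (simp add: norm_eq_1)
    have "{t. x + t *\<^sub>R e \<in> V} \<subseteq> {lo - x \<bullet> e..hi - x \<bullet> e}"
    proof
      fix t assume "t \<in> {t. x + t *\<^sub>R e \<in> V}"
      then have "lo \<le> (x + t *\<^sub>R e) \<bullet> e \<and> (x + t *\<^sub>R e) \<bullet> e \<le> hi" using assms(6) by blast
      then show "t \<in> {lo - x \<bullet> e..hi - x \<bullet> e}" using \<open>e \<bullet> e = 1\<close> by (simp add: inner_add_left)
    qed
    then have "measure lebesgue {t. x + t *\<^sub>R e \<in> V} \<le> measure lebesgue {lo - x \<bullet> e..hi - x \<bullet> e}"
      by (rule measure_le_superset) simp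
    then show ?thesis using assms(4) by simp
  qed
qed (use assms in auto)

lemma measure_subset_ball_le:
  fixes U :: "(real ^ 'n) set"
  assumes "U \<subseteq> cball 0 1"
  shows "measure lebesgue U \<le> unit_ball_vol (real CARD('n))"
  using measure_le_superset[OF assms] by (simp add: content_cball)

text \<open>For nonzero \<open>g\<close> the set lies in a slab of half width \<kappa> = 1 / norm g,
  centred at signed distance - t from the origin with t = c \<kappa>, and the claim reads q (1 + t)
  \<le> 4 n \<kappa>. The volume of the whole slab in the unit cylinder is good enough while t is at
  most 0.9; for larger t the cut at distance 1 or the smaller sections near the boundary of the ball
  have to be used.\<close>

lemma affine_bound:
  fixes g :: "real ^ 'n"
  assumes n: "CARD('n) \<ge> 2" and U: "compact U" "U \<subseteq> cball 0 1" and q: "q > 0" "q \<le> measure lebesgue U"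
    and sub: "\<And>x. x \<in> U \<Longrightarrow> \<bar>c + g \<bullet> x\<bar> \<le> 1" and c: "c \<ge> 0"
  shows "q * (c + norm g) \<le> 4 * real CARD('n)"
proof -
  let ?n = "CARD('n)"
  define V where "V = unit_ball_vol (real (?n - 1))"
  have V: "V \<le> 1.05 * real ?n" "V \<ge> 0" using unit_ball_vol_pred_le[OF n] by (auto simp: V_def)
  have n2: "real ?n \<ge> 2" using n by simp
  have "q \<le> unit_ball_vol (real ?n)" using q(2) measure_subset_ball_le[OF U(2)] by simp
  then have qn: "q \<le> 4 * real ?n" using unit_ball_vol_less_Suc_Suc[OF n] n2 by linarith
  have "U \<noteq> {}" using q by auto
  then obtain u where u: "u \<in> U" by blast
  show ?thesis
  proof (cases "g = 0")
    case True
    then have "c \<le> 1" using sub[OF u] by simp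
    then have "q * c \<le> q * 1" using q by (intro mult_left_mono) auto
    then show ?thesis using qn True by simp
  next
    case False
    define a where "a = norm g"
    have a: "a > 0" using False by (simp add: a_def)
    define e where "e = (1 / a) *\<^sub>R g"
    have e: "norm e = 1" "g = a *\<^sub>R e" using a by (auto simp: e_def a_def)
    define \<kappa> where "\<kappa> = 1 / a"
    define t where "t = c * \<kappa>"
    have \<kappa>: "\<kappa> > 0" using a by (simp add: \<kappa>_def)
    have t: "t \<ge> 0" using c \<kappa> by (simp add: t_def)
    have K: "c + a = (1 + t) / \<kappa>" using a by (simp add: t_def \<kappa>_def field_simps)
    have slab: "- \<kappa> - t \<le> x \<bullet> e \<and> x \<bullet> e \<le> \<kappa> - t" if "x \<in> U" for x
    proof -
      have "\<bar>c + a * (x \<bullet> e)\<bar> \<le> 1" using sub[OF that] by (simp add: e(2) inner_commute)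
      then have "\<bar>\<kappa> * (c + a * (x \<bullet> e))\<bar> \<le> \<kappa> * 1" using \<kappa> by (simp add: abs_mult)
      moreover have "\<kappa> * (c + a * (x \<bullet> e)) = t + x \<bullet> e" using a by (simp add: t_def \<kappa>_def field_simps)
      ultimately show ?thesis by linarith
    qed
    have unit: "- 1 \<le> x \<bullet> e \<and> x \<bullet> e \<le> 1 \<and> norm x \<le> 1" if "x \<in> U" for x
      using Cauchy_Schwarz_ineq2[of x e] e(1) U(2) that by (auto simp: subset_iff abs_le_iff)
    have bd: "q \<le> (hi - lo) * V * r ^ (?n - 1)"
      if "\<And>x. x \<in> U \<Longrightarrow> lo \<le> x \<bullet> e \<and> x \<bullet> e \<le> hi" "r > 0"
        "\<And>x. x \<in> U \<Longrightarrow> norm x \<le> r \<or> norm (x - (x \<bullet> e) *\<^sub>R e) \<le> r" for lo hi r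
    proof -
      have "lo \<le> hi" using that(1)[OF u] by linarith
      then show ?thesis
        using q(2) slab_measure_le[OF U(1) e(1) that(2) _ that(3) that(1)] by (fastforce simp: V_def)
    qed
    have mul: "q * ((1 + t) / \<kappa>) \<le> L" if "q \<le> l" "l * (1 + t) \<le> L * \<kappa>" for l L
    proof -
      have "q * (1 + t) \<le> l * (1 + t)" using that(1) t by (intro mult_right_mono) auto
      then show ?thesis using that(2) \<kappa> by (simp add: field_simps)
    qed
    \<comment> \<open>In turn: the slab is so wide that \<open>q \<le> 4 * real ?n\<close> suffices;
      it is cut off at height - 1; the full slab suffices; it is cut off again, where
      \<open>\<kappa> \<ge> 0.2\<close> gives \<kappa> - t + 1 \<le> 1.5 \<kappa>; or it stays at
      distance 0.7 from the origin, where the ball has sections of radius below 0.72.\<close>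
    consider "t > 1" "\<kappa> - t + 1 > 2" | "t > 1" "\<kappa> - t + 1 \<le> 2" | "t \<le> 0.9" | "0.9 < t" "t \<le> 1" "\<kappa> \<ge> 0.2" | "0.9 < t" "t \<le> 1" "\<kappa> < 0.2"
      by linarith
    then have "q * ((1 + t) / \<kappa>) \<le> 4 * real ?n"
    proof cases
      case 1
      then have "1 + t \<le> 1 * \<kappa>" by simp
      then have "q * (1 + t) \<le> (4 * real ?n) * \<kappa>" using qn q t by (intro mult_mono) auto
      then show ?thesis by (intro mul[of q]) auto
    next
      case 2
      define h where "h = \<kappa> - t + 1"
      have "q \<le> (\<kappa> - t - (-1)) * V * 1 ^ (?n - 1)" using slab unit by (intro bd) auto
      then have "q \<le> h * V" by (simp add: h_def)
      moreover have "h * V * (1 + t) \<le> 4 * real ?n * \<kappa>"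
      proof -
        have "h * (t - 1) \<le> 2 * (t - 1)" using 2 by (intro mult_right_mono) (auto simp: h_def)
        then have "h * (1 + t) \<le> 2 * \<kappa>" by (simp add: h_def algebra_simps)
        then have "V * (h * (1 + t)) \<le> V * (2 * \<kappa>)" using V(2) by (rule mult_left_mono)
        also have "\<dots> \<le> (1.05 * real ?n) * (2 * \<kappa>)" using V(1) \<kappa> by (intro mult_right_mono) auto
        also have "\<dots> \<le> 4 * real ?n * \<kappa>" using \<kappa> by simp
        finally show ?thesis by (simp add: mult_ac)
      qed
      ultimately show ?thesis by (rule mul)
    next
      case 3
      have "q \<le> (\<kappa> - t - (- \<kappa> - t)) * V * 1 ^ (?n - 1)" using slab unit by (intro bd) auto
      then have "q \<le> 2 * \<kappa> * V" by simp
      moreover have "2 * \<kappa> * V * (1 + t) \<le> 4 * real ?n * \<kappa>"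
      proof -
        have "V * (1 + t) \<le> (1.05 * real ?n) * 1.9" using V 3 t by (intro mult_mono) auto
        also have "\<dots> \<le> 2 * real ?n" by simp
        finally have "(2 * \<kappa>) * (V * (1 + t)) \<le> (2 * \<kappa>) * (2 * real ?n)" using \<kappa> by (intro mult_left_mono) auto
        then show ?thesis by (simp add: mult_ac)
      qed
      ultimately show ?thesis by (rule mul)
    next
      case 4
      have "q \<le> (\<kappa> - t - (-1)) * V * 1 ^ (?n - 1)" using slab unit by (intro bd) auto
      then have "q \<le> (\<kappa> - t + 1) * V" by simp
      moreover have "(\<kappa> - t + 1) * V * (1 + t) \<le> 4 * real ?n * \<kappa>"
      proof -
        have "(\<kappa> - t + 1) * (1 + t) \<le> (1.5 * \<kappa>) * 2" using 4 \<kappa> by (intro mult_mono) auto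
        then have "V * ((\<kappa> - t + 1) * (1 + t)) \<le> V * (3 * \<kappa>)" using V(2) by (intro mult_left_mono) auto
        also have "\<dots> \<le> (1.05 * real ?n) * (3 * \<kappa>)" using V(1) \<kappa> by (intro mult_right_mono) auto
        also have "\<dots> \<le> 4 * real ?n * \<kappa>" using \<kappa> by simp
        finally show ?thesis by (simp add: mult_ac)
      qed
      ultimately show ?thesis by (rule mul)
    next
      case 5
      have shadow: "norm (x - (x \<bullet> e) *\<^sub>R e) \<le> 0.72" if x: "x \<in> U" for x
      proof -
        have "(norm (x - (x \<bullet> e) *\<^sub>R e))\<^sup>2 = (norm x)\<^sup>2 - (x \<bullet> e)\<^sup>2"
          by (rule norm_perp_squared[OF e(1)])
        moreover have "(norm x)\<^sup>2 \<le> 1\<^sup>2" using unit[OF x] by (intro power_mono) auto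
        moreover have "0.7\<^sup>2 \<le> (- (x \<bullet> e))\<^sup>2" using slab[OF x] 5 by (intro power_mono) auto
        ultimately have "(norm (x - (x \<bullet> e) *\<^sub>R e))\<^sup>2 \<le> 0.72\<^sup>2" by (simp add: power2_eq_square)
        then show ?thesis by (rule power2_le_imp_le) simp
      qed
      have "q \<le> (\<kappa> - t - (- \<kappa> - t)) * V * 0.72 ^ (?n - 1)" using slab shadow by (intro bd) auto
      also have "\<dots> \<le> (\<kappa> - t - (- \<kappa> - t)) * V * 0.72 ^ 1"
        using n \<kappa> V(2) by (intro mult_left_mono power_decreasing) auto
      finally have "q \<le> 1.44 * \<kappa> * V" by simp
      moreover have "1.44 * \<kappa> * V * (1 + t) \<le> 4 * real ?n * \<kappa>"
      proof -
        have "V * (1 + t) \<le> (1.05 * real ?n) * 2" using V 5 t by (intro mult_mono) auto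
        then have "(1.44 * \<kappa>) * (V * (1 + t)) \<le> (1.44 * \<kappa>) * (2.1 * real ?n)" using \<kappa> by (intro mult_left_mono) auto
        also have "\<dots> \<le> 4 * real ?n * \<kappa>" using \<kappa> by simp
        finally show ?thesis by (simp add: mult_ac)
      qed
      ultimately show ?thesis by (rule mul)
    qed
    then show ?thesis using K by (simp add: a_def)
  qed
qed

lemma sublevel_if_no_peak:
  fixes P :: "'a::euclidean_space \<Rightarrow> real"
  assumes U: "compact U" and P: "continuous_on U P" "\<And>y. y \<in> frontier U \<Longrightarrow> \<bar>P y\<bar> \<le> 1"
    and "\<And>z. z \<in> interior U \<Longrightarrow> \<bar>P z\<bar> \<le> 1" and x: "x \<in> U"
  shows "\<bar>P x\<bar> \<le> 1"
proof -
  have "x \<in> interior U \<or> x \<in> frontier U"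
    using x compact_imp_closed[OF U] by (auto simp: frontier_def closure_closed)
  then show ?thesis using assms by blast
qed

text \<open>Peaks and valleys are impossible, so \<open>U\<close> lies in the sublevel set. On the
  ball \<open>P\<close> is bounded by the quantity in \<open>affine_bound\<close>, after a change of
  sign that makes the constant term nonnegative.\<close>

lemma poly_fun_le_bound_deg_1:
  fixes P :: "real ^ 'n \<Rightarrow> real"
  assumes P: "P \<in> poly_fun_le 1" and n: "CARD('n) \<ge> 2"
    and U: "compact U" "U \<subseteq> cball 0 1" and q: "q > 0" "q \<le> measure lebesgue U"
    and front: "\<And>x. x \<in> frontier U \<Longrightarrow> \<bar>P x\<bar> \<le> 1" and x0: "x0 \<in> cball 0 1"
  shows "\<bar>P x0\<bar> \<le> 4 * real CARD('n) / q"
proof -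
  have bU: "bounded U" using U(1) by (rule compact_imp_bounded)
  have nop: "\<bar>P z\<bar> \<le> 1" if "z \<in> interior U" for z
    using no_peak_affine[OF P bU front that] no_peak_affine[OF poly_fun_le_uminus[OF P] bU _ that] front
    by (simp add: abs_le_iff)
  have sub: "\<bar>P x\<bar> \<le> 1" if "x \<in> U" for x
    using sublevel_if_no_peak[OF U(1) continuous_on_poly_fun_le[OF P] front nop that] .
  obtain c g where cg: "P = (\<lambda>x. c + g \<bullet> x)" using poly_fun_le_1[OF P] by blast
  have gx: "\<bar>g \<bullet> x0\<bar> \<le> norm g"
  proof -
    have "\<bar>g \<bullet> x0\<bar> \<le> norm g * norm x0" by (rule Cauchy_Schwarz_ineq2)
    also have "\<dots> \<le> norm g * 1" using x0 by (intro mult_left_mono) auto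
    finally show ?thesis by simp
  qed
  have "q * (\<bar>c\<bar> + norm g) \<le> 4 * real CARD('n)"
  proof (cases "c \<ge> 0")
    case True
    then show ?thesis using affine_bound[OF n U q, of c g] sub by (auto simp: cg)
  next
    case False
    have "\<bar>- c + (- g) \<bullet> x\<bar> \<le> 1" if "x \<in> U" for x using sub[OF that] by (simp add: cg abs_le_iff)
    then show ?thesis using affine_bound[OF n U q, of "- c" "- g"] False by auto
  qed
  moreover have "q * \<bar>P x0\<bar> \<le> q * (\<bar>c\<bar> + norm g)"
    using gx q(1) by (intro mult_left_mono) (auto simp: cg)
  ultimately show ?thesis using q(1) by (simp add: field_simps)
qed

section \<open>Dimension one\<close>

text \<open>All \<open>d\<close> right end points together with the leftmost left end point are
  \<open>d + 1\<close> frontier points with mutual distances at least \<open>q\<close>. Lagrange's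
  formula on an interval of length 2 yields (d + 1) (2 / q)^d, and d + 1 \<le> 2^d.\<close>

lemma poly_fun_le_bound_dim_1:
  fixes P :: "real ^ 'n \<Rightarrow> real"
  assumes P: "P \<in> poly_fun_le d" and n: "CARD('n) = 1"
    and J: "finite J" "disjoint_family_on U J" "card J = d" and d: "d \<ge> 1"
    and U: "\<And>j. j \<in> J \<Longrightarrow> compact (U j)" "\<And>j. j \<in> J \<Longrightarrow> U j \<subseteq> cball 0 1" "\<And>j. j \<in> J \<Longrightarrow> connected (U j)"
    and q: "q > 0" "\<And>j. j \<in> J \<Longrightarrow> q \<le> measure lebesgue (U j)"
    and front: "\<And>j x. j \<in> J \<Longrightarrow> x \<in> frontier (U j) \<Longrightarrow> \<bar>P x\<bar> \<le> 1"
    and x0: "x0 \<in> cball 0 1"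
  shows "\<bar>P x0\<bar> \<le> (4 * real CARD('n) / q) ^ d"
proof -
  obtain k :: 'n where k: "UNIV = {k}" using n by (auto simp: card_1_singleton_iff)
  have allk: "i = k" for i using k by blast
  define e :: "real ^ 'n" where "e = axis k 1"
  have rep: "x = (x $ k) *\<^sub>R e" for x
    by (simp add: vec_eq_iff e_def axis_def) (metis allk)
  have ek: "e $ k = 1" by (simp add: e_def)
  have nrm: "norm x = \<bar>x $ k\<bar>" for x :: "real ^ 'n"
    by (subst rep[of x]) (simp add: e_def)
  have cont: "continuous_on S (\<lambda>x :: real ^ 'n. x $ k)" for S by (intro continuous_intros)
  have "\<exists>a b. a \<in> U j \<and> b \<in> U j \<and> (\<forall>x\<in>U j. a $ k \<le> x $ k \<and> x $ k \<le> b $ k)" if j: "j \<in> J" for j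
  proof -
    have "U j \<noteq> {}" using q(1) q(2)[OF j] by auto
    then show ?thesis
      using continuous_attains_inf[OF U(1)[OF j] _ cont] continuous_attains_sup[OF U(1)[OF j] _ cont] by meson
  qed
  then obtain a b where ab: "\<And>j. j \<in> J \<Longrightarrow> a j \<in> U j" "\<And>j. j \<in> J \<Longrightarrow> b j \<in> U j"
    "\<And>j x. j \<in> J \<Longrightarrow> x \<in> U j \<Longrightarrow> a j $ k \<le> x $ k" "\<And>j x. j \<in> J \<Longrightarrow> x \<in> U j \<Longrightarrow> x $ k \<le> b j $ k"
    by metis
  have inner_pt: "\<exists>s>0. x + s *\<^sub>R e \<in> S \<and> x - s *\<^sub>R e \<in> S" if "x \<in> interior S" for x S
  proof -
    obtain \<epsilon> where \<epsilon>: "\<epsilon> > 0" "cball x \<epsilon> \<subseteq> S" using \<open>x \<in> interior S\<close> mem_interior_cball by blast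
    have "norm e = 1" by (simp add: e_def)
    then show ?thesis using \<epsilon> by (intro exI[of _ \<epsilon>]) (auto simp: subset_iff dist_norm)
  qed
  have fr: "x \<in> frontier (U j)" if "j \<in> J" "x \<in> U j" "x \<notin> interior (U j)" for j x
    using that closure_subset by (auto simp: frontier_def)
  have Pa: "\<bar>P (a j)\<bar> \<le> 1" if j: "j \<in> J" for j
  proof -
    have "a j \<notin> interior (U j)"
    proof
      assume "a j \<in> interior (U j)"
      from inner_pt[OF this] obtain s where "s > 0" "a j - s *\<^sub>R e \<in> U j" by blast
      then show False using ab(3)[OF j, of "a j - s *\<^sub>R e"] ek by simp
    qed
    then show ?thesis using front[OF j fr[OF j ab(1)[OF j]]] by blast
  qed
  have Pb: "\<bar>P (b j)\<bar> \<le> 1" if j: "j \<in> J" for j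
  proof -
    have "b j \<notin> interior (U j)"
    proof
      assume "b j \<in> interior (U j)"
      from inner_pt[OF this] obtain s where "s > 0" "b j + s *\<^sub>R e \<in> U j" by blast
      then show False using ab(4)[OF j, of "b j + s *\<^sub>R e"] ek by simp
    qed
    then show ?thesis using front[OF j fr[OF j ab(2)[OF j]]] by blast
  qed
  have len: "q \<le> b j $ k - a j $ k" if j: "j \<in> J" for j
  proof -
    have sub: "U j \<subseteq> cbox (a j) (b j)"
    proof
      fix x assume "x \<in> U j"
      then have "a j $ k \<le> x $ k \<and> x $ k \<le> b j $ k" using ab(3,4)[OF j] by blast
      then show "x \<in> cbox (a j) (b j)" unfolding mem_box_cart using allk by metis
    qed
    then have ne: "cbox (a j) (b j) \<noteq> {}" using ab(1)[OF j] by blast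
    from sub have "measure lebesgue (U j) \<le> measure lebesgue (cbox (a j) (b j))"
      by (rule measure_le_superset) simp
    also have "\<dots> = b j $ k - a j $ k"
      using ne by (simp add: content_cbox_if_cart k)
    finally show ?thesis using q(2)[OF j] by simp
  qed
  have sep: "q \<le> b j $ k - b i $ k" if ij: "i \<in> J" "j \<in> J" "i \<noteq> j" "b i $ k \<le> b j $ k" for i j
  proof -
    have disj: "U i \<inter> U j = {}" using J(2) ij by (auto simp: disjoint_family_on_def)
    have "a j $ k > b i $ k"
    proof (rule ccontr)
      \<comment> \<open>Then the interval \<open>U j\<close> would contain the right end point of
        \<open>U i\<close>.\<close>
      assume "\<not> a j $ k > b i $ k"
      then have le: "a j $ k \<le> b i $ k" by simp
      have conn: "connected ((\<lambda>x. x $ k) ` U j)"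
        using U(3)[OF ij(2)] cont by (intro connected_continuous_image)
      have "b i $ k \<in> (\<lambda>x. x $ k) ` U j"
        by (rule connectedD_interval[OF conn imageI[OF ab(1)[OF ij(2)]] imageI[OF ab(2)[OF ij(2)]] le ij(4)])
      then obtain x where x: "x \<in> U j" "x $ k = b i $ k" by auto
      have "x = (x $ k) *\<^sub>R e" by (rule rep)
      also have "\<dots> = (b i $ k) *\<^sub>R e" by (simp only: x(2))
      also have "\<dots> = b i" by (rule rep[symmetric])
      finally have "x = b i" .
      then show False using x(1) ab(2)[OF ij(1)] disj by blast
    qed
    then show ?thesis using len[OF ij(2)] by simp
  qed
  have "J \<noteq> {}" using J(3) d by auto
  then obtain j0 where j0: "j0 \<in> J" "Min ((\<lambda>j. a j $ k) ` J) = a j0 $ k"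
    using obtains_MIN[OF J(1)] by blast
  have j0_le: "a j0 $ k \<le> a j $ k" if "j \<in> J" for j
    unfolding j0(2)[symmetric] using J(1) that by (intro Min_le) auto
  define X where "X = insert (a j0 $ k) ((\<lambda>j. b j $ k) ` J)"
  have gap: "q \<le> \<bar>x - y\<bar>" if "x \<in> X" "y \<in> X" "x \<noteq> y" for x y
  proof -
    have 1: "q \<le> b j $ k - a j0 $ k" if "j \<in> J" for j using len[OF that] j0_le[OF that] by linarith
    have 2: "q \<le> \<bar>b i $ k - b j $ k\<bar>" if "i \<in> J" "j \<in> J" "i \<noteq> j" for i j
      using sep[of i j] sep[of j i] that by (cases "b i $ k \<le> b j $ k") auto
    have 3: "q \<le> \<bar>b j $ k - a j0 $ k\<bar>" "q \<le> \<bar>a j0 $ k - b j $ k\<bar>" if "j \<in> J" for j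
      using 1[OF that] q(1) by linarith+
    show ?thesis using that 2 3 unfolding X_def by fastforce
  qed
  have injb: "inj_on (\<lambda>j. b j $ k) J"
  proof (rule inj_onI, rule ccontr)
    fix i j assume "i \<in> J" "j \<in> J" "b i $ k = b j $ k" "i \<noteq> j"
    then show False using sep[of i j] q(1) by simp
  qed
  have "a j0 $ k \<notin> (\<lambda>j. b j $ k) ` J"
  proof
    assume "a j0 $ k \<in> (\<lambda>j. b j $ k) ` J"
    then obtain j where "j \<in> J" "a j0 $ k = b j $ k" by auto
    then show False using len[of j] j0_le[of j] q(1) by linarith
  qed
  then have cardX: "card X = Suc d" "finite X" using J injb by (auto simp: X_def card_image)
  obtain p where p: "degree p \<le> d" "\<And>t. poly p t = P (0 + t *\<^sub>R e)"
    using poly_fun_le_line[OF P] by blast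
  have px: "poly p (x $ k) = P x" for x by (simp only: p(2) add_0_left rep[symmetric])
  have X1: "\<bar>poly p x\<bar> \<le> 1 \<and> \<bar>x\<bar> \<le> 1" if "x \<in> X" for x
  proof -
    have nb: "\<bar>y $ k\<bar> \<le> 1" if "y \<in> U j" "j \<in> J" for y j
      using U(2)[OF that(2)] that(1) by (auto simp: nrm subset_iff)
    show ?thesis using \<open>x \<in> X\<close> Pa[OF j0(1)] Pb nb[OF ab(1)] nb[OF ab(2)] j0(1)
      by (auto simp: X_def px)
  qed
  have "\<bar>poly p (x0 $ k)\<bar> \<le> (\<Sum>i\<in>X. 2 ^ (card X - 1) / (\<Prod>j\<in>X-{i}. \<bar>i - j\<bar>))"
  proof (rule lagrange_bound[of X "\<lambda>x. x" p "x0 $ k" 2])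
    show "\<bar>x0 $ k - i\<bar> \<le> 2" if "i \<in> X" for i
      using X1[OF that] x0 by (simp add: nrm abs_le_iff)
  qed (use cardX p X1 in auto)
  also have "\<dots> \<le> (\<Sum>i\<in>X. 2 ^ d / q ^ d)"
  proof (rule sum_mono)
    fix i assume i: "i \<in> X"
    have "(\<Prod>j\<in>X-{i}. q) \<le> (\<Prod>j\<in>X-{i}. \<bar>i - j\<bar>)"
      using gap i q(1) by (intro prod_mono) auto
    then have "q ^ d \<le> (\<Prod>j\<in>X-{i}. \<bar>i - j\<bar>)" using i cardX by simp
    then show "2 ^ (card X - 1) / (\<Prod>j\<in>X-{i}. \<bar>i - j\<bar>) \<le> 2 ^ d / q ^ d"
      using q(1) cardX by (auto intro!: frac_le)
  qed
  also have "\<dots> = real (Suc d) * (2 ^ d / q ^ d)" using cardX by simp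
  also have "\<dots> \<le> 2 ^ d * (2 ^ d / q ^ d)"
  proof (rule mult_right_mono)
    have "Suc d \<le> 2 ^ d" by (simp add: Suc_le_eq)
    then show "real (Suc d) \<le> 2 ^ d" by (metis of_nat_le_iff of_nat_power of_nat_numeral)
  qed (use q(1) in simp)
  also have "\<dots> = (4 * real CARD('n) / q) ^ d"
    by (simp add: n power_divide flip: power_mult_distrib)
  finally show ?thesis by (simp add: px)
qed

subsection \<open>Degree two\<close>

text \<open>Taylor's formula at every base point \<open>x\<close>: \<open>l x\<close> is the
  derivative there, and \<open>b\<close> is half the second derivative, the same at all
  points.\<close>

lemma quadratic_expansion:
  fixes P :: "real ^ 'n \<Rightarrow> real"
  assumes "P \<in> poly_fun_le 2"
  obtains b l where "bilinear b" "\<And>h k. b h k = b k h" "\<And>x. linear (l x)" "\<And>x h. P (x + h) = P x + l x h + b h h"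
proof -
  obtain c g and M :: "real ^ 'n ^ 'n" where P: "P = (\<lambda>x. c + g \<bullet> x + x \<bullet> (M *v x))"
    using poly_fun_le_2[OF assms] by blast
  define b where "b h k = (h \<bullet> (M *v k) + k \<bullet> (M *v h)) / 2" for h k
  define l where "l x h = g \<bullet> h + 2 * b x h" for x h
  have "bilinear b"
    by (auto simp: bilinear_def linear_iff b_def inner_add_left inner_add_right matrix_vector_right_distrib
        matrix_vector_mult_scaleR algebra_simps add_divide_distrib)
  moreover have "linear (l x)" for x
    by (auto simp: linear_iff l_def b_def inner_add_left inner_add_right matrix_vector_right_distrib
        matrix_vector_mult_scaleR algebra_simps add_divide_distrib)
  moreover have "P (x + h) = P x + l x h + b h h" for x h
    by (simp add: P l_def b_def inner_add_left inner_add_right matrix_vector_right_distrib)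
  moreover have "b h k = b k h" for h k by (simp add: b_def add.commute)
  ultimately show ?thesis using that by blast
qed

lemma quadratic_line:
  fixes P :: "'a::real_vector \<Rightarrow> real"
  assumes "bilinear b" "\<And>x. linear (l x)" "\<And>x h. P (x + h) = P x + l x h + b h h"
  shows "P (x + t *\<^sub>R h) = P x + t * l x h + t\<^sup>2 * b h h"
  using assms(1,2)
  by (simp add: assms(3) linear_cmul bilinear_lmul bilinear_rmul power2_eq_square)

lemma norm_perp_le:
  fixes e x :: "'a::real_inner"
  assumes "norm e = 1"
  shows "norm (x - (x \<bullet> e) *\<^sub>R e) \<le> norm x"
  by (rule power2_le_imp_le) (simp_all add: norm_perp_squared[OF assms])

text \<open>The set where \<open>\<bar>R - a y\<^sup>2\<bar> \<le> 1\<close> consists of two intervals that get short when \<open>R\<close> is large, while the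
  interval \<open>R - a y\<^sup>2 \<ge> - 1\<close> is long only for large \<open>R\<close>.\<close>
lemma mixed_shell_length:
  fixes S T :: "real set"
  assumes a: "a > 0" and \<theta>: "0 \<le> \<theta>" "\<theta> \<le> 1" and "R \<le> H" and H: "H \<ge> -1"
    and thr: "((1 + \<theta>)\<^sup>2 - 4 * \<theta>\<^sup>2) * sqrt (H + 1) \<le> sqrt 2 * ((1 + \<theta>)\<^sup>2 + 4 * \<theta>\<^sup>2)"
    and S: "\<And>t. t \<in> S \<Longrightarrow> \<bar>R - a * (t + y)\<^sup>2\<bar> \<le> 1" and T: "\<And>t. t \<in> T \<Longrightarrow> - 1 \<le> R - a * (t + y)\<^sup>2"
  shows "\<theta> * measure lebesgue S + (1 - \<theta>) / 2 * measure lebesgue T \<le> sqrt 2 * (1 + \<theta>) / sqrt a"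
proof (cases "R \<ge> - 1")
  case False
  have "t \<notin> S" "t \<notin> T" for t
  proof -
    have "0 \<le> a * (t + y)\<^sup>2" using a by simp
    then show "t \<notin> S" "t \<notin> T" using S[of t] T[of t] False by fastforce+
  qed
  then have "S = {}" "T = {}" by auto
  then show ?thesis using a \<theta> by simp
next
  case True
  define \<eta> where "\<eta> = sqrt (R + 1)"
  define \<zeta> where "\<zeta> = sqrt (max 0 (R - 1))"
  have \<eta>: "\<eta> \<ge> 0" "\<eta>\<^sup>2 = R + 1" "\<eta> \<le> sqrt (H + 1)" using True assms(4) by (auto simp: \<eta>_def)
  have \<zeta>: "\<zeta> \<ge> 0" "\<zeta>\<^sup>2 = max 0 (R - 1)" by (auto simp: \<zeta>_def)
  have \<zeta>\<eta>: "\<zeta> \<le> \<eta>" using True unfolding \<eta>_def \<zeta>_def by (intro real_sqrt_le_mono) auto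
  have sa: "sqrt a > 0" using a by simp
  have sq: "(\<bar>v\<bar> * sqrt a)\<^sup>2 = a * v\<^sup>2" for v using a by (simp add: power_mult_distrib)
  have up: "\<bar>v\<bar> \<le> \<eta> / sqrt a" if "- 1 \<le> R - a * v\<^sup>2" for v
  proof -
    have "(\<bar>v\<bar> * sqrt a)\<^sup>2 \<le> \<eta>\<^sup>2" unfolding sq \<eta>(2) using that by simp
    then have "\<bar>v\<bar> * sqrt a \<le> \<eta>" using \<eta>(1) by (rule power2_le_imp_le)
    then show ?thesis using sa by (simp add: field_simps)
  qed
  have low: "\<zeta> / sqrt a \<le> \<bar>v\<bar>" if "R - a * v\<^sup>2 \<le> 1" for v
  proof -
    have "\<zeta>\<^sup>2 \<le> (\<bar>v\<bar> * sqrt a)\<^sup>2" unfolding sq \<zeta>(2) using that a by simp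
    then have "\<zeta> \<le> \<bar>v\<bar> * sqrt a" by (rule power2_le_imp_le) (use sa in simp)
    then show ?thesis using sa by (simp add: field_simps)
  qed
  have mS: "measure lebesgue S \<le> 2 * (\<eta> / sqrt a - \<zeta> / sqrt a)"
  proof (rule measure_le_two_intervals[where y = y])
    show "\<zeta> / sqrt a \<le> \<bar>t + y\<bar> \<and> \<bar>t + y\<bar> \<le> \<eta> / sqrt a" if "t \<in> S" for t
      using S[OF that] up[of "t + y"] low[of "t + y"] by linarith
  qed (use \<zeta>(1) \<zeta>\<eta> sa in \<open>auto simp: divide_right_mono\<close>)
  have mT: "measure lebesgue T \<le> 2 * (\<eta> / sqrt a - 0)"
  proof (rule measure_le_two_intervals[where y = y])
    show "0 \<le> \<bar>t + y\<bar> \<and> \<bar>t + y\<bar> \<le> \<eta> / sqrt a" if "t \<in> T" for t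
      using T[OF that] up[of "t + y"] by linarith
  qed (use \<eta>(1) sa in auto)
  have "\<theta> * measure lebesgue S + (1 - \<theta>) / 2 * measure lebesgue T
      \<le> \<theta> * (2 * (\<eta> / sqrt a - \<zeta> / sqrt a)) + (1 - \<theta>) / 2 * (2 * (\<eta> / sqrt a - 0))"
    using mS mT \<theta> by (intro add_mono mult_left_mono) auto
  also have "\<dots> = ((1 + \<theta>) * \<eta> - 2 * \<theta> * \<zeta>) / sqrt a"
    using sa by (simp add: field_simps)
  also have "\<dots> \<le> sqrt 2 * (1 + \<theta>) / sqrt a"
  proof (rule divide_right_mono)
    \<comment> \<open>Equality holds at \<open>\<eta> = sqrt 2\<close>, that is
      \<open>R = 1\<close>. Beyond it, squaring and cancelling \<eta> - sqrt 2 turns the claim into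
      \<open>thr\<close> with \<open>\<eta>\<close> in place of its largest value
      \<open>sqrt (H + 1)\<close>.\<close>
    show "(1 + \<theta>) * \<eta> - 2 * \<theta> * \<zeta> \<le> sqrt 2 * (1 + \<theta>)"
    proof (cases "\<eta> \<le> sqrt 2")
      case True
      then have "(1 + \<theta>) * \<eta> \<le> (1 + \<theta>) * sqrt 2" using \<theta> by (intro mult_left_mono) auto
      moreover have "(1 + \<theta>) * sqrt 2 = sqrt 2 * (1 + \<theta>)" by (rule mult.commute)
      moreover have "0 \<le> 2 * \<theta> * \<zeta>" using \<theta> \<zeta>(1) by simp
      ultimately show ?thesis by linarith
    next
      case False
      show ?thesis
      proof (rule ccontr)
        assume "\<not> ?thesis"
        then have "2 * \<theta> * \<zeta> < (1 + \<theta>) * (\<eta> - sqrt 2)" by (simp add: algebra_simps)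
        then have "(2 * \<theta> * \<zeta>)\<^sup>2 < ((1 + \<theta>) * (\<eta> - sqrt 2))\<^sup>2"
          using \<theta> \<zeta>(1) by (intro power_strict_mono) auto
        moreover have "(sqrt 2)\<^sup>2 < \<eta>\<^sup>2" using False by (intro power_strict_mono) auto
        then have "\<zeta>\<^sup>2 = \<eta>\<^sup>2 - 2" using \<zeta>(2) \<eta>(2) by simp
        then have "\<zeta>\<^sup>2 = (\<eta> - sqrt 2) * (\<eta> + sqrt 2)" by (simp add: algebra_simps power2_eq_square)
        ultimately have "(\<eta> - sqrt 2) * (4 * \<theta>\<^sup>2 * (\<eta> + sqrt 2)) < (\<eta> - sqrt 2) * ((1 + \<theta>)\<^sup>2 * (\<eta> - sqrt 2))"
          by (simp add: power_mult_distrib power2_eq_square[of "\<eta> - sqrt 2"] mult_ac)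
        then have "4 * \<theta>\<^sup>2 * (\<eta> + sqrt 2) < (1 + \<theta>)\<^sup>2 * (\<eta> - sqrt 2)"
          using False by (subst (asm) mult_less_cancel_left_pos) auto
        then have "sqrt 2 * ((1 + \<theta>)\<^sup>2 + 4 * \<theta>\<^sup>2) < ((1 + \<theta>)\<^sup>2 - 4 * \<theta>\<^sup>2) * \<eta>"
          by (simp add: algebra_simps)
        also have "\<dots> \<le> ((1 + \<theta>)\<^sup>2 - 4 * \<theta>\<^sup>2) * sqrt (H + 1)"
        proof (rule mult_left_mono[OF \<eta>(3)])
          have "(1 + \<theta>)\<^sup>2 - 4 * \<theta>\<^sup>2 = (1 + 3 * \<theta>) * (1 - \<theta>)" by (simp add: power2_eq_square algebra_simps)
          then show "0 \<le> (1 + \<theta>)\<^sup>2 - 4 * \<theta>\<^sup>2" using \<theta> by simp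
        qed
        finally show False using thr by simp
      qed
    qed
  qed (use sa in simp)
  finally show ?thesis .
qed

text \<open>The case \<open>\<theta> = 1\<close>, where the left side of the threshold condition
  vanishes, so that \<open>H\<close> may be as large as \<open>R\<close> requires.\<close>

lemma shell_length:
  fixes S :: "real set"
  assumes "a > 0" "\<And>t. t \<in> S \<Longrightarrow> \<bar>R - a * (t + y)\<^sup>2\<bar> \<le> 1"
  shows "measure lebesgue S \<le> 2 * sqrt 2 / sqrt a"
proof -
  have "1 * measure lebesgue S + (1 - 1) / 2 * measure lebesgue S \<le> sqrt 2 * (1 + 1) / sqrt a"
  proof (rule mixed_shell_length[OF assms(1), of 1 R "max R (-1)" S y S])
    show "- 1 \<le> R - a * (t + y)\<^sup>2" if "t \<in> S" for t using assms(2)[OF that] by linarith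
  qed (use assms(2) in auto)
  then show ?thesis by (simp add: mult.commute)
qed

lemma sqrt_2_bounds: "1.4142 \<le> sqrt 2" "sqrt 2 \<le> 1.4143"
  by (rule real_le_rsqrt, simp add: power2_eq_square) (rule real_le_lsqrt, simp_all add: power2_eq_square)

text \<open>If \<open>P\<close> has a large second-order coefficient in some direction, then the sublevel set has short
  fibres in this direction; otherwise \<open>P\<close> decreases quickly along the rays that start at \<open>x0\<close>.\<close>
lemma quadratic_bound_sublevel:
  fixes P :: "real ^ 'n \<Rightarrow> real"
  assumes P: "P \<in> poly_fun_le 2" and n: "CARD('n) \<ge> 2" and T: "compact T" "T \<subseteq> cball 0 1"
    and q: "q > 0" "2 * q \<le> measure lebesgue T" and sub: "\<And>x. x \<in> T \<Longrightarrow> \<bar>P x\<bar> \<le> 1"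
    and x0: "x0 \<in> cball 0 1" and K: "P x0 \<ge> 0"
  shows "q * sqrt (P x0) \<le> 4 * real CARD('n)"
proof -
  let ?n = "CARD('n)"
  define k where "k = sqrt (P x0)"
  have k: "k \<ge> 0" "k\<^sup>2 = P x0" using K by (auto simp: k_def)
  define V where "V = unit_ball_vol (real ?n)"
  define V' where "V' = unit_ball_vol (real (?n - 1))"
  have V: "V \<le> 5.3" "V < real ?n + 2" "V \<ge> 0" and V': "V' \<le> 1.05 * real ?n" "V' \<ge> 0"
    using unit_ball_vol_le[of ?n] unit_ball_vol_less_Suc_Suc[OF n] unit_ball_vol_pred_le[OF n]
    by (auto simp: V_def V'_def)
  have n2: "real ?n \<ge> 2" using n by simp
  have qV: "2 * q \<le> V" using q(2) measure_subset_ball_le[OF T(2)] by (simp add: V_def)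
  obtain b l where bl: "bilinear b" "\<And>h k. b h k = b k h" "\<And>x. linear (l x)" "\<And>x h. P (x + h) = P x + l x h + b h h"
    using quadratic_expansion[OF P] by blast
  note line = quadratic_line[OF bl(1,3,4)]
  have "q * k \<le> 4 * real ?n"
  proof (cases "k \<le> 4")
    case True
    \<comment> \<open>Up to 4 the trivial bound \<open>2 * q \<le> V < n + 2\<close>
      suffices.\<close>
    then have "q * k \<le> (V / 2) * 4" using qV k q(1) by (intro mult_mono) auto
    then show ?thesis using V(2) n2 by simp
  next
    case k4: False
    show ?thesis
    proof (cases "\<exists>e. norm e = 1 \<and> k\<^sup>2 / 7.1 \<le> \<bar>b e e\<bar>")
      case True
      \<comment> \<open>The constant 7.1 balances the two cases: here it leads to sqrt 7.1 * sqrt 2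
        * 1.05 < 4, in the other case to the coefficient 4 / 7.1 = 40 / 71 on chords of length at
        most 2.\<close>
      then obtain e where e: "norm e = 1" "k\<^sup>2 / 7.1 \<le> \<bar>b e e\<bar>" by blast
      define a where "a = \<bar>b e e\<bar>"
      have a: "a > 0" using e(2) k4 by (simp add: a_def) (smt (verit) divide_pos_pos zero_less_power)
      have fib: "measure lebesgue {t. x + t *\<^sub>R e \<in> T} \<le> 2 * sqrt 2 / sqrt a" for x
      proof -
        \<comment> \<open>The sign makes the second-order coefficient along \<open>e\<close> equal
          to \<open>- a\<close>, so that completing the square gives the form of
          \<open>shell_length\<close>.\<close>
        define s where "s = (if b e e < 0 then 1 else - 1 :: real)"
        have s: "s * b e e = - a" "\<bar>s\<bar> = 1" by (auto simp: s_def a_def)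
        have sq: "s * P (x + t *\<^sub>R e) = (s * P x + (s * l x e)\<^sup>2 / (4 * a)) - a * (t + (- (s * l x e) / (2 * a)))\<^sup>2" for t
        proof -
          have "s * P (x + t *\<^sub>R e) = s * P x + t * (s * l x e) + t\<^sup>2 * (s * b e e)"
            by (simp add: line algebra_simps)
          also have "\<dots> = s * P x + t * (s * l x e) - a * t\<^sup>2" by (simp add: s(1))
          also have "\<dots> = (s * P x + (s * l x e)\<^sup>2 / (4 * a)) - a * (t + (- (s * l x e) / (2 * a)))\<^sup>2"
            using a by (simp add: power2_eq_square field_simps)
          finally show ?thesis .
        qed
        have "\<bar>(s * P x + (s * l x e)\<^sup>2 / (4 * a)) - a * (t + (- (s * l x e) / (2 * a)))\<^sup>2\<bar> \<le> 1"
          if "t \<in> {t. x + t *\<^sub>R e \<in> T}" for t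
        proof -
          have "\<bar>s * P (x + t *\<^sub>R e)\<bar> \<le> 1" using sub[of "x + t *\<^sub>R e"] that s(2) by (simp add: abs_mult)
          then show ?thesis unfolding sq .
        qed
        then show ?thesis by (rule shell_length[OF a])
      qed
      have "measure lebesgue T \<le> 2 * sqrt 2 / sqrt a * unit_ball_vol (real (?n - 1)) * 1 ^ (?n - 1)"
        by (rule measure_le_fibres[OF T(1) e(1), of 1 _ 0]) (use T(2) fib a in auto)
      then have "2 * q \<le> 2 * sqrt 2 / sqrt a * V'" using q(2) by (simp add: V'_def)
      then have X: "q * sqrt a \<le> sqrt 2 * V'" using a by (simp add: field_simps)
      have "k\<^sup>2 \<le> 7.1 * a" using e(2) by (simp add: a_def)
      also have "\<dots> \<le> 2.665\<^sup>2 * a" using a by (intro mult_right_mono) (auto simp: power2_eq_square)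
      also have "\<dots> = (2.665 * sqrt a)\<^sup>2" using a by (subst power_mult_distrib) simp
      finally have "k \<le> 2.665 * sqrt a" by (rule power2_le_imp_le) (use a in simp)
      then have "q * k \<le> q * (2.665 * sqrt a)" using q(1) by (intro mult_left_mono) auto
      also have "\<dots> = 2.665 * (q * sqrt a)" by simp
      also have "\<dots> \<le> 2.665 * (1.4143 * (1.05 * real ?n))"
        using X mult_mono[OF sqrt_2_bounds(2) V'(1) _ V'(2)] by simp
      also have "\<dots> \<le> 4 * real ?n" by simp
      finally show ?thesis .
    next
      case False
      \<comment> \<open>\<open>- D\<close> will bound the secant slopes of \<open>P\<close> between
        points of \<open>T\<close> on a ray from \<open>x0\<close>: the value has to drop from
        \<open>k\<^sup>2\<close> to at most 1, and curvature can undo at most 40 / 71 of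
        \<open>k\<^sup>2\<close>. As \<open>P\<close> varies by at most 2 on \<open>T\<close>, such
        points are within \<open>2 / D\<close> of each other.\<close>
      define D where "D = 31 / 71 * k\<^sup>2 - 1"
      define \<rho> where "\<rho> = 2 / D"
      have k16: "k\<^sup>2 \<ge> 16" using power_mono[of 4 k 2] k4 by simp
      have den: "D > 0" using k16 by (simp add: D_def)
      have Dk: "40 / 71 * k\<^sup>2 = k\<^sup>2 - 1 - D" by (simp add: D_def)
      have small: "\<bar>b h h\<bar> \<le> 40 / 71 * k\<^sup>2" if "norm h \<le> 2" for h
      proof (cases "h = 0")
        case True
        then show ?thesis using bl(1) by (simp add: bilinear_lzero)
      next
        case h: False
        define e where "e = (1 / norm h) *\<^sub>R h"
        have e: "norm e = 1" "h = norm h *\<^sub>R e" using h by (auto simp: e_def)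
        have "b h h = (norm h)\<^sup>2 * b e e"
          by (subst (1 2) e(2)) (simp add: bilinear_lmul[OF bl(1)] bilinear_rmul[OF bl(1)] power2_eq_square)
        then have "\<bar>b h h\<bar> = (norm h)\<^sup>2 * \<bar>b e e\<bar>" by (simp add: abs_mult)
        also have "\<dots> \<le> 2\<^sup>2 * (k\<^sup>2 / 7.1)"
          using False e(1) that by (intro mult_mono power_mono) (auto simp: not_le less_imp_le)
        finally show ?thesis by simp
      qed
      have "measure lebesgue T \<le> real DIM(real ^ 'n) * \<rho> * measure lebesgue (cball (0 :: real ^ 'n) 1)"
      proof (rule radial_measure_le[OF T(1) compact_cball convex_cball x0 T(2)])
        show "\<rho> \<ge> 0" using den by (simp add: \<rho>_def)
        show "measure lebesgue {s\<in>{0..1}. x0 + s *\<^sub>R (y - x0) \<in> T} \<le> \<rho>" if y: "y \<in> cball 0 1" for y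
        proof (rule measure_le_diameter)
          show "\<rho> \<ge> 0" using den by (simp add: \<rho>_def)
          show "bounded {s\<in>{0..1::real}. x0 + s *\<^sub>R (y - x0) \<in> T}"
            by (rule bounded_subset[of "{0..1}"]) auto
          define h where "h = y - x0"
          have "norm h \<le> 2"
            using norm_triangle_ineq4[of y x0] x0 y by (simp add: h_def)
          then have \<alpha>: "\<bar>b h h\<bar> \<le> 40 / 71 * k\<^sup>2" by (rule small)
          fix s t assume s: "s \<in> {s\<in>{0..1}. x0 + s *\<^sub>R (y - x0) \<in> T}" and t: "t \<in> {s\<in>{0..1}. x0 + s *\<^sub>R (y - x0) \<in> T}"
            and st: "s < t"
          define \<beta> where "\<beta> = l x0 h"
          define \<alpha> where "\<alpha> = b h h"
          have ps: "\<bar>k\<^sup>2 + s * \<beta> + s\<^sup>2 * \<alpha>\<bar> \<le> 1" and pt: "\<bar>k\<^sup>2 + t * \<beta> + t\<^sup>2 * \<alpha>\<bar> \<le> 1"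
            using sub[of "x0 + s *\<^sub>R h"] sub[of "x0 + t *\<^sub>R h"] s t by (auto simp: line k(2) h_def \<beta>_def \<alpha>_def)
          have s01: "0 \<le> s" "s \<le> 1" "t \<le> 1" using s t by auto
          have "s \<noteq> 0" using ps k16 by auto
          then have s0: "s > 0" using s01 by simp
          have "s * (k\<^sup>2 - 1) \<le> 1 * (k\<^sup>2 - 1)" using s01 k16 by (intro mult_right_mono) auto
          have "s * (\<beta> + \<alpha> * (s + t)) \<le> s * - D"
          proof -
            have "s * (\<beta> + \<alpha> * (s + t)) = (s * \<beta> + s\<^sup>2 * \<alpha>) + s * (\<alpha> * t)"
              by (simp add: algebra_simps power2_eq_square)
            also have "\<dots> \<le> (1 - k\<^sup>2) + s * (40 / 71 * k\<^sup>2)"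
            proof (rule add_mono)
              show "s * \<beta> + s\<^sup>2 * \<alpha> \<le> 1 - k\<^sup>2" using ps by linarith
              have "\<alpha> * t \<le> \<bar>\<alpha>\<bar> * t" using s0 st by (intro mult_right_mono) auto
              also have "\<dots> \<le> \<bar>\<alpha>\<bar> * 1" using s01 by (intro mult_left_mono) auto
              also have "\<dots> \<le> 40 / 71 * k\<^sup>2" using \<open>\<bar>b h h\<bar> \<le> 40 / 71 * k\<^sup>2\<close> by (simp add: \<alpha>_def)
              finally show "s * (\<alpha> * t) \<le> s * (40 / 71 * k\<^sup>2)" using s0 by (intro mult_left_mono) auto
            qed
            also have "\<dots> = (1 - k\<^sup>2) + s * (k\<^sup>2 - 1) - s * D" unfolding Dk by (simp add: right_diff_distrib)
            also have "\<dots> \<le> s * - D"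
              using \<open>s * (k\<^sup>2 - 1) \<le> 1 * (k\<^sup>2 - 1)\<close> by simp
            finally show ?thesis .
          qed
          then have "\<beta> + \<alpha> * (s + t) \<le> - D"
            using s0 by (simp only: mult_le_cancel_left_pos)
          then have "(t - s) * (\<beta> + \<alpha> * (s + t)) \<le> (t - s) * - D"
            using st by (intro mult_left_mono) auto
          moreover have "(t - s) * (\<beta> + \<alpha> * (s + t)) = (k\<^sup>2 + t * \<beta> + t\<^sup>2 * \<alpha>) - (k\<^sup>2 + s * \<beta> + s\<^sup>2 * \<alpha>)"
            by (simp add: algebra_simps power2_eq_square)
          ultimately have "(t - s) * D \<le> 2" using ps pt by linarith
          then show "t - s \<le> \<rho>" using den by (simp add: \<rho>_def pos_le_divide_eq)
        qed
      qed
      then have "2 * q \<le> real ?n * \<rho> * V" using q(2) by (simp add: content_cball V_def)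
      then have "q * D \<le> real ?n * V" using den by (simp add: \<rho>_def field_simps)
      also have "\<dots> \<le> real ?n * 5.3" using V(1) by (intro mult_left_mono) auto
      finally have 1: "q * D \<le> 5.3 * real ?n" by simp
      have "5.3 * k \<le> 4 * D"
      proof -
        \<comment> \<open>873 / 500 is 124 / 71 rounded down, and the constant term is lowered until
          4 becomes a root.\<close>
        have "0 \<le> (k - 4) * (873 / 500 * (k + 4) - 53 / 10)" using k4 by (intro mult_nonneg_nonneg) auto
        also have "\<dots> = 873 / 500 * k\<^sup>2 - 53 / 10 * k - 842 / 125" by (simp add: power2_eq_square field_simps)
        also have "\<dots> \<le> 124 / 71 * k\<^sup>2 - 53 / 10 * k - 4"
          by (intro diff_mono mult_right_mono) (use k(1) in auto)
        finally have "53 / 10 * k \<le> 4 * D" by (simp add: D_def)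
        then show ?thesis by simp
      qed
      then have "q * (5.3 * k) \<le> q * (4 * D)" using q(1) by (intro mult_left_mono) auto
      also have "\<dots> = 4 * (q * D)" by simp
      also have "\<dots> \<le> 4 * (5.3 * real ?n)" using 1 by (rule mult_left_mono) simp
      finally have "k * q \<le> 4 * real ?n" by simp
      then show ?thesis by (simp only: mult.commute)
    qed
  qed
  then show ?thesis by (simp add: k_def)
qed

text \<open>In the application \<open>X = q * sqrt a\<close>, where \<open>- a\<close> is the smallest value of the second-order form on
  unit vectors, and \<open>c\<close> is the norm of the peak, and \<open>s\<close> the square root of its height above \<open>- 1\<close>. The
  thresholds for \<open>c\<close> and \<open>s\<close> and the values of \<open>\<theta>\<close> are found numerically.\<close>
lemma peak_arith:
  fixes n :: nat and V' X c s :: real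
  assumes n: "n \<ge> 2" and V': "V' \<ge> 0" "V' \<le> 1.05 * real n" "V' \<le> 5.3" "n \<le> 5 \<Longrightarrow> V' \<le> 5.1" "n = 2 \<Longrightarrow> V' = 2"
    and X: "X \<ge> 0" and c: "0 \<le> c" "c \<le> 1" and s: "s > 0"
    and f1: "\<And>\<theta>. 0 \<le> \<theta> \<Longrightarrow> \<theta> \<le> 1 \<Longrightarrow> ((1 + \<theta>)\<^sup>2 - 4 * \<theta>\<^sup>2) * s \<le> sqrt 2 * ((1 + \<theta>)\<^sup>2 + 4 * \<theta>\<^sup>2) \<Longrightarrow> X \<le> V' * (sqrt 2 * (1 + \<theta>))"
    and f2: "X \<le> 2 * real n * V' / s"
    and f3: "0.72 < c \<Longrightarrow> 5 / 3 * sqrt 2 < s \<Longrightarrow> n \<ge> 3 \<Longrightarrow> X \<le> 2 * sqrt 2 * V' * ((1 - c\<^sup>2) / 0.64)"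
  shows "X * (1 + c) \<le> 4 * real n"
proof -
  have mono: "X * (1 + c) \<le> Y * (1 + m)" if "X \<le> Y" "c \<le> m" for Y m
    using that X c by (intro mult_mono) auto
  have Vs: "V' * (sqrt 2 * w) \<le> V * (1.4143 * w)" if "V' \<le> V" "w \<ge> 0" for w V
    using that V'(1) sqrt_2_bounds by (intro mult_mono) auto
  show ?thesis
  proof (cases "s \<le> 5 / 3 * sqrt 2")
    case True
    \<comment> \<open>For \<open>\<theta> = 1 / 3\<close> the condition in \<open>f1\<close> reads
      exactly \<open>s \<le> 5 / 3 * sqrt 2\<close>.\<close>
    have "X \<le> V' * (sqrt 2 * (1 + 1 / 3))"
      using True by (intro f1) (auto simp: power2_eq_square)
    also have "\<dots> \<le> (1.05 * real n) * (1.4143 * (1 + 1 / 3))" by (rule Vs[OF V'(2)]) simp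
    also have "\<dots> \<le> 2 * real n" by simp
    finally have "X * (1 + c) \<le> 2 * real n * (1 + 1)" using c by (intro mono) auto
    then show ?thesis by simp
  next
    case False
    then have s2: "s \<ge> 2.357" using sqrt_2_bounds(1) by simp
    have div: "X \<le> 2 * real n * V' / s0" if "0 < s0" "s0 \<le> s" for s0
      by (rule order_trans[OF f2]) (use that V'(1) s in \<open>auto intro!: divide_left_mono\<close>)
    show ?thesis
    proof (cases "n = 2")
      case True
      have "X \<le> 2 * real n * V' / 2.357" using s2 by (intro div) auto
      then have "X \<le> 4" using True V'(5) by simp
      then have "X * (1 + c) \<le> 4 * (1 + 1)" using c by (intro mono) auto
      then show ?thesis using True by simp
    next
      case n3: False
      then have n3: "n \<ge> 3" using n by simp
      show ?thesis
      proof (cases "c > 0.72")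
        case True
        define w where "w = 1 - c"
        have w: "0 \<le> w" "w \<le> 0.28" using True c by (auto simp: w_def)
        \<comment> \<open>The cubic increases for \<open>w \<le> 0.28\<close>, so its maximum is the
          value 0.28 * 1.72^2 = 0.828352 at the end point.\<close>
        have "(1 - c\<^sup>2) * (1 + c) = w * (2 - w)\<^sup>2" by (simp add: w_def power2_eq_square algebra_simps)
        also have "\<dots> \<le> 0.83"
        proof -
          have "w * (2 - w)\<^sup>2 = 4 * w - 4 * w\<^sup>2 + w\<^sup>2 * w" by (simp add: power2_eq_square algebra_simps)
          also have "\<dots> \<le> 4 * w - 4 * w\<^sup>2 + w\<^sup>2 * 0.28" using w by (intro add_left_mono mult_left_mono) auto
          also have "\<dots> = 4 * w - 3.72 * w\<^sup>2" by simp
          also have "\<dots> \<le> 0.83"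
          proof -
            have "0 \<le> (0.28 - w) * (2.9584 - 3.72 * w)" using w by (intro mult_nonneg_nonneg) auto
            also have "\<dots> = 0.828352 - 4 * w + 3.72 * w\<^sup>2" by (simp add: power2_eq_square field_simps)
            finally show ?thesis by simp
          qed
          finally show ?thesis .
        qed
        finally have cc: "(1 - c\<^sup>2) * (1 + c) \<le> 0.83" .
        have "X * (1 + c) \<le> 2 * sqrt 2 * V' * ((1 - c\<^sup>2) / 0.64) * (1 + c)"
          using f3[OF True _ n3] False c by (intro mult_right_mono) auto
        also have "\<dots> = V' * (sqrt 2 * (2 / 0.64 * ((1 - c\<^sup>2) * (1 + c))))" by simp
        also have "\<dots> \<le> V' * (sqrt 2 * (2 / 0.64 * 0.83))" using cc V'(1) by (intro mult_left_mono) auto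
        also have "\<dots> \<le> (1.05 * real n) * (1.4143 * (2 / 0.64 * 0.83))" by (rule Vs[OF V'(2)]) simp
        also have "\<dots> \<le> 4 * real n" by simp
        finally show ?thesis .
      next
        case c72: False
        \<comment> \<open>The condition in \<open>f1\<close> allows \<open>s\<close> up to about
          4.42 for \<theta> = 0.56 and 9.24 for \<theta> = 0.75; beyond that the decay of
          \<open>f2\<close> in \<open>s\<close> is enough. For \<open>n \<ge> 6\<close> the absolute
          bound 5.3 on \<open>V'\<close> beats \<open>1.05 * real n\<close>.\<close>
        consider "n \<le> 5" "s \<le> 4.4" | "n \<le> 5" "s \<ge> 4.4" | "n \<ge> 6" "s \<le> 9" | "n \<ge> 6" "s \<ge> 9" by linarith
        then have "X \<le> 4 * real n / 1.72"
        proof cases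
          case 1
          have "X \<le> V' * (sqrt 2 * (1 + 0.56))"
            using 1 sqrt_2_bounds by (intro f1) (auto simp: power2_eq_square)
          also have "\<dots> \<le> (1.05 * real n) * (1.4143 * (1 + 0.56))" by (rule Vs[OF V'(2)]) simp
          finally show ?thesis by simp
        next
          case 2
          have "X \<le> 2 * real n * V' / 4.4" using 2 by (intro div) auto
          also have "\<dots> \<le> 2 * real n * 5.1 / 4.4" using V'(4)[OF 2(1)] by (intro divide_right_mono mult_left_mono) auto
          finally show ?thesis by simp
        next
          case 3
          have "X \<le> V' * (sqrt 2 * (1 + 0.75))"
            using 3 sqrt_2_bounds by (intro f1) (auto simp: power2_eq_square)
          also have "\<dots> \<le> 5.3 * (1.4143 * (1 + 0.75))" by (rule Vs[OF V'(3)]) simp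
          finally show ?thesis using 3(1) by simp
        next
          case 4
          have "X \<le> 2 * real n * V' / 9" using 4 by (intro div) auto
          also have "\<dots> \<le> 2 * real n * 5.3 / 9" using V'(3) by (intro divide_right_mono mult_left_mono) auto
          finally show ?thesis by simp
        qed
        then have "X * (1 + c) \<le> 4 * real n / 1.72 * (1 + 0.72)" using c72 by (intro mono) auto
        then show ?thesis by simp
      qed
    qed
  qed
qed

text \<open>In terms of \<open>P x = P z - Q (x - z)\<close> with \<open>Q\<close> positive definite, \<open>V\<close> lies in the shell
  \<open>\<bar>P z - Q\<bar> \<le> 1\<close>, and \<open>U\<close> and \<open>V\<close> in the ellipsoid \<open>Q \<le> P z + 1\<close>. If \<open>P x0\<close> is nonnegative, the rays
  from \<open>z\<close> give the bound, otherwise the fibres in the direction in which \<open>Q\<close> is largest.\<close>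
lemma quadratic_bound_peak:
  fixes P :: "real ^ 'n \<Rightarrow> real"
  assumes P: "P \<in> poly_fun_le 2" and n: "CARD('n) \<ge> 2" and U: "compact U" "U \<subseteq> cball 0 1"
    and V: "compact V" "V \<subseteq> cball 0 1" and disj: "U \<inter> V = {}"
    and front: "\<And>y. y \<in> frontier U \<Longrightarrow> \<bar>P y\<bar> \<le> 1" and sub: "\<And>y. y \<in> V \<Longrightarrow> \<bar>P y\<bar> \<le> 1"
    and z: "z \<in> interior U" "P z > 1" "\<And>y. y \<in> U \<Longrightarrow> P y \<le> P z"
    and q: "q > 0" "q \<le> measure lebesgue U" "q \<le> measure lebesgue V" and x0: "x0 \<in> cball 0 1"
  shows "q * sqrt \<bar>P x0\<bar> \<le> 4 * real CARD('n)"
proof -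
  let ?n = "CARD('n)"
  define V1 where "V1 = unit_ball_vol (real ?n)"
  define V' where "V' = unit_ball_vol (real (?n - 1))"
  have V1: "V1 \<le> 5.3" "V1 < real ?n + 2" and V': "V' \<le> 1.05 * real ?n" "V' \<ge> 0" "V' \<le> 5.3"
    using unit_ball_vol_le[of ?n] unit_ball_vol_less_Suc_Suc[OF n] unit_ball_vol_pred_le[OF n]
      unit_ball_vol_le[of "?n - 1"]
    by (auto simp: V1_def V'_def)
  have n2: "real ?n \<ge> 2" using n by simp
  obtain b l where bl: "bilinear b" "\<And>h k. b h k = b k h" "\<And>x. linear (l x)" "\<And>x h. P (x + h) = P x + l x h + b h h"
    using quadratic_expansion[OF P] by blast
  note line = quadratic_line[OF bl(1,3,4)]
  define H where "H = P z"
  have H: "H > 1" using z(2) by (simp add: H_def)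
  have zU: "z \<in> U" using z(1) interior_subset by blast
  have bU: "bounded U" using U(1) by (rule compact_imp_bounded)
  have l0: "l z h = 0" for h
  proof -
    have "open ((\<lambda>t. z + t *\<^sub>R h) -` interior U)"
      by (intro open_vimage open_interior) (auto intro!: continuous_intros)
    moreover have "0 \<in> (\<lambda>t. z + t *\<^sub>R h) -` interior U" using z(1) by simp
    ultimately obtain \<epsilon> where \<epsilon>: "\<epsilon> > 0" "ball 0 \<epsilon> \<subseteq> (\<lambda>t. z + t *\<^sub>R h) -` interior U"
      by (meson open_contains_ball)
    have le: "t * l z h + t\<^sup>2 * b h h \<le> 0" if "\<bar>t\<bar> < \<epsilon>" for t
    proof -
      have "z + t *\<^sub>R h \<in> U" using \<epsilon>(2) that interior_subset[of U] by (auto simp: subset_iff dist_real_def)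
      then have "P (z + t *\<^sub>R h) \<le> P z" by (rule z(3))
      then show ?thesis by (simp add: line)
    qed
    \<comment> \<open>So small that \<open>z\<close> plus or minus \<open>t *\<^sub>R h\<close>
      stays in \<open>U\<close> and the quadratic term cannot outweigh the linear one.\<close>
    define t where "t = min (\<epsilon> / 2) (\<bar>l z h\<bar> / (2 * (\<bar>b h h\<bar> + 1)))"
    show ?thesis
    proof (rule ccontr)
      assume nz: "l z h \<noteq> 0"
      have t: "t > 0" "t < \<epsilon>" using \<epsilon>(1) nz by (auto simp: t_def)
      have "t * (2 * (\<bar>b h h\<bar> + 1)) \<le> \<bar>l z h\<bar>"
      proof -
        have "t \<le> \<bar>l z h\<bar> / (2 * (\<bar>b h h\<bar> + 1))" by (simp add: t_def)
        then show ?thesis by (subst (asm) pos_le_divide_eq) auto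
      qed
      then have small: "t * \<bar>b h h\<bar> < \<bar>l z h\<bar>" using t(1) by (simp add: algebra_simps)
      have "\<bar>l z h\<bar> + t * b h h \<le> 0"
      proof (cases "l z h > 0")
        case True
        have "t * (l z h + t * b h h) \<le> 0" using le[of t] t by (simp add: algebra_simps power2_eq_square)
        then show ?thesis using t(1) True by (simp add: mult_le_0_iff)
      next
        case False
        have "t * (- l z h + t * b h h) \<le> 0" using le[of "- t"] t by (simp add: algebra_simps power2_eq_square)
        then show ?thesis using t(1) False by (simp add: mult_le_0_iff)
      qed
      moreover have "- (t * \<bar>b h h\<bar>) \<le> t * b h h"
        using mult_left_mono[of "- \<bar>b h h\<bar>" "b h h" t] t(1) by simp
      ultimately show False using small by linarith
    qed
  qed
  define Q where "Q h = - b h h" for h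
  have PQ: "P (z + h) = H - Q h" for h by (simp add: bl(4) l0 Q_def H_def)
  have Qs: "Q (t *\<^sub>R h) = t\<^sup>2 * Q h" for t h
    by (simp add: Q_def bilinear_lmul[OF bl(1)] bilinear_rmul[OF bl(1)] power2_eq_square)
  have PQ': "P x = H - Q (x - z)" for x using PQ[of "x - z"] by simp
  \<comment> \<open>Each ray from \<open>z\<close> leaves \<open>U\<close> at a point where
    \<open>P \<le> 1 < H\<close>.\<close>
  have Qpos: "Q h > 0" if h0: "h \<noteq> 0" for h
  proof -
    obtain t where t: "t > 0" "z + t *\<^sub>R h \<in> frontier U" using frontier_on_ray[OF bU z(1) h0] by blast
    have "P (z + t *\<^sub>R h) \<le> 1" using front[OF t(2)] by simp
    then have "t\<^sup>2 * Q h > 0" using H by (simp add: PQ Qs)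
    then show ?thesis by (simp add: zero_less_mult_iff)
  qed
  have Q0: "Q h \<ge> 0" for h
    using Qpos[of h] Qs[of 0 h] by (cases "h = 0") auto
  \<comment> \<open>On the segment from \<open>z\<close> to \<open>z + h\<close> the value of
    \<open>P\<close> stays above 1, so the segment does not meet the frontier.\<close>
  have inU: "z + h \<in> U" if h: "Q h < H - 1" for h
  proof (rule ccontr)
    assume "z + h \<notin> U"
    then have "closed_segment z (z + h) \<inter> frontier U \<noteq> {}"
      using zU by (intro connected_Int_frontier) auto
    then obtain s where s: "0 \<le> s" "s \<le> 1" "(1 - s) *\<^sub>R z + s *\<^sub>R (z + h) \<in> frontier U"
      by (auto simp: in_segment)
    have "(1 - s) *\<^sub>R z + s *\<^sub>R (z + h) = z + s *\<^sub>R h" by (simp add: algebra_simps)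
    then have "P (z + s *\<^sub>R h) \<le> 1" using front[OF s(3)] by simp
    moreover have "s\<^sup>2 * Q h \<le> 1 * Q h" using s Q0 by (intro mult_right_mono) (auto simp: power_le_one)
    ultimately show False using h by (simp add: PQ Qs)
  qed
  \<comment> \<open>\<open>P\<close> does not increase along rays from \<open>z\<close>, so a value
    below - 1 would persist up to the frontier.\<close>
  have Ulow: "P x \<ge> - 1" if x: "x \<in> U" for x
  proof (rule ccontr)
    assume Px: "\<not> P x \<ge> - 1"
    have "x \<in> interior U"
      using x front[of x] Px compact_imp_closed[OF U(1)] by (auto simp: frontier_def closure_closed)
    moreover have "x - z \<noteq> 0" using Px H by (auto simp: H_def)
    ultimately obtain t where t: "t > 0" "x + t *\<^sub>R (x - z) \<in> frontier U" using frontier_on_ray[OF bU] by blast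
    have "x + t *\<^sub>R (x - z) = z + (1 + t) *\<^sub>R (x - z)" by (simp add: algebra_simps)
    then have "P (x + t *\<^sub>R (x - z)) = H - (1 + t)\<^sup>2 * Q (x - z)" by (simp add: PQ Qs)
    moreover have "1 * Q (x - z) \<le> (1 + t)\<^sup>2 * Q (x - z)" using t(1) Q0 by (intro mult_right_mono) auto
    ultimately show False using front[OF t(2)] PQ'[of x] Px by simp
  qed
  \<comment> \<open>\<open>W\<close> contains the disjoint sets \<open>U\<close> and
    \<open>V\<close>, hence has measure at least \<open>2 * q\<close>.\<close>
  define W where "W = cball 0 1 \<inter> {x. - 1 \<le> P x}"
  have "closed {x. - 1 \<le> P x}"
    by (intro closed_Collect_le continuous_intros continuous_on_poly_fun_le[OF P])
  then have W: "compact W" "W \<subseteq> cball 0 1" unfolding W_def by (auto intro: compact_Int_closed)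
  have VW: "V \<subseteq> W" using V(2) sub by (force simp: W_def abs_le_iff)
  have UW: "U \<subseteq> W" using U(2) Ulow by (auto simp: W_def)
  have lm: "S \<in> lmeasurable" if "compact S" for S :: "(real ^ 'n) set" using that by (rule lmeasurable_compact)
  have q2W: "2 * q \<le> measure lebesgue W"
  proof -
    have "2 * q \<le> measure lebesgue U + measure lebesgue V" using q by simp
    also have "\<dots> = measure lebesgue (U \<union> V)"
    proof -
      have "V - U = V" using disj by blast
      then show ?thesis using measure_Un2[OF lm[OF U(1)] lm[OF V(1)]] by simp
    qed
    also have "\<dots> \<le> measure lebesgue W" using UW VW by (intro measure_le_superset lm[OF W(1)]) auto
    finally show ?thesis .
  qed
  have qV1: "2 * q \<le> V1" using q2W measure_subset_ball_le[OF W(2)] by (simp add: V1_def)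
  show ?thesis
  proof (cases "P x0 \<ge> 0")
    case True
    define k where "k = sqrt H"
    have k: "k > 0" "k\<^sup>2 = H" using H by (auto simp: k_def)
    have "\<bar>P x0\<bar> \<le> H" using True Q0 by (simp add: PQ')
    then have "sqrt \<bar>P x0\<bar> \<le> k" by (simp add: k_def)
    then have "q * sqrt \<bar>P x0\<bar> \<le> q * k" using q(1) by (intro mult_left_mono) auto
    also have "q * k \<le> 4 * real ?n"
    proof (cases "k \<le> 2.56")
      case True
      then have "q * k \<le> (V1 / 2) * 2.56" using qV1 k q(1) by (intro mult_mono) auto
      then show ?thesis using V1(2) n2 by simp
    next
      case False
      have "measure lebesgue V \<le> real DIM(real ^ 'n) * (2 / (H + 1)) * measure lebesgue (cball (0 :: real ^ 'n) 1)"
      proof (rule radial_measure_le[OF V(1) compact_cball convex_cball _ V(2), of z])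
        show "z \<in> cball 0 1" using zU U(2) by blast
        show "0 \<le> 2 / (H + 1)" using H by simp
        show "measure lebesgue {s\<in>{0..1}. z + s *\<^sub>R (y - z) \<in> V} \<le> 2 / (H + 1)" for y
        proof (rule measure_le_diameter)
          show "0 \<le> 2 / (H + 1)" using H by simp
          show "bounded {s\<in>{0..1::real}. z + s *\<^sub>R (y - z) \<in> V}"
            by (rule bounded_subset[of "{0..1}"]) auto
          fix s t assume s: "s \<in> {s\<in>{0..1}. z + s *\<^sub>R (y - z) \<in> V}" and t: "t \<in> {s\<in>{0..1}. z + s *\<^sub>R (y - z) \<in> V}"
            and st: "s < t"
          define \<beta> where "\<beta> = Q (y - z)"
          have ps: "\<bar>H - s\<^sup>2 * \<beta>\<bar> \<le> 1" and pt: "\<bar>H - t\<^sup>2 * \<beta>\<bar> \<le> 1"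
            using sub[of "z + s *\<^sub>R (y - z)"] sub[of "z + t *\<^sub>R (y - z)"] s t by (auto simp: PQ Qs \<beta>_def)
          have st01: "0 \<le> s" "t \<le> 1" using s t by auto
          have \<beta>: "\<beta> \<ge> 0" by (simp add: \<beta>_def Q0)
          have t0: "t > 0" using st st01 by simp
          \<comment> \<open>From \<open>s\<^sup>2 * \<beta> \<ge> H - 1\<close> and
            \<open>t\<^sup>2 * \<beta> \<le> H + 1\<close>, that is (s / t)^2 \<ge> 1 - 2 / (H +
            1).\<close>
          have "(t\<^sup>2 - s\<^sup>2) * \<beta> * (H + 1) \<le> 2 * (t\<^sup>2 * \<beta>)"
          proof -
            have "(H - 1) * (t\<^sup>2 * \<beta>) \<le> (H - 1) * (H + 1)" using pt H by (intro mult_left_mono) auto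
            also have "\<dots> \<le> (s\<^sup>2 * \<beta>) * (H + 1)" using ps H by (intro mult_right_mono) auto
            finally show ?thesis by (simp add: algebra_simps)
          qed
          then have "\<beta> * ((t\<^sup>2 - s\<^sup>2) * (H + 1)) \<le> \<beta> * (2 * t\<^sup>2)" by (simp add: mult_ac)
          moreover have "\<beta> \<noteq> 0" using ps H by auto
          then have "\<beta> > 0" using \<beta> by simp
          ultimately have "(t\<^sup>2 - s\<^sup>2) * (H + 1) \<le> 2 * t\<^sup>2" by (simp only: mult_le_cancel_left_pos)
          moreover have "(t - s) * t \<le> t\<^sup>2 - s\<^sup>2"
            using mult_left_mono[of s t s] st st01 by (simp add: power2_eq_square algebra_simps)
          then have "(t - s) * t * (H + 1) \<le> (t\<^sup>2 - s\<^sup>2) * (H + 1)" using H by (intro mult_right_mono) auto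
          ultimately have "t * ((t - s) * (H + 1)) \<le> t * (2 * t)" by (simp add: power2_eq_square mult_ac)
          then have "(t - s) * (H + 1) \<le> 2 * t" using t0 by (simp only: mult_le_cancel_left_pos)
          then have "(t - s) * (H + 1) \<le> 2" using st01 by simp
          then show "t - s \<le> 2 / (H + 1)" using H by (simp add: pos_le_divide_eq)
        qed
      qed
      then have "q \<le> 2 * real ?n * V1 / (H + 1)"
        using q(3) by (simp add: content_cball V1_def mult_ac)
      then have "q * (k\<^sup>2 + 1) \<le> 2 * real ?n * V1"
        using H unfolding k(2) by (simp add: pos_le_divide_eq)
      also have "\<dots> \<le> 2 * real ?n * (53 / 10)" using V1(1) by (intro mult_left_mono) auto
      finally have 1: "q * (k\<^sup>2 + 1) \<le> 2 * real ?n * (53 / 10)" .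
      have "0 \<le> (k - 64 / 25) * (2 * (k + 64 / 25) - 53 / 10)" using False by (intro mult_nonneg_nonneg) auto
      also have "\<dots> = 2 * k\<^sup>2 - 53 / 10 * k + 288 / 625" by (simp add: power2_eq_square field_simps)
      finally have "53 / 10 * k \<le> 2 * (k\<^sup>2 + 1)" by simp
      then have "q * (53 / 10 * k) \<le> q * (2 * (k\<^sup>2 + 1))" using q(1) by (intro mult_left_mono) auto
      moreover have "q * (2 * (k\<^sup>2 + 1)) = 2 * (q * (k\<^sup>2 + 1))" "q * (53 / 10 * k) = 53 / 10 * (q * k)" by simp_all
      ultimately show ?thesis using 1 by linarith
    qed
    finally show ?thesis .
  next
    case False
    define c where "c = norm z"
    have c: "0 \<le> c" "c \<le> 1" using zU U(2) by (auto simp: c_def)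
    obtain e where e: "norm e = 1" "\<And>h. norm h = 1 \<Longrightarrow> Q h \<le> Q e"
    proof -
      have "Q = (\<lambda>h. H - P (z + h))" by (simp add: PQ)
      moreover have "continuous_on (sphere 0 1) (\<lambda>h. H - P (z + h))"
        by (intro continuous_intros continuous_on_compose2[OF continuous_on_poly_fun_le[OF P, of UNIV]]) auto
      ultimately have "continuous_on (sphere 0 1) Q" by simp
      moreover have "sphere (0 :: real ^ 'n) 1 \<noteq> {}" by simp
      ultimately show ?thesis
        using continuous_attains_sup[of "sphere (0 :: real ^ 'n) 1" Q] that by (auto simp: dist_norm)
    qed
    define a where "a = Q e"
    have "e \<noteq> 0" using e(1) by auto
    then have a: "a > 0" using Qpos by (simp add: a_def)
    have Qle: "Q h \<le> a * (norm h)\<^sup>2" for h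
    proof (cases "h = 0")
      case True
      then show ?thesis using Qs[of 0 h] by simp
    next
      case False
      have "Q h = Q (norm h *\<^sub>R ((1 / norm h) *\<^sub>R h))" using False by simp
      also have "\<dots> = (norm h)\<^sup>2 * Q ((1 / norm h) *\<^sub>R h)" by (rule Qs)
      also have "\<dots> \<le> (norm h)\<^sup>2 * a" unfolding a_def using False by (intro mult_left_mono e(2)) auto
      finally show ?thesis by (simp add: mult.commute)
    qed
    have ee: "e \<bullet> e = 1" using e(1) by (simp add: norm_eq_1)
    have Qadd: "Q (\<tau> *\<^sub>R e + w) = \<tau>\<^sup>2 * a - 2 * \<tau> * b e w + Q w" for \<tau> w
      using bl(2)[of w e]
      by (simp add: Q_def a_def bilinear_ladd[OF bl(1)] bilinear_radd[OF bl(1)] bilinear_lmul[OF bl(1)]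
          bilinear_rmul[OF bl(1)] power2_eq_square algebra_simps)
    \<comment> \<open>The first-order condition for the maximum of \<open>Q\<close> on the sphere at
      \<open>e\<close>. It makes \<open>P\<close> on a fibre along \<open>e\<close> a constant minus
      \<open>a\<close> times a square.\<close>
    have orth: "b e w = 0" if we: "w \<bullet> e = 0" for w
    proof (rule ccontr)
      assume nz: "b e w \<noteq> 0"
      define D where "D = a * (norm w)\<^sup>2 + 1"
      have "D > 0" using a by (simp add: D_def add_nonneg_pos)
      then have D: "D > 0" "D \<noteq> 0" by auto
      define \<tau> where "\<tau> = - b e w / D"
      have "Q (1 *\<^sub>R e + \<tau> *\<^sub>R w) \<le> a * (norm (1 *\<^sub>R e + \<tau> *\<^sub>R w))\<^sup>2" by (rule Qle)
      also have "(norm (1 *\<^sub>R e + \<tau> *\<^sub>R w))\<^sup>2 = 1 + \<tau>\<^sup>2 * (norm w)\<^sup>2"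
        unfolding power2_norm_eq_inner using we ee
        by (simp add: inner_add_left inner_add_right inner_commute power2_eq_square)
      finally have "a - 2 * (\<tau> * b e w) + \<tau>\<^sup>2 * Q w \<le> a * (1 + \<tau>\<^sup>2 * (norm w)\<^sup>2)"
        unfolding Qadd by (simp add: Qs bilinear_rmul[OF bl(1)])
      moreover have "0 \<le> \<tau>\<^sup>2 * Q w" using Q0 by simp
      moreover have "a * (1 + \<tau>\<^sup>2 * (norm w)\<^sup>2) = a + \<tau>\<^sup>2 * (D - 1)" by (simp add: D_def algebra_simps)
      moreover have "\<tau>\<^sup>2 * (D - 1) \<le> \<tau>\<^sup>2 * D" by (intro mult_left_mono) auto
      ultimately have "- 2 * (\<tau> * b e w) \<le> \<tau>\<^sup>2 * D" by linarith
      moreover have "\<tau> * b e w = - (b e w)\<^sup>2 / D" "\<tau>\<^sup>2 * D = (b e w)\<^sup>2 / D"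
        using D by (auto simp: \<tau>_def power2_eq_square)
      ultimately have "(b e w)\<^sup>2 / D \<le> 0" by simp
      then show False using D nz by (simp add: divide_le_0_iff)
    qed
    have fibP: "P (x + t *\<^sub>R e) = (H - Q ((x - z) - ((x - z) \<bullet> e) *\<^sub>R e)) - a * (t + (x - z) \<bullet> e)\<^sup>2" for x t
    proof -
      define w where "w = (x - z) - ((x - z) \<bullet> e) *\<^sub>R e"
      have we: "w \<bullet> e = 0" by (simp add: w_def inner_diff_left ee)
      have "x + t *\<^sub>R e - z = (t + (x - z) \<bullet> e) *\<^sub>R e + w" by (simp add: w_def algebra_simps)
      then have "P (x + t *\<^sub>R e) = H - Q ((t + (x - z) \<bullet> e) *\<^sub>R e + w)" by (simp add: PQ')
      also have "\<dots> = (H - Q w) - a * (t + (x - z) \<bullet> e)\<^sup>2" unfolding Qadd orth[OF we] by simp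
      finally show ?thesis by (simp add: w_def)
    qed
    have RH: "H - Q w \<le> H" for w using Q0[of w] by simp
    define u where "u = H + 1"
    have u: "u > 2" using H by (simp add: u_def)
    define X where "X = q * sqrt a"
    have sa: "sqrt a > 0" using a by simp
    have mixed: "\<theta> * measure lebesgue {t. x + t *\<^sub>R e \<in> V} + (1 - \<theta>) / 2 * measure lebesgue {t. x + t *\<^sub>R e \<in> W}
        \<le> sqrt 2 * (1 + \<theta>) / sqrt a"
      if "0 \<le> \<theta>" "\<theta> \<le> 1" "((1 + \<theta>)\<^sup>2 - 4 * \<theta>\<^sup>2) * sqrt u \<le> sqrt 2 * ((1 + \<theta>)\<^sup>2 + 4 * \<theta>\<^sup>2)" for \<theta> x
    proof (rule mixed_shell_length[OF a that(1,2) RH _ that(3)[unfolded u_def]])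
      show "- 1 \<le> H" using H by simp
      show "\<bar>(H - Q ((x - z) - ((x - z) \<bullet> e) *\<^sub>R e)) - a * (t + (x - z) \<bullet> e)\<^sup>2\<bar> \<le> 1"
        if "t \<in> {t. x + t *\<^sub>R e \<in> V}" for t
        unfolding fibP[symmetric] using that sub by simp
      show "- 1 \<le> (H - Q ((x - z) - ((x - z) \<bullet> e) *\<^sub>R e)) - a * (t + (x - z) \<bullet> e)\<^sup>2"
        if "t \<in> {t. x + t *\<^sub>R e \<in> W}" for t
        unfolding fibP[symmetric] using that by (simp add: W_def)
    qed
    have f1: "X \<le> V' * (sqrt 2 * (1 + \<theta>))"
      if \<theta>: "0 \<le> \<theta>" "\<theta> \<le> 1" "((1 + \<theta>)\<^sup>2 - 4 * \<theta>\<^sup>2) * sqrt u \<le> sqrt 2 * ((1 + \<theta>)\<^sup>2 + 4 * \<theta>\<^sup>2)" for \<theta>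
    proof -
      \<comment> \<open>The weights are such that \<open>q \<le> measure lebesgue V\<close> and
        \<open>2 * q \<le> measure lebesgue W\<close> combine to \<open>q\<close> for every
        \<theta>.\<close>
      have "\<theta> * q + (1 - \<theta>) / 2 * (2 * q) \<le> \<theta> * measure lebesgue V + (1 - \<theta>) / 2 * measure lebesgue W"
        using \<theta> q(3) q2W by (intro add_mono mult_left_mono) auto
      also have "\<dots> \<le> sqrt 2 * (1 + \<theta>) / sqrt a * unit_ball_vol (real (?n - 1)) * 1 ^ (?n - 1)"
      proof (rule measure_fibres_le[OF V(1) W(1) e(1), of _ _ _ _ 0])
        show "norm (x - 0 - ((x - 0) \<bullet> e) *\<^sub>R e) \<le> 1" if "x \<in> V \<union> W" for x
          using norm_perp_le[OF e(1), of x] V(2) W(2) that by (force simp: subset_iff)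
      qed (use \<theta> mixed[OF \<theta>] sa in auto)
      finally have "q \<le> sqrt 2 * (1 + \<theta>) / sqrt a * V'" by (simp add: V'_def field_simps)
      then have "q * sqrt a \<le> sqrt 2 * (1 + \<theta>) / sqrt a * V' * sqrt a" using sa by (intro mult_right_mono) auto
      also have "\<dots> = V' * (sqrt 2 * (1 + \<theta>))" using sa by simp
      finally show ?thesis by (simp add: X_def)
    qed
    have Wfib: "measure lebesgue {t. x + t *\<^sub>R e \<in> W} \<le> 2 * sqrt u / sqrt a" for x
    proof -
      have "measure lebesgue {t. x + t *\<^sub>R e \<in> W} \<le> 2 * (sqrt (u / a) - 0)"
      proof (rule measure_le_two_intervals[where y = "(x - z) \<bullet> e"])
        show "0 \<le> \<bar>t + (x - z) \<bullet> e\<bar> \<and> \<bar>t + (x - z) \<bullet> e\<bar> \<le> sqrt (u / a)" if "t \<in> {t. x + t *\<^sub>R e \<in> W}" for t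
        proof -
          have "- 1 \<le> (H - Q ((x - z) - ((x - z) \<bullet> e) *\<^sub>R e)) - a * (t + (x - z) \<bullet> e)\<^sup>2"
            unfolding fibP[symmetric] using that by (simp add: W_def)
          then have "a * (t + (x - z) \<bullet> e)\<^sup>2 \<le> u"
            using Q0[of "(x - z) - ((x - z) \<bullet> e) *\<^sub>R e"] by (simp add: u_def)
          then have "\<bar>t + (x - z) \<bullet> e\<bar>\<^sup>2 \<le> u / a" using a by (simp add: field_simps)
          then show ?thesis by (auto intro: real_le_rsqrt)
        qed
      qed (use u a in auto)
      then show ?thesis by (simp add: real_sqrt_divide)
    qed
    have mW: "measure lebesgue W \<le> 2 * sqrt u / sqrt a * V'"
    proof -
      have "measure lebesgue W \<le> 2 * sqrt u / sqrt a * unit_ball_vol (real (?n - 1)) * 1 ^ (?n - 1)"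
        by (rule measure_le_fibres[OF W(1) e(1), of 1 _ 0]) (use W(2) Wfib u sa in auto)
      then show ?thesis by (simp add: V'_def)
    qed
    \<comment> \<open>The ratio of the ellipsoids \<open>Q = H - 1\<close> and
      \<open>Q = H + 1\<close>. Shrinking \<open>W\<close> towards \<open>z\<close> by a factor
      below \<sigma> gives a subset of \<open>W\<close> on which \<open>P > 1\<close>, hence
      disjoint from \<open>V\<close>.\<close>
    define \<sigma> where "\<sigma> = sqrt ((H - 1) / (H + 1))"
    have \<sigma>: "\<sigma> > 0" "\<sigma>\<^sup>2 = (H - 1) / (H + 1)" "\<sigma> < 1" using H by (auto simp: \<sigma>_def)
    have mV: "measure lebesgue V \<le> (1 - \<sigma> ^ ?n) * measure lebesgue W"
    proof -
      \<comment> \<open>The factor \<open>w < 1\<close> keeps the shrunken copy strictly inside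
        \<open>P > 1\<close>; \<open>field_le_mult_one_interval\<close> removes it in the
        end.\<close>
      have "w * (\<sigma> ^ ?n * measure lebesgue W) \<le> measure lebesgue W - measure lebesgue V" if w: "0 < w" "w < 1" for w
      proof -
        define s where "s = root ?n w * \<sigma>"
        have rw: "0 < root ?n w" "root ?n w < 1" using w by auto
        have s: "0 < s" "s < \<sigma>" using rw \<sigma> by (auto simp: s_def)
        have sn: "s ^ ?n = w * \<sigma> ^ ?n" using w by (simp add: s_def power_mult_distrib)
        define S where "S = (\<lambda>x. s *\<^sub>R x + (1 - s) *\<^sub>R z) ` W"
        have mS: "measure lebesgue S = s ^ ?n * measure lebesgue W"
          unfolding S_def using measure_lebesgue_affine[of s "(1 - s) *\<^sub>R z" W] s by simp
        have cS: "compact S"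
          unfolding S_def by (intro compact_continuous_image W(1) continuous_intros)
        have PS: "P x > 1 \<and> x \<in> cball 0 1" if xS: "x \<in> S" for x
        proof -
          obtain y where y: "y \<in> W" "x = s *\<^sub>R y + (1 - s) *\<^sub>R z" using xS by (auto simp: S_def)
          have "x \<in> cball 0 1"
            unfolding y(2) using y(1) W(2) zU U(2) s \<sigma>(3) by (intro convexD[OF convex_cball]) auto
          moreover have "x = z + s *\<^sub>R (y - z)" by (simp add: y(2) algebra_simps)
          then have "P x = H - s\<^sup>2 * Q (y - z)" by (simp add: PQ Qs)
          moreover have "Q (y - z) \<le> H + 1" using y(1) PQ'[of y] by (simp add: W_def)
          then have "s\<^sup>2 * Q (y - z) \<le> s\<^sup>2 * (H + 1)" by (intro mult_left_mono) auto
          moreover have "s\<^sup>2 * (H + 1) < \<sigma>\<^sup>2 * (H + 1)"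
            using s H by (intro mult_strict_right_mono power_strict_mono) auto
          moreover have "\<sigma>\<^sup>2 * (H + 1) = H - 1" using H by (simp add: \<sigma>(2))
          ultimately show ?thesis by simp
        qed
        have "V - S = V" using PS sub by fastforce
        then have "measure lebesgue S + measure lebesgue V = measure lebesgue (S \<union> V)"
          using measure_Un2[OF lm[OF cS] lm[OF V(1)]] by simp
        also have "\<dots> \<le> measure lebesgue W"
        proof (rule measure_le_superset[OF _ lm[OF W(1)]])
          have "S \<subseteq> W" using PS by (force simp: W_def)
          then show "S \<union> V \<subseteq> W" using VW by blast
        qed
        finally have "measure lebesgue S + measure lebesgue V \<le> measure lebesgue W" .
        then show ?thesis by (simp add: mS sn mult.assoc)
      qed
      then have "\<sigma> ^ ?n * measure lebesgue W \<le> measure lebesgue W - measure lebesgue V"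
        by (rule field_le_mult_one_interval)
      then show ?thesis by (simp add: algebra_simps)
    qed
    have \<sigma>n: "1 - \<sigma> ^ ?n \<le> real ?n / u"
    proof -
      \<comment> \<open>For \<open>n \<ge> 2\<close> the mean of the powers is at most the mean of 1
        and \<sigma>; the factor 1 + \<sigma> is wanted because (1 - \<sigma>) (1 + \<sigma>) = 2 /
        u.\<close>
      have "(\<Sum>i<?n. \<sigma> ^ i) \<le> real ?n * (1 + \<sigma>) / 2"
      proof -
        have "(\<Sum>i<?n. \<sigma> ^ i) = 1 + (\<Sum>i\<in>{1..<?n}. \<sigma> ^ i)"
          using n by (simp add: lessThan_atLeast0 sum.atLeast_Suc_lessThan)
        also have "(\<Sum>i\<in>{1..<?n}. \<sigma> ^ i) \<le> (\<Sum>i\<in>{1..<?n}. \<sigma>)"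
        proof (rule sum_mono)
          fix i assume "i \<in> {1..<?n}"
          then have "\<sigma> ^ i \<le> \<sigma> ^ 1" using \<sigma> by (intro power_decreasing) auto
          then show "\<sigma> ^ i \<le> \<sigma>" by simp
        qed
        also have "(\<Sum>i\<in>{1..<?n}. \<sigma>) = (real ?n - 1) * \<sigma>" using n by (simp add: of_nat_diff)
        also have "1 + (real ?n - 1) * \<sigma> \<le> real ?n * (1 + \<sigma>) / 2"
          using mult_nonneg_nonneg[of "real ?n - 2" "1 - \<sigma>"] n2 \<sigma>(3) by (simp add: field_simps)
        finally show ?thesis by simp
      qed
      then have "(1 - \<sigma>) * (\<Sum>i<?n. \<sigma> ^ i) \<le> (1 - \<sigma>) * (real ?n * (1 + \<sigma>) / 2)" using \<sigma>(3) by (intro mult_left_mono) auto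
      also have "\<dots> = real ?n / 2 * (1 - \<sigma>\<^sup>2)" by (simp add: power2_eq_square algebra_simps)
      also have "1 - \<sigma>\<^sup>2 = 2 / u" using H by (simp add: \<sigma>(2) u_def field_simps)
      finally show ?thesis using one_diff_power_eq[of \<sigma> ?n] by simp
    qed
    have f2: "X \<le> 2 * real ?n * V' / sqrt u"
    proof -
      have "q \<le> (1 - \<sigma> ^ ?n) * measure lebesgue W" using q(3) mV by simp
      also have "\<dots> \<le> real ?n / u * (2 * sqrt u / sqrt a * V')"
        using \<sigma>n mW u by (intro mult_mono) auto
      finally have "q * sqrt a \<le> real ?n / u * (2 * sqrt u / sqrt a * V') * sqrt a" using sa by (intro mult_right_mono) auto
      also have "\<dots> = 2 * real ?n * V' * (sqrt u / u)" using sa by simp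
      also have "sqrt u / u = 1 / sqrt u" using u by (simp add: sqrt_divide_self_eq inverse_eq_divide)
      finally show ?thesis by (simp add: X_def)
    qed
    \<comment> \<open>For 0 < s < \<sigma> both \<open>z + s *\<^sub>R h\<close> and its mirror
      image in \<open>z\<close> lie in \<open>U\<close>, hence in the ball, and the parallelogram
      law gives the bound.\<close>
    have lens: "(norm h)\<^sup>2 * \<sigma>\<^sup>2 \<le> 1 - c\<^sup>2" if h: "Q h \<le> H + 1" for h
    proof -
      have "w * ((norm h)\<^sup>2 * \<sigma>\<^sup>2) \<le> 1 - c\<^sup>2" if w: "0 < w" "w < 1" for w
      proof -
        define s where "s = sqrt w * \<sigma>"
        have s2: "s\<^sup>2 = w * \<sigma>\<^sup>2" using w by (simp add: s_def power_mult_distrib)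
        have "s\<^sup>2 * Q h \<le> s\<^sup>2 * (H + 1)" using h by (intro mult_left_mono) auto
        also have "\<dots> = w * (H - 1)" using H by (simp add: s2 \<sigma>(2))
        also have "\<dots> < H - 1" using w H by simp
        finally have "Q (s *\<^sub>R h) < H - 1" "Q ((- s) *\<^sub>R h) < H - 1" unfolding Qs by simp_all
        then have "z + s *\<^sub>R h \<in> cball 0 1" "z + (- s) *\<^sub>R h \<in> cball 0 1" using inU U(2) by blast+
        then have "(norm (z + s *\<^sub>R h))\<^sup>2 \<le> 1" "(norm (z + (- s) *\<^sub>R h))\<^sup>2 \<le> 1"
          by (auto simp: power_le_one)
        moreover have "(norm (z + s *\<^sub>R h))\<^sup>2 + (norm (z + (- s) *\<^sub>R h))\<^sup>2 = 2 * c\<^sup>2 + 2 * (s\<^sup>2 * (norm h)\<^sup>2)"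
          unfolding c_def power2_norm_eq_inner
          by (simp add: inner_add_left inner_add_right inner_diff_left inner_diff_right inner_commute power2_eq_square)
        ultimately have "s\<^sup>2 * (norm h)\<^sup>2 \<le> 1 - c\<^sup>2" by linarith
        then show ?thesis by (simp add: s2 mult_ac)
      qed
      then show ?thesis by (rule field_le_mult_one_interval)
    qed
    have f3: "X \<le> 2 * sqrt 2 * V' * ((1 - c\<^sup>2) / 0.64)"
      if c72: "0.72 < c" and su: "5 / 3 * sqrt 2 < sqrt u" and n3: "?n \<ge> 3"
    proof -
      have "(5 / 3 * sqrt 2)\<^sup>2 < (sqrt u)\<^sup>2" using su by (intro power_strict_mono) auto
      then have u50: "u > 50 / 9" using u by (simp add: power_mult_distrib power2_eq_square)
      have "1 - \<sigma>\<^sup>2 = 2 / u" using H by (simp add: \<sigma>(2) u_def field_simps)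
      moreover have "2 / u \<le> 9 / 25" using u50 by (simp add: field_simps)
      ultimately have \<sigma>64: "16 / 25 \<le> \<sigma>\<^sup>2" by linarith
      \<comment> \<open>By \<open>lens\<close> and \<sigma>^2 \<ge> 0.64 the set \<open>V\<close>
        lies in the ball of radius \<open>r\<close> about \<open>z\<close>. The condition
        \<open>0.72 < c\<close> makes \<open>r \<le> 1\<close>, and \<open>n \<ge> 3\<close> then
        gains a factor r^2 from the shadow of \<open>V\<close>.\<close>
      define r where "r = sqrt ((1 - c\<^sup>2) / 0.64)"
      have c2: "c\<^sup>2 \<ge> 0.72\<^sup>2" using c72 by (intro power_mono) auto
      have "e \<noteq> 0" by fact
      have c1: "c\<^sup>2 < 1"
      proof -
        define h where "h = (1 / sqrt a) *\<^sub>R e"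
        have "Q h = 1" using a by (simp add: h_def Qs power_divide a_def[symmetric])
        then have "(norm h)\<^sup>2 * \<sigma>\<^sup>2 \<le> 1 - c\<^sup>2" using H by (intro lens) auto
        moreover have "h \<noteq> 0" using \<open>e \<noteq> 0\<close> a by (simp add: h_def)
        then have "(norm h)\<^sup>2 * \<sigma>\<^sup>2 > 0" using \<sigma>(1) by simp
        ultimately show ?thesis by linarith
      qed
      have r: "r > 0" "r\<^sup>2 = (1 - c\<^sup>2) / 0.64" using c1 by (auto simp: r_def)
      have r1: "r \<le> 1" unfolding r_def using c2 by (simp add: power2_eq_square)
      have Vr: "norm (x - z) \<le> r" if "x \<in> V" for x
      proof -
        have "Q (x - z) \<le> H + 1" using sub[OF that] PQ'[of x] by simp
        then have "(norm (x - z))\<^sup>2 * \<sigma>\<^sup>2 \<le> 1 - c\<^sup>2" by (rule lens)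
        moreover have "(norm (x - z))\<^sup>2 * (16 / 25) \<le> (norm (x - z))\<^sup>2 * \<sigma>\<^sup>2" using \<sigma>64 by (intro mult_left_mono) auto
        ultimately have "(norm (x - z))\<^sup>2 \<le> r\<^sup>2" by (simp add: r(2))
        then show ?thesis by (rule power2_le_imp_le) (use r in simp)
      qed
      have "measure lebesgue V \<le> 2 * sqrt 2 / sqrt a * unit_ball_vol (real (?n - 1)) * r ^ (?n - 1)"
      proof (rule measure_le_fibres[OF V(1) e(1) r(1), of _ z])
        show "measure lebesgue {t. x + t *\<^sub>R e \<in> V} \<le> 2 * sqrt 2 / sqrt a" for x
          using mixed[of 1 x] by (simp add: mult.commute)
      qed (use Vr sa in auto)
      also have "\<dots> \<le> 2 * sqrt 2 / sqrt a * V' * r ^ 2"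
        unfolding V'_def[symmetric] using r r1 n3 sa V'(2) by (intro mult_left_mono power_decreasing) auto
      finally have "q \<le> 2 * sqrt 2 / sqrt a * V' * r ^ 2" using q(3) by simp
      then have "q * sqrt a \<le> 2 * sqrt 2 / sqrt a * V' * r ^ 2 * sqrt a" using sa by (intro mult_right_mono) auto
      also have "\<dots> = 2 * sqrt 2 * V' * r\<^sup>2" using sa by simp
      finally show ?thesis by (simp add: X_def r(2))
    qed
    have "X * (1 + c) \<le> 4 * real ?n"
    proof (rule peak_arith[OF n V'(2,1,3) _ _ _ c _ f1 f2 f3])
      show "V' \<le> 5.1" if n5: "?n \<le> 5"
      proof -
        consider "?n - 1 = 1" | "?n - 1 = 2" | "?n - 1 = 3" | "?n - 1 = 4" using n n5 by linarith
        then show ?thesis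
          unfolding V'_def by cases (simp_all only: unit_ball_vol_small, insert pi_le_3_15 pi_squared_le, auto)
      qed
      show "V' = 2" if "?n = 2" unfolding V'_def using that by simp
      show "0 \<le> X" using q(1) sa by (simp add: X_def)
      show "0 < sqrt u" using u by simp
    qed
    \<comment> \<open>Since \<open>P x0 < 0 < H\<close>, the absolute value of \<open>P x0\<close>
      is at most \<open>Q (x0 - z)\<close>.\<close>
    moreover have "sqrt \<bar>P x0\<bar> \<le> sqrt a * (1 + c)"
    proof -
      have "norm (x0 - z) \<le> 1 + c" using norm_triangle_ineq4[of x0 z] x0 by (simp add: c_def)
      then have "a * (norm (x0 - z))\<^sup>2 \<le> a * (1 + c)\<^sup>2" using a by (intro mult_left_mono power_mono) auto
      then have "\<bar>P x0\<bar> \<le> a * (1 + c)\<^sup>2" using False Qle[of "x0 - z"] PQ'[of x0] H by simp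
      then have "sqrt \<bar>P x0\<bar> \<le> sqrt (a * (1 + c)\<^sup>2)" by (rule real_sqrt_le_mono)
      also have "\<dots> = sqrt a * (1 + c)" using c by (simp add: real_sqrt_mult)
      finally show ?thesis .
    qed
    then have "q * sqrt \<bar>P x0\<bar> \<le> q * (sqrt a * (1 + c))" using q(1) by (intro mult_left_mono) auto
    ultimately show ?thesis by (simp add: X_def mult.assoc)
  qed
qed

text \<open>If one of the two sets contains a peak, the other lies in the sublevel set, because a
  second peak and a valley are both excluded on lines. Valleys reduce to peaks by passing to
  \<open>- P\<close>.\<close>

lemma poly_fun_le_bound_deg_2:
  fixes P :: "real ^ 'n \<Rightarrow> real"
  assumes P: "P \<in> poly_fun_le 2" and n: "CARD('n) \<ge> 2"
    and U: "compact U" "U \<subseteq> cball 0 1" and V: "compact V" "V \<subseteq> cball 0 1" and disj: "U \<inter> V = {}"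
    and front: "\<And>y. y \<in> frontier U \<union> frontier V \<Longrightarrow> \<bar>P y\<bar> \<le> 1"
    and q: "q > 0" "q \<le> measure lebesgue U" "q \<le> measure lebesgue V" and x0: "x0 \<in> cball 0 1"
  shows "\<bar>P x0\<bar> \<le> (4 * real CARD('n) / q)\<^sup>2"
proof -
  have peak: "q * sqrt \<bar>F x0\<bar> \<le> 4 * real CARD('n)"
    if F: "F \<in> poly_fun_le 2" and A: "compact A" "A \<subseteq> cball 0 1" and B: "compact B" "B \<subseteq> cball 0 1" and AB: "A \<inter> B = {}"
      and fr: "\<And>y. y \<in> frontier A \<Longrightarrow> \<bar>F y\<bar> \<le> 1" "\<And>y. y \<in> frontier B \<Longrightarrow> \<bar>F y\<bar> \<le> 1"
      and z: "z \<in> interior A" "\<forall>y\<in>A. F y \<le> F z" "F z > 1" and qAB: "q \<le> measure lebesgue A" "q \<le> measure lebesgue B"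
    for F :: "real ^ 'n \<Rightarrow> real" and A B z
  proof -
    have bd: "bounded A" "bounded B" using A(1) B(1) by (auto intro: compact_imp_bounded)
    have F3: "F \<in> poly_fun_le 3" by (rule poly_fun_le_mono[OF F]) simp
    have nop: "\<bar>F w\<bar> \<le> 1" if "w \<in> interior B" for w
      using no_two_peaks[OF F3 bd(1) fr(1) bd(2) fr(2) AB z(1,3) that]
        no_peak_and_valley[OF F bd(1) fr(1) bd(2) fr(2) z(1,3) that] by (simp add: abs_le_iff)
    have "\<bar>F y\<bar> \<le> 1" if "y \<in> B" for y
      using sublevel_if_no_peak[OF B(1) continuous_on_poly_fun_le[OF F] fr(2) nop that] .
    then show ?thesis
      using quadratic_bound_peak[OF F n A B AB fr(1) _ z(1,3) _ q(1) qAB x0] z(2) by blast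
  qed
  have "q * sqrt \<bar>P x0\<bar> \<le> 4 * real CARD('n)"
  proof (cases "\<forall>y\<in>U \<union> V. \<bar>P y\<bar> \<le> 1")
    case True
    have m: "2 * q \<le> measure lebesgue (U \<union> V)"
    proof -
      have "measure lebesgue (U \<union> V) = measure lebesgue U + measure lebesgue (V - U)"
        by (rule measure_Un2) (use U V in \<open>auto intro: lmeasurable_compact\<close>)
      moreover have "V - U = V" using disj by blast
      ultimately show ?thesis using q by simp
    qed
    have UV: "compact (U \<union> V)" "U \<union> V \<subseteq> cball 0 1" using U V by (auto intro: compact_Un)
    show ?thesis
    proof (cases "P x0 \<ge> 0")
      case True
      then show ?thesis
        using quadratic_bound_sublevel[OF P n UV q(1) m _ x0] \<open>\<forall>y\<in>U \<union> V. \<bar>P y\<bar> \<le> 1\<close> by auto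
    next
      case False
      then show ?thesis
        using quadratic_bound_sublevel[OF poly_fun_le_uminus[OF P] n UV q(1) m _ x0] \<open>\<forall>y\<in>U \<union> V. \<bar>P y\<bar> \<le> 1\<close> by auto
    qed
  next
    case False
    obtain A B x where AB: "{A, B} = {U, V}" "x \<in> A" "\<bar>P x\<bar> > 1"
      using False that[of U V] that[of V U] by (auto simp: not_le insert_commute)
    have A: "compact A" "A \<subseteq> cball 0 1" "q \<le> measure lebesgue A" "\<And>y. y \<in> frontier A \<Longrightarrow> \<bar>P y\<bar> \<le> 1"
      and B: "compact B" "B \<subseteq> cball 0 1" "q \<le> measure lebesgue B" "\<And>y. y \<in> frontier B \<Longrightarrow> \<bar>P y\<bar> \<le> 1"
      and d: "A \<inter> B = {}"
      using AB(1) U V q front disj by (auto simp: doubleton_eq_iff)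
    obtain z where z: "z \<in> interior A" "((\<forall>y\<in>A. P y \<le> P z) \<and> P z > 1) \<or> ((\<forall>y\<in>A. P z \<le> P y) \<and> P z < - 1)"
      using interior_extremum[OF A(1) continuous_on_poly_fun_le[OF P] AB(2,3) A(4)] by blast
    from z(2) show ?thesis
    proof
      assume "(\<forall>y\<in>A. P y \<le> P z) \<and> P z > 1"
      then show ?thesis
        using peak[OF P A(1,2) B(1,2) d A(4) B(4) z(1) _ _ A(3) B(3)] by blast
    next
      assume "(\<forall>y\<in>A. P z \<le> P y) \<and> P z < - 1"
      then show ?thesis
        using peak[OF poly_fun_le_uminus[OF P] A(1,2) B(1,2) d _ _ z(1) _ _ A(3) B(3)] A(4) B(4) by simp
    qed
  qed
  then have "sqrt \<bar>P x0\<bar> \<le> 4 * real CARD('n) / q" using q(1) by (simp add: field_simps)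
  then have "(sqrt \<bar>P x0\<bar>)\<^sup>2 \<le> (4 * real CARD('n) / q)\<^sup>2" by (intro power_mono) auto
  then show ?thesis by simp
qed

subsection \<open>Remez constants\<close>

lemma poly_fun_le_bound:
  fixes P :: "real ^ 'n \<Rightarrow> real"
  assumes P: "P \<in> poly_fun_le d" and d: "d \<ge> 1" and N: "N = (d - 1) ^ CARD('n) + 1"
    and U: "\<And>j. j \<in> {1..N} \<Longrightarrow> compact (U j)" "\<And>j. j \<in> {1..N} \<Longrightarrow> U j \<subseteq> cball 0 1"
      "\<And>j. j \<in> {1..N} \<Longrightarrow> connected (U j)"
    and disj: "disjoint_family_on U {1..N}"
    and q: "q > 0" "\<And>j. j \<in> {1..N} \<Longrightarrow> q \<le> measure lebesgue (U j)"
    and front: "\<And>j y. j \<in> {1..N} \<Longrightarrow> y \<in> frontier (U j) \<Longrightarrow> \<bar>P y\<bar> \<le> 1"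
    and x0: "x0 \<in> cball 0 1"
  shows "\<bar>P x0\<bar> \<le> (4 * real CARD('n) / q) ^ d"
proof -
  have pos: "CARD('n) \<ge> 1" by (simp add: Suc_leI)
  consider "CARD('n) = 1" | "CARD('n) \<ge> 2" "d = 1" | "CARD('n) \<ge> 2" "d = 2" | "CARD('n) \<ge> 2" "d \<ge> 3"
    using d pos by linarith
  then show ?thesis
  proof cases
    case 1
    then have "card {1..N} = d" using d by (simp add: N)
    then show ?thesis
      by (intro poly_fun_le_bound_dim_1[OF P 1 _ disj _ d U q front x0]) auto
  next
    case 2
    have N1: "1 \<in> {1..N}" by (simp add: N)
    have "\<bar>P x0\<bar> \<le> 4 * real CARD('n) / q"
      using 2 P by (intro poly_fun_le_bound_deg_1[OF _ _ U(1,2)[OF N1] q(1) q(2)[OF N1] front[OF N1] x0]) auto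
    then show ?thesis using 2 by simp
  next
    case 3
    then have N2: "{1..N} = {1, 2}" by (auto simp: N)
    then have "U 1 \<inter> U 2 = {}" using disj by (auto simp: disjoint_family_on_def)
    moreover have N12: "1 \<in> {1..N}" "2 \<in> {1..N}" using N2 by auto
    moreover have "P \<in> poly_fun_le 2" using P 3 by simp
    ultimately have "\<bar>P x0\<bar> \<le> (4 * real CARD('n) / q)\<^sup>2"
      using front[OF N12(1)] front[OF N12(2)]
      by (intro poly_fun_le_bound_deg_2[OF _ 3(1) U(1,2)[OF N12(1)] U(1,2)[OF N12(2)] _ _ q(1) q(2)[OF N12(1)]
            q(2)[OF N12(2)] x0]) auto
    then show ?thesis using 3 by simp
  next
    case 4
    have "card {1..N} = (d - 1) ^ CARD('n) + 1" by (simp add: N)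
    then show ?thesis
      by (intro poly_fun_le_bound_deg_ge_3[OF P 4(2,1) _ disj _ U(1,2) q front x0]) auto
  qed
qed

lemma measure_pos_if_interior_nonempty:
  fixes S :: "(real ^ 'n) set"
  assumes "compact S" "interior S \<noteq> {}"
  shows "measure lebesgue S > 0"
proof -
  obtain x e where e: "e > 0" "ball x e \<subseteq> S"
    using assms(2) by (meson all_not_in_conv mem_interior)
  have "0 < measure lebesgue (ball x e)" using content_ball_pos[OF e(1), of x] by simp
  also have "\<dots> \<le> measure lebesgue S"
    by (rule measure_le_superset[OF e(2) lmeasurable_compact[OF assms(1)]])
  finally show ?thesis .
qed

theorem corollary6p1:
  fixes d N :: nat
    and U :: "nat \<Rightarrow> (real ^ 'n) set"
    and \<mu> :: "nat \<Rightarrow> real"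
    and Z :: "(real ^ 'n) set"
  assumes "d \<ge> 1"
    and "N = (d - 1) ^ CARD('n) + 1"
    and "\<And>j. j \<in> {1..N} \<Longrightarrow> U j \<subseteq> cball 0 1"
    and "\<And>j. j \<in> {1..N} \<Longrightarrow> compact (U j)"
    and "\<And>j. j \<in> {1..N} \<Longrightarrow> connected (U j)"
    and "\<And>j. j \<in> {1..N} \<Longrightarrow> interior (U j) \<noteq> {}"
    and "disjoint_family_on U {1..N}"
    and "\<And>j. j \<in> {1..N} \<Longrightarrow> \<mu> j = measure lebesgue (U j)"
    and "\<And>i j. 1 \<le> i \<Longrightarrow> i \<le> j \<Longrightarrow> j \<le> N \<Longrightarrow> \<mu> j \<le> \<mu> i"
    and "Z = (\<Union>j\<in>{1..N}. frontier (U j))"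
  shows "norming d Z \<and> remez_constant d Z \<le> ennreal ((4 * real CARD('n) / \<mu> N) ^ d)"
proof -
  define C where "C = (4 * real CARD('n) / \<mu> N) ^ d"
  have NN: "N \<in> {1..N}" by (simp add: assms(2))
  have \<mu>N: "\<mu> N > 0"
    using measure_pos_if_interior_nonempty[OF assms(4,6)[OF NN]] assms(8)[OF NN] by simp
  have C0: "C \<ge> 0" using \<mu>N by (simp add: C_def)
  have \<mu>j: "\<mu> N \<le> measure lebesgue (U j)" if "j \<in> {1..N}" for j
    using assms(8)[OF that] assms(9)[of j N] that by simp
  have bound: "\<bar>P x\<bar> \<le> C * s"
    if P: "P \<in> poly_fun_le d" and Z: "\<And>y. y \<in> Z \<Longrightarrow> \<bar>P y\<bar> \<le> s" and s: "s \<ge> 0" and x: "x \<in> cball 0 1" for P s x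
  proof -
    \<comment> \<open>Normalising by some \<open>\<tau> > s\<close> instead of \<open>s\<close>
      avoids a division by zero when \<open>s = 0\<close>; the limit recovers
      \<open>s\<close>.\<close>
    have "\<bar>P x\<bar> \<le> C * \<tau>" if \<tau>: "s < \<tau>" for \<tau>
    proof -
      have "\<bar>(1 / \<tau>) * P x\<bar> \<le> C"
        unfolding C_def
      proof (rule poly_fun_le_bound[OF poly_fun_le_cmult[OF P] assms(1,2,4,3,5,7) \<mu>N \<mu>j _ x])
        fix j y assume "j \<in> {1..N}" "y \<in> frontier (U j)"
        then have "y \<in> Z" unfolding assms(10) by blast
        then show "\<bar>1 / \<tau> * P y\<bar> \<le> 1" using Z \<tau> s by (force simp: abs_mult)
      qed
      then show ?thesis using \<tau> s by (simp add: abs_mult pos_divide_le_eq)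
    qed
    then have "\<bar>P x\<bar> \<le> C * (s + e)" if "e > 0" for e using that by simp
    moreover have "((\<lambda>e. C * (s + e)) \<longlongrightarrow> C * (s + 0)) (at_right 0)" by (intro tendsto_intros)
    ultimately have "\<bar>P x\<bar> \<le> C * (s + 0)"
      by (intro tendsto_lowerbound[of _ _ "at_right 0"]) (auto simp: eventually_at_right_less eventually_at_filter)
    then show ?thesis by simp
  qed
  have Zsub: "Z \<subseteq> cball 0 1"
    using assms(3,4) frontier_subset_closed compact_imp_closed unfolding assms(10) by blast
  have "remez_constant d Z \<le> ennreal C"
    unfolding remez_constant_def
  proof (rule Inf_lower, safe)
    fix P :: "real ^ 'n \<Rightarrow> real" assume P: "P \<in> poly_fun_le d"
    let ?s = "SUP x\<in>Z. ennreal \<bar>P x\<bar>"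
    have "bounded (P ` cball 0 1)"
      by (intro compact_imp_bounded compact_continuous_image continuous_on_poly_fun_le[OF P]) auto
    then obtain B where B: "\<And>x. x \<in> cball 0 1 \<Longrightarrow> \<bar>P x\<bar> \<le> B" unfolding bounded_iff by fastforce
    have "?s \<le> ennreal B" using Zsub B by (intro SUP_least ennreal_leI) auto
    then have fin: "?s < top" using ennreal_less_top le_less_trans by blast
    then obtain s where s: "s \<ge> 0" "?s = ennreal s" by (metis ennreal_cases less_irrefl)
    have "\<bar>P y\<bar> \<le> s" if "y \<in> Z" for y
      using SUP_upper[OF that, of "\<lambda>x. ennreal \<bar>P x\<bar>"] s by simp
    then have "ennreal \<bar>P x\<bar> \<le> ennreal C * ?s" if "x \<in> cball 0 1" for x
      using bound[OF P _ s(1) that] C0 s by (simp add: ennreal_mult'[symmetric] ennreal_leI)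
    then show "(SUP x\<in>cball 0 1. ennreal \<bar>P x\<bar>) \<le> ennreal C * ?s" by (rule SUP_least)
  qed
  moreover from this have "norming d Z"
    unfolding norming_def using ennreal_less_top[of C] le_less_trans by (metis infinity_ennreal_def)
  ultimately show ?thesis by (simp add: C_def)
qed

end
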